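(* Let $\mathcal{A}\in\mathbb{R}^{I_1\times\cdots\times I_N}$, let $\mu_0=1$, and let $\mu_1,\dots,\mu_{N-1}$, $R$, $I_1,\dots,I_N$ be positive integers such that for each $n=1,\dots,N-1$: $\mu_n<\mu_n+R<\min\{\mu_{n-1}I_n,\,I_{n+1}\cdots I_N\}$ and $\mu_n+R>(1+1/\ln(\mu_n))\mu_n$. Let $\mathcal{Q}_1,\dots,\mathcal{Q}_N$ be produced by the randomized TT algorithm described in the context (with $q=0$), where for each $n$ the matrix $\mathbf{\Omega}_n\in\mathbb{R}^{I_{n+1}\cdots I_N\times(\mu_n+R)}$ is a standard Gaussian matrix. Let $a_n,a_n',b_n,b_n'$ be the constants specified in the context. Then the inequality $$\|\mathcal{A}-\mathcal{Q}_1\times_{2}^1\mathcal{Q}_2\times_{3}^1\cdots\times_{3}^1\mathcal{Q}_N\|_F\le 2\sum_{n=1}^{N-1}\alpha_n\,\Delta_{\mu_n+1}(\mathbf{A}_{([n])})$$ holds with probability at least $$1-\sum_{n=1}^{N-1}\bigl(\exp(-b_n'(\mu_n+R))+\exp(-a_n'I_{n+1}\cdots I_N)\bigr),$$ where $$\alpha_n=1+\sqrt{\frac{a_n^2I_{n+1}\cdots I_N}{b_n^2(\mu_n+R)}}+\sqrt{\frac{a_n^2I_{n+1}\cdots I_N}{b_n^2(\mu_n+R)}}.$$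
   Context: Norms and unfoldings. $\|\cdot\|_F$ is the Frobenius norm (square root of the sum of squared entries). $\sigma_i(\cdot)$ is the $i$-th largest singular value. For a matrix $\mathbf{M}$ with $p$ rows and $r$ columns, $\Delta_{k}(\mathbf{M})=\bigl(\sum_{i=k}^{\min\{p,r\}}\sigma_i(\mathbf{M})^2\bigr)^{1/2}$. The matrix $\mathbf{A}_{([n])}\in\mathbb{R}^{I_1\cdots I_n\times I_{n+1}\cdots I_N}$ is the unfolding of $\mathcal{A}$ whose rows are indexed by $(i_1,\dots,i_n)$ and columns by $(i_{n+1},\dots,i_N)$, both in column-major (first index fastest) order; "reshape" always preserves column-major order of entries. Tensor train product. For $\mathcal{Q}_1\in\mathbb{R}^{I_1\times\mu_1}$, $\mathcal{Q}_n\in\mathbb{R}^{\mu_{n-1}\times I_n\times\mu_n}$ ($2\le n\le N-1$), $\mathcal{Q}_N\in\mathbb{R}^{\mu_{N-1}\times I_N}$, the tensor $\mathcal{Q}_1\times_2^1\mathcal{Q}_2\times_3^1\cdots\times_3^1\mathcal{Q}_N\in\mathbb{R}^{I_1\times\cdots\times I_N}$ has entries $\sum_{j_1=1}^{\mu_1}\cdots\sum_{j_{N-1}=1}^{\mu_{N-1}}\mathcal{Q}_1(i_1,j_1)\mathcal{Q}_2(j_1,i_2,j_2)\cdots\mathcal{Q}_N(j_{N-1},i_N)$. Algorithm ($q=0$). Let $\mathbf{A}_1=\mathbf{A}_{([1])}$. For $n=1,\dots,N-1$ successively: (i) if $n\ge 2$, let $\mathbf{A}_n$ be $\mathbf{Q}_{n-1}^\top\mathbf{A}_{n-1}$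 reshaped to size $\mu_{n-1}I_n\times I_{n+1}\cdots I_N$; (ii) generate the random matrix $\mathbf{\Omega}_n$ (independently of the previous ones) and set $\mathbf{Z}_n=\mathbf{A}_n\mathbf{\Omega}_n$; (iii) choose $\mathbf{Q}_n\in\mathbb{R}^{\mu_{n-1}I_n\times\mu_n}$ with $\mathbf{Q}_n^\top\mathbf{Q}_n=\mathbf{I}_{\mu_n}$ such that there exists $\mathbf{S}_n\in\mathbb{R}^{\mu_n\times(\mu_n+R)}$ with $\|\mathbf{Q}_n\mathbf{S}_n-\mathbf{Z}_n\|_F=\Delta_{\mu_n+1}(\mathbf{Z}_n)$ (for example, the first $\mu_n$ left singular vectors of $\mathbf{Z}_n$); (iv) let $\mathcal{Q}_n$ be $\mathbf{Q}_n$ reshaped to size $\mu_{n-1}\times I_n\times\mu_n$ (with $\mathcal{Q}_1=\mathbf{Q}_1$). Finally $\mathcal{Q}_N=\mathbf{Q}_{N-1}^\top\mathbf{A}_{N-1}$ reshaped to size $\mu_{N-1}\times I_N$. A standard Gaussian matrix has independent $N(0,1)$ entries. Constants. For each $n$, $a_n'>0$ and $\tau\ge1$ are given, and $a_n=6\tau\sqrt{a_n'+4}$; this is the constant in the known bound $\mathbf{P}(\|\mathbf{\Omega}\|_2>a\sqrt{J})\le\exp(-a'J)$, $a=6\tau\sqrt{a'+4}$, for random sub-Gaussian $I\times J$ matrices, $I\le J$. The numbers $b_n,b_n'>0$ are constants such that a standard Gaussian matrix $\mathbf{G}\in\mathbb{R}^{\mu_n\times(\mu_n+R)}$ satisfies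 $\mathbf{P}(\sigma_{\mu_n}(\mathbf{G})\le b_n\sqrt{\mu_n+R})\le\exp(-b_n'(\mu_n+R))$ (such constants exist by a known theorem when $\mu_n+R>(1+1/\ln(\mu_n))\mu_n$). *)

theory Defs
  imports
    "HOL-Probability.Probability"
    "Jordan_Normal_Form.Char_Poly"
    "HOL-Computational_Algebra.Polynomial"
begin

text \<open>
  Modes are numbered \<open>1, \<dots>, N\<close> as in the mathematical text, while all array indices
  (rows and columns of matrices, and the entries \<open>i k\<close> of a multi-index \<open>i\<close>) start at \<open>0\<close>.
  A tensor of size \<open>I 1 \<times> \<dots> \<times> I N\<close> is a function on multi-indices, of which only the values
  on \<open>multi_indices I {1..N}\<close> matter.
\<close>

type_synonym tensor = "(nat \<Rightarrow> nat) \<Rightarrow> real"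

definition multi_indices :: "(nat \<Rightarrow> nat) \<Rightarrow> nat set \<Rightarrow> (nat \<Rightarrow> nat) set" where
  "multi_indices I K = (\<Pi>\<^sub>E k\<in>K. {..<I k})"

definition tensor_frob_norm :: "(nat \<Rightarrow> nat) \<Rightarrow> nat \<Rightarrow> tensor \<Rightarrow> real" where
  "tensor_frob_norm I N A = sqrt (\<Sum>i\<in>multi_indices I {1..N}. (A i)\<^sup>2)"

definition frob_norm :: "real mat \<Rightarrow> real" where
  "frob_norm M = sqrt (\<Sum>i<dim_row M. \<Sum>j<dim_col M. (M $$ (i, j))\<^sup>2)"

text \<open>
  The singular values are the square roots of the eigenvalues of \<open>M\<^sup>T M\<close>, listed in decreasing
  order with multiplicity. This list has length \<open>dim_col M\<close>; its entries beyond position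
  \<open>min (dim_row M) (dim_col M)\<close> are zeros that are not counted as singular values.
\<close>

definition sing_val_list :: "real mat \<Rightarrow> real list" where
  "sing_val_list M =
     rev (sorted_list_of_multiset (image_mset sqrt (proots (char_poly (transpose_mat M * M)))))"

text \<open>The \<open>i\<close>-th largest singular value, for \<open>1 \<le> i \<le> min (dim_row M) (dim_col M)\<close>.\<close>

definition sing_val :: "nat \<Rightarrow> real mat \<Rightarrow> real" where
  "sing_val i M = sing_val_list M ! (i - 1)"

definition sv_tail :: "nat \<Rightarrow> real mat \<Rightarrow> real" where
  "sv_tail k M = sqrt (\<Sum>i = k..min (dim_row M) (dim_col M). (sing_val i M)\<^sup>2)"

text \<open>
  In the column-major order of the multi-indices for the modes \<open>m, m + 1, \<dots>\<close>, the
  multi-index \<open>i\<close> has position \<open>x = i m + I m * i (m+1) + I m * I (m+1) * i (m+2) + \<dots>\<close>;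
  \<open>col_major_index I m x k\<close> recovers \<open>i k\<close> from \<open>x\<close>.
\<close>

definition col_major_index :: "(nat \<Rightarrow> nat) \<Rightarrow> nat \<Rightarrow> nat \<Rightarrow> nat \<Rightarrow> nat" where
  "col_major_index I m x k = (x div (\<Prod>l = m..<k. I l)) mod I k"

definition unfolding_mat :: "(nat \<Rightarrow> nat) \<Rightarrow> nat \<Rightarrow> nat \<Rightarrow> tensor \<Rightarrow> real mat" where
  "unfolding_mat I N n A =
     Matrix.mat (\<Prod>k = 1..n. I k) (\<Prod>k = n+1..N. I k)
       (\<lambda>(x, y). A (\<lambda>k\<in>{1..N}. if k \<le> n then col_major_index I 1 x k
                                else col_major_index I (n+1) y k))"

text \<open>
  Meant for \<open>p * r = dim_row M * dim_col M\<close>. The entry \<open>(x, y)\<close> of a matrix with \<open>p\<close> rows is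
  at the column-major position \<open>x + p * y\<close>.
\<close>

definition reshape_mat :: "nat \<Rightarrow> nat \<Rightarrow> real mat \<Rightarrow> real mat" where
  "reshape_mat p r M =
     Matrix.mat p r (\<lambda>(x, y). M $$ ((x + p * y) mod dim_row M, (x + p * y) div dim_row M))"

text \<open>
  The column-major reshaping of \<open>Q\<close>, of size \<open>p I \<times> \<mu>\<close>, to a tensor of size \<open>p \<times> I \<times> \<mu>\<close>.
\<close>

definition reshape_core :: "nat \<Rightarrow> real mat \<Rightarrow> nat \<Rightarrow> nat \<Rightarrow> nat \<Rightarrow> real" where
  "reshape_core p Q j i l = Q $$ (j + p * i, l)"

text \<open>
  The tensor train product for \<open>N \<ge> 2\<close>: \<open>Q1\<close> is the first core, \<open>C 2, \<dots>, C (N-1)\<close> are the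
  third-order cores and \<open>QN\<close> is the last one.
\<close>

definition tt_product ::
  "nat \<Rightarrow> (nat \<Rightarrow> nat) \<Rightarrow> real mat \<Rightarrow> (nat \<Rightarrow> nat \<Rightarrow> nat \<Rightarrow> nat \<Rightarrow> real) \<Rightarrow> real mat \<Rightarrow> tensor" where
  "tt_product N \<mu> Q1 C QN i =
     (\<Sum>j\<in>multi_indices \<mu> {1..N-1}.
        Q1 $$ (i 1, j 1) * (\<Prod>n = 2..N-1. C n (j (n-1)) (i n) (j n)) * QN $$ (j (N-1), i N))"

text \<open>
  \<open>rand_tt_run I N \<mu> R A \<Omega> As Q\<close> says that \<open>As n\<close> and \<open>Q n\<close> (for \<open>1 \<le> n \<le> N - 1\<close>) are
  obtained from the tensor \<open>A\<close> and the test matrices \<open>\<Omega> n\<close> by a run of the randomized tensor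
  train algorithm without power iterations. The matrix \<open>Q n\<close> is any matrix satisfying
  the requirement of the algorithm.
\<close>

definition rand_tt_run ::
  "(nat \<Rightarrow> nat) \<Rightarrow> nat \<Rightarrow> (nat \<Rightarrow> nat) \<Rightarrow> nat \<Rightarrow> tensor \<Rightarrow>
     (nat \<Rightarrow> real mat) \<Rightarrow> (nat \<Rightarrow> real mat) \<Rightarrow> (nat \<Rightarrow> real mat) \<Rightarrow> bool" where
  "rand_tt_run I N \<mu> R A \<Omega> As Q \<longleftrightarrow>
     As 1 = unfolding_mat I N 1 A \<and>
     (\<forall>n\<in>{2..N-1}. As n = reshape_mat (\<mu> (n-1) * I n) (\<Prod>k = n+1..N. I k)
                              (transpose_mat (Q (n-1)) * As (n-1))) \<and>
     (\<forall>n\<in>{1..N-1}.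
        Q n \<in> carrier_mat (\<mu> (n-1) * I n) (\<mu> n) \<and>
        transpose_mat (Q n) * Q n = 1\<^sub>m (\<mu> n) \<and>
        (let Z = As n * \<Omega> n in
           \<exists>S\<in>carrier_mat (\<mu> n) (\<mu> n + R). frob_norm (Q n * S - Z) = sv_tail (\<mu> n + 1) Z))"

definition rand_tt_output ::
  "(nat \<Rightarrow> nat) \<Rightarrow> nat \<Rightarrow> (nat \<Rightarrow> nat) \<Rightarrow> (nat \<Rightarrow> real mat) \<Rightarrow> (nat \<Rightarrow> real mat) \<Rightarrow> tensor" where
  "rand_tt_output I N \<mu> As Q =
     tt_product N \<mu> (Q 1) (\<lambda>n. reshape_core (\<mu> (n-1)) (Q n))
       (reshape_mat (\<mu> (N-1)) (I N) (transpose_mat (Q (N-1)) * As (N-1)))"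

definition random_matrix :: "'w measure \<Rightarrow> nat \<Rightarrow> nat \<Rightarrow> ('w \<Rightarrow> real mat) \<Rightarrow> bool" where
  "random_matrix P p r X \<longleftrightarrow>
     (\<forall>\<omega>\<in>space P. X \<omega> \<in> carrier_mat p r) \<and>
     (\<forall>i<p. \<forall>j<r. (\<lambda>\<omega>. X \<omega> $$ (i, j)) \<in> borel_measurable P)"

definition std_gaussian_matrix :: "'w measure \<Rightarrow> nat \<Rightarrow> nat \<Rightarrow> ('w \<Rightarrow> real mat) \<Rightarrow> bool" where
  "std_gaussian_matrix P p r X \<longleftrightarrow>
     random_matrix P p r X \<and>
     (\<forall>i<p. \<forall>j<r. distributed P lborel (\<lambda>\<omega>. X \<omega> $$ (i, j)) std_normal_density) \<and>
     prob_space.indep_vars P (\<lambda>_. borel) (\<lambda>(i, j) \<omega>. X \<omega> $$ (i, j)) ({..<p} \<times> {..<r})"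

definition entry_events :: "'w measure \<Rightarrow> nat \<Rightarrow> nat \<Rightarrow> ('w \<Rightarrow> real mat) \<Rightarrow> 'w set set" where
  "entry_events P p r X =
     {(\<lambda>\<omega>. X \<omega> $$ (i, j)) -` B \<inter> space P | i j B. i < p \<and> j < r \<and> B \<in> sets borel}"

text \<open>
  The events known before \<open>\<Omega> n\<close> is drawn: the sigma-algebra generated by \<open>\<Omega> k\<close> and \<open>Q k\<close>
  for \<open>1 \<le> k < n\<close>. The \<open>Q k\<close> must be included because the algorithm does not determine them
  uniquely: otherwise the choice of \<open>Q k\<close> could anticipate a later \<open>\<Omega> n\<close>. If every \<open>Q k\<close> is a
  measurable function of \<open>\<Omega> 1, \<dots>, \<Omega> k\<close>, this is the sigma-algebra generated by
  \<open>\<Omega> 1, \<dots>, \<Omega> (n-1)\<close>.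
\<close>

definition past_events ::
  "'w measure \<Rightarrow> (nat \<Rightarrow> nat) \<Rightarrow> nat \<Rightarrow> (nat \<Rightarrow> nat) \<Rightarrow> nat \<Rightarrow>
     (nat \<Rightarrow> 'w \<Rightarrow> real mat) \<Rightarrow> (nat \<Rightarrow> 'w \<Rightarrow> real mat) \<Rightarrow> nat \<Rightarrow> 'w set set" where
  "past_events P I N \<mu> R \<Omega> Q n =
     sigma_sets (space P)
       (\<Union>k\<in>{1..<n}. entry_events P (\<Prod>l = k+1..N. I l) (\<mu> k + R) (\<Omega> k)
                    \<union> entry_events P (\<mu> (k-1) * I k) (\<mu> k) (Q k))"

definition drawn_events ::
  "'w measure \<Rightarrow> (nat \<Rightarrow> nat) \<Rightarrow> nat \<Rightarrow> (nat \<Rightarrow> nat) \<Rightarrow> nat \<Rightarrow>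
     (nat \<Rightarrow> 'w \<Rightarrow> real mat) \<Rightarrow> nat \<Rightarrow> 'w set set" where
  "drawn_events P I N \<mu> R \<Omega> n =
     sigma_sets (space P) (entry_events P (\<Prod>l = n+1..N. I l) (\<mu> n + R) (\<Omega> n))"

end

theory Submission
  imports Defs
begin

text \<open>
  The error of the output splits into the errors of the single compressions. Let \<open>U n\<close> be the \<open>n\<close>-th unfolding of
  \<open>A\<close> and \<open>L n\<close> the matrix formed by the first \<open>n\<close> cores (\<open>left_frame\<close>). All \<open>L n\<close> have orthonormal
  columns, and \<open>As n = K n\<^sup>T U n\<close>, where \<open>K n\<close> is the block diagonal matrix with blocks \<open>L (n - 1)\<close>
  (\<open>compressed_unfolding\<close>). The last unfolding of the output is the projection \<open>L L\<^sup>T U\<close> with \<open>L = L (N - 1)\<close>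
  (\<open>unfolded_output\<close>). Going from \<open>U n - L n L n\<^sup>T U n\<close> to the next \<open>n\<close> only adds the error of one compression, so the
  total error is at most the sum of the \<open>\<parallel>As n - Q n Q n\<^sup>T As n\<parallel>\<close> (\<open>compression_error\<close>).

  For one compression, let \<open>V\<close> consist of the first \<open>\<mu> n\<close> right singular vectors of \<open>U n\<close>, and let
  \<open>\<Delta> = \<parallel>U n - U n V V\<^sup>T\<parallel>\<close>, the tail of the singular values of \<open>U n\<close>. Since \<open>K n\<close> is an isometry, also
  \<open>\<parallel>As n - As n V V\<^sup>T\<parallel> \<le> \<Delta>\<close>. If the least singular value of \<open>V\<^sup>T \<Omega> n\<close> exceeds \<open>c\<close> and the spectral norm of
  \<open>\<Omega> n\<close> is at most \<open>K\<close>, then a right inverse of \<open>V\<^sup>T \<Omega> n\<close> recovers \<open>As n V V\<^sup>T\<close> from the sketch \<open>As n \<Omega> n\<close>,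
  and the compression error is at most \<open>(1 + 2 K / c) \<Delta>\<close> (\<open>range_finder_error\<close>). For \<open>K = a n sqrt (r n)\<close>, with
  the number \<open>r n\<close> of columns of \<open>U n\<close>, and \<open>c = b n sqrt (\<mu> n + R)\<close>, this is \<open>\<alpha> n \<Delta>\<close>.

  The matrix \<open>V\<close> depends only on \<open>A\<close>. Hence \<open>V\<^sup>T \<Omega> n\<close> is again a standard Gaussian matrix
  (\<open>std_gaussian_matrix_rotated_law\<close>), and the assumption on \<open>b n\<close> and \<open>b' n\<close> bounds the probability that its least singular
  value is at most \<open>c\<close>. The spectral norm of \<open>\<Omega> n\<close> is controlled by a net argument
  (\<open>std_gaussian_matrix_op_norm_tail\<close>). A union bound over the \<open>2 (N - 1)\<close> exceptional events gives the theorem.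

  The argument rests on the spectral theorem for real symmetric matrices, on both halves of the Eckart--Young theorem,
  and on the principle that the characteristic function of a random vector decides whether its entries are
  independent standard normal variables. The last one follows from Levy's one-dimensional uniqueness theorem.
\<close>

section \<open>Frobenius norm and orthogonal projections\<close>

definition frob_inner :: "real mat \<Rightarrow> real mat \<Rightarrow> real" where
  "frob_inner M M' = (\<Sum>i<dim_row M. \<Sum>j<dim_col M. M $$ (i, j) * M' $$ (i, j))"

lemma mult_mat_entry:
  fixes M :: "real mat"
  assumes "M \<in> carrier_mat p q" "M' \<in> carrier_mat q r" "i < p" "j < r"
  shows "(M * M') $$ (i, j) = (\<Sum>k<q. M $$ (i, k) * M' $$ (k, j))"
  using assms by (auto simp: scalar_prod_def row_def lessThan_atLeast0 intro!: sum.cong)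

lemma frob_inner_carrier:
  assumes "M \<in> carrier_mat p r"
  shows "frob_inner M M' = (\<Sum>i<p. \<Sum>j<r. M $$ (i, j) * M' $$ (i, j))"
  using assms by (simp add: frob_inner_def)

lemma frob_norm_nonneg: "0 \<le> frob_norm M"
  by (simp add: frob_norm_def sum_nonneg)

lemma frob_norm_sq: "(frob_norm M)\<^sup>2 = frob_inner M M"
  by (simp add: frob_norm_def frob_inner_def sum_nonneg power2_eq_square)

lemma frob_norm_eq_sqrt: "frob_norm M = sqrt (frob_inner M M)"
  by (simp add: frob_norm_def frob_inner_def power2_eq_square)

lemma frob_norm_L2_set:
  assumes "M \<in> carrier_mat p r"
  shows "frob_norm M = L2_set (\<lambda>x. M $$ x) ({..<p} \<times> {..<r})"
  using assms by (simp add: frob_norm_def L2_set_def sum.cartesian_product)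

lemma frob_inner_le:
  assumes "M \<in> carrier_mat p r" "M' \<in> carrier_mat p r"
  shows "frob_inner M M' \<le> frob_norm M * frob_norm M'"
proof -
  have "frob_inner M M' = (\<Sum>x\<in>{..<p} \<times> {..<r}. M $$ x * M' $$ x)"
    using assms by (simp add: frob_inner_carrier sum.cartesian_product case_prod_beta')
  also have "\<dots> \<le> (\<Sum>x\<in>{..<p} \<times> {..<r}. \<bar>M $$ x\<bar> * \<bar>M' $$ x\<bar>)"
    by (intro sum_mono) (metis abs_ge_self abs_mult)
  also have "\<dots> \<le> frob_norm M * frob_norm M'"
    unfolding frob_norm_L2_set[OF assms(1)] frob_norm_L2_set[OF assms(2)] by (rule L2_set_mult_ineq)
  finally show ?thesis .
qed

lemma frob_norm_triangle:
  assumes "M \<in> carrier_mat p r" "M' \<in> carrier_mat p r"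
  shows "frob_norm (M + M') \<le> frob_norm M + frob_norm M'"
proof -
  have "frob_norm (M + M') = L2_set (\<lambda>x. M $$ x + M' $$ x) ({..<p} \<times> {..<r})"
    using assms by (subst frob_norm_L2_set[of _ p r]) (auto intro!: L2_set_cong)
  then show ?thesis
    unfolding frob_norm_L2_set[OF assms(1)] frob_norm_L2_set[OF assms(2)] by (simp add: L2_set_triangle_ineq)
qed

lemma frob_inner_transpose:
  assumes "M \<in> carrier_mat p r" "M' \<in> carrier_mat p r"
  shows "frob_inner M\<^sup>T M'\<^sup>T = frob_inner M M'"
proof -
  have "frob_inner M\<^sup>T M'\<^sup>T = (\<Sum>i<r. \<Sum>j<p. M $$ (j, i) * M' $$ (j, i))"
    by (subst frob_inner_carrier[of _ r p]) (use assms in auto)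
  also have "\<dots> = frob_inner M M'"
    unfolding frob_inner_carrier[OF assms(1)] by (rule sum.swap)
  finally show ?thesis .
qed

lemma frob_norm_transpose: "frob_norm M\<^sup>T = frob_norm M"
  by (simp add: frob_norm_eq_sqrt frob_inner_transpose[OF carrier_matI[OF refl refl] carrier_matI[OF refl refl]])

text \<open>Multiplication by \<open>M\<close> and by \<open>M\<^sup>T\<close> are adjoint for the Frobenius inner product. Isometries, projections and
  operator bounds are all handled through this identity.\<close>

lemma frob_inner_adjoint:
  assumes M: "M \<in> carrier_mat p q" and X: "X \<in> carrier_mat q r" and Y: "Y \<in> carrier_mat p r"
  shows "frob_inner (M * X) Y = frob_inner X (M\<^sup>T * Y)"
proof -
  have "frob_inner (M * X) Y = (\<Sum>i<p. \<Sum>j<r. (\<Sum>k<q. M $$ (i, k) * X $$ (k, j)) * Y $$ (i, j))"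
    by (subst frob_inner_carrier[of _ p r])
      (use M X in \<open>auto simp: mult_mat_entry[OF M X] simp del: index_mult_mat(1)\<close>)
  also have "\<dots> = (\<Sum>i<p. \<Sum>j<r. \<Sum>k<q. X $$ (k, j) * (M $$ (i, k) * Y $$ (i, j)))"
    by (simp add: sum_distrib_left sum_distrib_right mult_ac)
  also have "\<dots> = (\<Sum>i<p. \<Sum>k<q. \<Sum>j<r. X $$ (k, j) * (M $$ (i, k) * Y $$ (i, j)))"
    by (intro sum.cong refl sum.swap)
  also have "\<dots> = (\<Sum>k<q. \<Sum>i<p. \<Sum>j<r. X $$ (k, j) * (M $$ (i, k) * Y $$ (i, j)))"
    by (rule sum.swap)
  also have "\<dots> = (\<Sum>k<q. \<Sum>j<r. \<Sum>i<p. X $$ (k, j) * (M $$ (i, k) * Y $$ (i, j)))"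
    by (intro sum.cong refl sum.swap)
  also have "\<dots> = (\<Sum>k<q. \<Sum>j<r. X $$ (k, j) * (\<Sum>i<p. M $$ (i, k) * Y $$ (i, j)))"
    by (simp add: sum_distrib_left)
  also have "\<dots> = frob_inner X (M\<^sup>T * Y)"
    unfolding frob_inner_carrier[OF X] using M
    by (intro sum.cong refl) (simp add: mult_mat_entry[OF _ Y, of _ q] del: index_mult_mat(1))
  finally show ?thesis .
qed

text \<open>For \<open>K \<ge> 0\<close> this is the bound \<open>K\<close> on the spectral norm. Testing with matrices instead of vectors makes it
  apply directly to Frobenius norms of products.\<close>

definition op_bounded :: "real mat \<Rightarrow> real \<Rightarrow> bool" where
  "op_bounded M K \<longleftrightarrow> (\<forall>r. \<forall>X\<in>carrier_mat (dim_col M) r. frob_norm (M * X) \<le> K * frob_norm X)"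

lemma op_boundedD:
  assumes "op_bounded M K" "M \<in> carrier_mat p q" "X \<in> carrier_mat q r"
  shows "frob_norm (M * X) \<le> K * frob_norm X"
  using assms unfolding op_bounded_def by auto

text \<open>For \<open>X = M\<^sup>T Y\<close> the adjoint identity and Cauchy--Schwarz give
  \<open>\<parallel>X\<parallel>\<^sup>2 = \<langle>M X, Y\<rangle> \<le> K \<parallel>X\<parallel> \<parallel>Y\<parallel>\<close>.\<close>

lemma op_bounded_transpose:
  assumes "op_bounded M K" and "0 \<le> K"
  shows "op_bounded M\<^sup>T K"
  unfolding op_bounded_def
proof (intro allI ballI)
  fix r and Y :: "real mat" assume Y: "Y \<in> carrier_mat (dim_col M\<^sup>T) r"
  define X where "X = M\<^sup>T * Y"
  have X: "X \<in> carrier_mat (dim_col M) r" and Y': "Y \<in> carrier_mat (dim_row M) r"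
    and M: "M \<in> carrier_mat (dim_row M) (dim_col M)"
    using Y by (auto simp: X_def)
  have MX: "M * X \<in> carrier_mat (dim_row M) r"
    using X by auto
  have "(frob_norm X)\<^sup>2 = frob_inner (M * X) Y"
    using frob_inner_adjoint[OF M X Y'] by (simp add: frob_norm_sq X_def)
  also have "\<dots> \<le> frob_norm (M * X) * frob_norm Y"
    by (rule frob_inner_le[OF MX Y'])
  also have "\<dots> \<le> (K * frob_norm X) * frob_norm Y"
    by (intro mult_right_mono op_boundedD[OF assms(1) M X] frob_norm_nonneg)
  finally have "frob_norm X * frob_norm X \<le> frob_norm X * (K * frob_norm Y)"
    by (simp add: power2_eq_square mult_ac)
  moreover have "0 \<le> K * frob_norm Y"
    using assms(2) frob_norm_nonneg by simp
  ultimately show "frob_norm (M\<^sup>T * Y) \<le> K * frob_norm Y"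
    unfolding X_def[symmetric]
    by (metis frob_norm_nonneg mult_le_cancel_left_pos order_le_less)
qed

lemma op_bounded_right:
  assumes "op_bounded M K" "0 \<le> K" "M \<in> carrier_mat q r" "X \<in> carrier_mat p q"
  shows "frob_norm (X * M) \<le> K * frob_norm X"
proof -
  have "frob_norm (M\<^sup>T * X\<^sup>T) \<le> K * frob_norm X\<^sup>T"
    by (rule op_boundedD[OF op_bounded_transpose[OF assms(1,2)]]) (use assms in auto)
  then show ?thesis
    using transpose_mult[OF assms(4,3)] frob_norm_transpose[of "X * M"] by (simp add: frob_norm_transpose)
qed

lemma op_bounded_mult:
  assumes "op_bounded M K" "op_bounded M' K'" "0 \<le> K" "M \<in> carrier_mat p q" "M' \<in> carrier_mat q r"
  shows "op_bounded (M * M') (K * K')"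
  unfolding op_bounded_def
proof (intro allI ballI)
  fix s and X :: "real mat" assume "X \<in> carrier_mat (dim_col (M * M')) s"
  then have X: "X \<in> carrier_mat r s" using assms(5) by simp
  have "frob_norm (M * M' * X) = frob_norm (M * (M' * X))"
    using assoc_mult_mat[OF assms(4,5) X] by simp
  also have "\<dots> \<le> K * frob_norm (M' * X)"
    by (rule op_boundedD[OF assms(1,4)]) (use assms X in auto)
  also have "\<dots> \<le> K * (K' * frob_norm X)"
    by (intro mult_left_mono op_boundedD[OF assms(2,5) X] assms)
  finally show "frob_norm (M * M' * X) \<le> K * K' * frob_norm X" by simp
qed

lemma frob_norm_isometry:
  assumes "U \<in> carrier_mat p k" "U\<^sup>T * U = 1\<^sub>m k" "X \<in> carrier_mat k r"
  shows "frob_norm (U * X) = frob_norm X"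
proof -
  have "frob_inner (U * X) (U * X) = frob_inner X (U\<^sup>T * (U * X))"
    by (rule frob_inner_adjoint[OF assms(1,3)]) (use assms in auto)
  also have "U\<^sup>T * (U * X) = U\<^sup>T * U * X"
    using assms by (intro assoc_mult_mat[symmetric, of _ k p _ k _ r]) auto
  finally show ?thesis using assms by (simp add: frob_norm_eq_sqrt)
qed

lemma op_bounded_isometry:
  assumes "U \<in> carrier_mat p k" "U\<^sup>T * U = 1\<^sub>m k"
  shows "op_bounded U 1"
  unfolding op_bounded_def
proof (intro allI ballI)
  fix r and X :: "real mat" assume "X \<in> carrier_mat (dim_col U) r"
  then have "X \<in> carrier_mat k r" using assms(1) by simp
  from frob_norm_isometry[OF assms this] show "frob_norm (U * X) \<le> 1 * frob_norm X" by simp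
qed

lemma op_bounded_transpose_isometry:
  assumes "U \<in> carrier_mat p k" "U\<^sup>T * U = 1\<^sub>m k"
  shows "op_bounded U\<^sup>T 1"
  by (rule op_bounded_transpose[OF op_bounded_isometry[OF assms]]) simp

lemma op_bounded_symmetric_projection:
  assumes E: "E \<in> carrier_mat p p" "E\<^sup>T = E" "E * E = E"
  shows "op_bounded E 1"
  unfolding op_bounded_def
proof (intro allI ballI)
  fix r and X :: "real mat" assume "X \<in> carrier_mat (dim_col E) r"
  then have X: "X \<in> carrier_mat p r" using E(1) by simp
  have EX: "E * X \<in> carrier_mat p r" using E(1) X by auto
  have "(frob_norm (E * X))\<^sup>2 = frob_inner X (E * (E * X))"
    using frob_inner_adjoint[OF E(1) X EX] E(2) by (simp add: frob_norm_sq)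
  also have "E * (E * X) = E * X"
    using assoc_mult_mat[OF E(1,1) X] E(3) by simp
  also have "frob_inner X (E * X) \<le> frob_norm X * frob_norm (E * X)"
    by (rule frob_inner_le[OF X EX])
  finally have "frob_norm (E * X) * frob_norm (E * X) \<le> frob_norm X * frob_norm (E * X)"
    by (simp add: power2_eq_square)
  then have "frob_norm (E * X) \<le> frob_norm X"
    using frob_norm_nonneg[of "E * X"] frob_norm_nonneg[of X]
    by (metis mult_le_cancel_right_pos order_le_less)
  then show "frob_norm (E * X) \<le> 1 * frob_norm X" by simp
qed

lemma symmetric_projection_complement:
  fixes E :: "real mat"
  assumes E: "E \<in> carrier_mat p p" "E\<^sup>T = E" "E * E = E"
  shows "(1\<^sub>m p - E)\<^sup>T = 1\<^sub>m p - E" "(1\<^sub>m p - E) * (1\<^sub>m p - E) = 1\<^sub>m p - E"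
proof -
  show "(1\<^sub>m p - E)\<^sup>T = 1\<^sub>m p - E"
    using transpose_minus[of "1\<^sub>m p" p p E] E by simp
  have "(1\<^sub>m p - E) * (1\<^sub>m p - E) = (1\<^sub>m p - E) * 1\<^sub>m p - (1\<^sub>m p - E) * E"
    using E(1) by (intro mult_minus_distrib_mat[of _ p p _ p]) auto
  also have "(1\<^sub>m p - E) * E = 1\<^sub>m p * E - E * E"
    using E(1) by (intro minus_mult_distrib_mat[of _ p p _ _ p]) auto
  also have "\<dots> = 0\<^sub>m p p" using E(1,3) by simp
  finally show "(1\<^sub>m p - E) * (1\<^sub>m p - E) = 1\<^sub>m p - E" using E(1) by auto
qed

lemma projection_of_isometry:
  fixes U :: "real mat"
  assumes U: "U \<in> carrier_mat p k" "U\<^sup>T * U = 1\<^sub>m k"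
  shows "(U * U\<^sup>T)\<^sup>T = U * U\<^sup>T"
    "(U * U\<^sup>T) * (U * U\<^sup>T) = U * U\<^sup>T"
proof -
  have T: "U\<^sup>T \<in> carrier_mat k p" using U(1) by auto
  show "(U * U\<^sup>T)\<^sup>T = U * U\<^sup>T"
    using transpose_mult[OF U(1) T] by simp
  have "(U * U\<^sup>T) * (U * U\<^sup>T) = U * (U\<^sup>T * (U * U\<^sup>T))"
    using U(1) T by (intro assoc_mult_mat[of _ p k _ p _ p]) auto
  also have "U\<^sup>T * (U * U\<^sup>T) = U\<^sup>T * U * U\<^sup>T"
    using U(1) T by (intro assoc_mult_mat[symmetric, of _ k p _ k _ p]) auto
  also have "\<dots> = U\<^sup>T" using U T by auto
  finally show "(U * U\<^sup>T) * (U * U\<^sup>T) = U * U\<^sup>T" .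
qed

text \<open>\<open>1 - Q Q\<^sup>T\<close> annihilates \<open>Q T\<close> and is an orthogonal projection: applied to \<open>M - Q T\<close> it
  yields the left-hand side and does not increase the norm.\<close>

lemma orthogonal_projection_best:
  assumes Q: "Q \<in> carrier_mat p k" "Q\<^sup>T * Q = 1\<^sub>m k"
    and M: "M \<in> carrier_mat p r" and T: "T \<in> carrier_mat k r"
  shows "frob_norm (M - Q * (Q\<^sup>T * M)) \<le> frob_norm (M - Q * T)"
proof -
  define E where "E = Q * Q\<^sup>T"
  have Qt: "Q\<^sup>T \<in> carrier_mat k p" using Q(1) by auto
  have E: "E \<in> carrier_mat p p" using Q(1) by (auto simp: E_def)
  note EE = projection_of_isometry[OF Q, folded E_def]
  have D: "M - Q * T \<in> carrier_mat p r" using M Q(1) T by auto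
  have "E * (Q * T) = Q * T"
  proof -
    have "E * (Q * T) = E * Q * T" using E Q(1) T by (intro assoc_mult_mat[symmetric, of _ p p _ k _ r]) auto
    also have "E * Q = Q * (Q\<^sup>T * Q)"
      unfolding E_def using Q(1) Qt by (intro assoc_mult_mat[of _ p k _ p _ k]) auto
    finally show ?thesis using Q by simp
  qed
  then have "(1\<^sub>m p - E) * (Q * T) = 0\<^sub>m p r"
    using minus_mult_distrib_mat[of "1\<^sub>m p" p p E "Q * T" r] E Q(1) T by auto
  then have "(1\<^sub>m p - E) * (M - Q * T) = (1\<^sub>m p - E) * M - 0\<^sub>m p r"
    using mult_minus_distrib_mat[OF minus_carrier_mat[OF E] M mult_carrier_mat[OF Q(1) T], of "1\<^sub>m p"] by simp
  also have "\<dots> = M - E * M"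
    using minus_mult_distrib_mat[of "1\<^sub>m p" p p E M r] E M by auto
  also have "E * M = Q * (Q\<^sup>T * M)"
    unfolding E_def using Q(1) Qt M by (intro assoc_mult_mat[of _ p k _ p _ r]) auto
  finally have eq: "M - Q * (Q\<^sup>T * M) = (1\<^sub>m p - E) * (M - Q * T)" by simp
  have "op_bounded (1\<^sub>m p - E) 1"
    by (rule op_bounded_symmetric_projection[OF _ symmetric_projection_complement[OF E EE]]) (use E in auto)
  from op_boundedD[OF this minus_carrier_mat[OF E] D] show ?thesis unfolding eq by simp
qed

section \<open>Spectral theorem for real symmetric matrices\<close>

text \<open>The Householder reflection along \<open>w = x - e\<^sub>0\<close> exchanges \<open>e\<^sub>0\<close> and the unit vector \<open>x\<close>. It completes \<open>x\<close> to an
  orthonormal basis.\<close>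

lemma reflection_with_first_column:
  fixes x :: "nat \<Rightarrow> real"
  assumes unit: "(\<Sum>i<Suc m. (x i)\<^sup>2) = 1"
  obtains H where "H \<in> carrier_mat (Suc m) (Suc m)" "H\<^sup>T = H" "H * H = 1\<^sub>m (Suc m)"
    "\<And>i. i < Suc m \<Longrightarrow> H $$ (i, 0) = x i"
proof -
  define w where "w i = x i - (if i = 0 then 1 else 0)" for i
  have "(\<Sum>i<Suc m. (w i)\<^sup>2) = (\<Sum>i<Suc m. (x i)\<^sup>2 - (if i = 0 then 2 * x i else 0) + (if i = 0 then 1 else 0))"
    by (intro sum.cong) (auto simp: w_def power2_eq_square algebra_simps)
  also have "\<dots> = 2 - 2 * x 0"
    using unit by (simp add: sum.distrib sum_subtractf)
  finally have w: "(\<Sum>i<Suc m. (w i)\<^sup>2) = 2 - 2 * x 0" .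
  show thesis
  proof (cases "x 0 = 1")
    case True
    then have "w i = 0" if "i < Suc m" for i
      using w that sum_nonneg_eq_0_iff[of "{..<Suc m}" "\<lambda>i. (w i)\<^sup>2"] by auto
    then have "x i = (if i = 0 then 1 else 0)" if "i < Suc m" for i
      using that unfolding w_def by (metis eq_iff_diff_eq_0)
    then show thesis by (intro that[of "1\<^sub>m (Suc m)"]) auto
  next
    case False
    define c where "c = 1 / (1 - x 0)"
    define H where "H = Matrix.mat (Suc m) (Suc m) (\<lambda>(i, j). (if i = j then 1 else 0) - c * w i * w j)"
    have H: "H \<in> carrier_mat (Suc m) (Suc m)" by (simp add: H_def)
    have c: "c * (2 - 2 * x 0) = 2" using False by (simp add: c_def field_simps)
    show thesis
    proof (rule that[OF H])
      show "H\<^sup>T = H" by (rule eq_matI) (auto simp: H_def)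
      show "H * H = 1\<^sub>m (Suc m)"
      proof (rule eq_matI)
        fix i j assume "i < dim_row (1\<^sub>m (Suc m))" "j < dim_col (1\<^sub>m (Suc m))"
        then have ij: "i < Suc m" "j < Suc m" by auto
        have "(H * H) $$ (i, j) = (\<Sum>k<Suc m. H $$ (i, k) * H $$ (k, j))"
          by (rule mult_mat_entry[OF H H ij])
        also have "\<dots> = (\<Sum>k<Suc m. (if i = k then (if k = j then 1 else 0) else 0)
              - (if i = k then c * w k * w j else 0) - (if k = j then c * w i * w k else 0)
              + c * c * w i * w j * (w k)\<^sup>2)"
          by (intro sum.cong) (use ij in \<open>auto simp: H_def power2_eq_square algebra_simps\<close>)
        also have "\<dots> = (if i = j then 1 else 0) - c * w i * w j - c * w i * w j
              + c * w i * w j * (c * (2 - 2 * x 0))"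
          unfolding sum.distrib sum_subtractf sum_distrib_left[symmetric] w
          using ij by (simp del: sum.lessThan_Suc)
        also have "\<dots> = 1\<^sub>m (Suc m) $$ (i, j)" unfolding c using ij by simp
        finally show "(H * H) $$ (i, j) = 1\<^sub>m (Suc m) $$ (i, j)" .
      qed (use H in auto)
      show "H $$ (i, 0) = x i" if "i < Suc m" for i
        using that False by (auto simp: H_def w_def c_def field_simps)
    qed
  qed
qed

definition diag_of_list :: "real list \<Rightarrow> real mat" where
  "diag_of_list es = Matrix.mat (length es) (length es) (\<lambda>(i, j). if i = j then es ! i else 0)"

lemma unit_eigenvector:
  fixes B :: "real mat"
  assumes B: "B \<in> carrier_mat n n" and root: "poly (char_poly B) e = 0"
  obtains x where "(\<Sum>i<n. (x i)\<^sup>2) = 1" "\<And>i. i < n \<Longrightarrow> (\<Sum>j<n. B $$ (i, j) * x j) = e * x i"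
proof -
  obtain v where v: "v \<in> carrier_vec n" "v \<noteq> 0\<^sub>v n" and ev: "B *\<^sub>v v = e \<cdot>\<^sub>v v"
    using eigenvalue_root_char_poly[OF B] root B unfolding eigenvalue_def eigenvector_def by auto
  define s where "s = (\<Sum>i<n. (vec_index v i)\<^sup>2)"
  obtain i where "i < n" "vec_index v i \<noteq> 0"
    using v by (metis carrier_vecD eq_vecI index_zero_vec(1) index_zero_vec(2))
  then have "s > 0"
    unfolding s_def by (intro sum_pos2[of _ i]) auto
  have "(\<Sum>i<n. (vec_index v i / sqrt s)\<^sup>2) = 1"
    using \<open>s > 0\<close> by (simp add: power_divide flip: sum_divide_distrib s_def)
  moreover have "(\<Sum>j<n. B $$ (i, j) * (vec_index v j / sqrt s)) = e * (vec_index v i / sqrt s)" if "i < n" for i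
  proof -
    have "(\<Sum>j<n. B $$ (i, j) * vec_index v j) = vec_index (B *\<^sub>v v) i"
      using that B v by (auto simp: scalar_prod_def Matrix.row_def lessThan_atLeast0 intro!: sum.cong)
    also have "\<dots> = e * vec_index v i" unfolding ev using that v by simp
    finally have "(\<Sum>j<n. B $$ (i, j) * vec_index v j) / sqrt s = e * vec_index v i / sqrt s" by simp
    then show ?thesis by (simp add: sum_divide_distrib)
  qed
  ultimately show thesis by (rule that)
qed

lemma symmetric_conjugate:
  fixes B :: "real mat"
  assumes "B \<in> carrier_mat n n" "B\<^sup>T = B" "P \<in> carrier_mat n m"
  shows "(P\<^sup>T * B * P)\<^sup>T = P\<^sup>T * B * P"
proof -
  have T: "P\<^sup>T \<in> carrier_mat m n" using assms(3) by simp
  have "(P\<^sup>T * B * P)\<^sup>T = P\<^sup>T * (P\<^sup>T * B)\<^sup>T"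
    by (rule transpose_mult[OF mult_carrier_mat[OF T assms(1)] assms(3)])
  also have "(P\<^sup>T * B)\<^sup>T = B * P"
    using transpose_mult[OF T assms(1)] assms(2) by simp
  also have "P\<^sup>T * (B * P) = P\<^sup>T * B * P"
    by (rule assoc_mult_mat[symmetric, OF T assms(1,3)])
  finally show ?thesis .
qed

text \<open>One eigenvector is split off at a time. In an orthonormal basis that starts with it the matrix has
  first column \<open>(e, 0, \<dots>, 0)\<close>, and by symmetry the same first row, so that the rest is a smaller symmetric matrix
  with the remaining eigenvalues.\<close>

lemma orthogonal_diagonalization:
  fixes B :: "real mat"
  assumes "B \<in> carrier_mat n n" "B\<^sup>T = B" "char_poly B = (\<Prod>e\<leftarrow>es. [:- e, 1:])"
  shows "\<exists>P\<in>carrier_mat n n. P\<^sup>T * P = 1\<^sub>m n \<and> P\<^sup>T * B * P = diag_of_list es"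
  using assms
proof (induction es arbitrary: n B)
  case Nil
  then have "n = 0" using degree_monic_char_poly[of B n] by simp
  then show ?case
    using Nil by (intro bexI[of _ "1\<^sub>m 0"] conjI eq_matI) (auto simp: diag_of_list_def)
next
  case (Cons e es)
  note B = Cons.prems(1) and sym = Cons.prems(2)
  have "degree (char_poly B) \<noteq> 0"
    unfolding Cons.prems(3) degree_linear_factors[of uminus "e # es"] by simp
  then obtain m where n: "n = Suc m"
    using degree_monic_char_poly[OF B] by (cases n) auto
  have "poly (char_poly B) e = 0" unfolding Cons.prems(3) by simp
  from unit_eigenvector[OF B this] obtain x where
    x: "(\<Sum>i<Suc m. (x i)\<^sup>2) = 1" "\<And>i. i < n \<Longrightarrow> (\<Sum>j<n. B $$ (i, j) * x j) = e * x i"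
    unfolding n by blast
  from reflection_with_first_column[OF x(1)] obtain H where
    H: "H \<in> carrier_mat n n" "H\<^sup>T = H" "H * H = 1\<^sub>m n" "\<And>i. i < n \<Longrightarrow> H $$ (i, 0) = x i"
    unfolding n by blast
  define B' where "B' = H * B * H"
  have B': "B' \<in> carrier_mat n n" using H(1) B by (simp add: B'_def)
  have sym': "B'\<^sup>T = B'"
    using symmetric_conjugate[OF B sym H(1)] H(2) by (simp add: B'_def)
  have col0: "B' $$ (i, 0) = (if i = 0 then e else 0)" if i: "i < n" for i
  proof -
    have BH: "B * H \<in> carrier_mat n n" using B H(1) by simp
    have "B' = H * (B * H)" unfolding B'_def by (rule assoc_mult_mat[OF H(1) B H(1)])
    then have "B' $$ (i, 0) = (\<Sum>k<n. H $$ (i, k) * (B * H) $$ (k, 0))"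
      using mult_mat_entry[OF H(1) BH i] n by simp
    also have "\<dots> = (\<Sum>k<n. H $$ (i, k) * (e * H $$ (k, 0)))"
    proof (intro sum.cong refl arg_cong2[where f = "(*)"])
      fix k assume "k \<in> {..<n}"
      then have k: "k < n" by simp
      have "(B * H) $$ (k, 0) = (\<Sum>j<n. B $$ (k, j) * x j)"
        using mult_mat_entry[OF B H(1) k] n H(4) by simp
      then show "(B * H) $$ (k, 0) = e * H $$ (k, 0)" using x(2)[OF k] H(4)[OF k] by simp
    qed
    also have "\<dots> = e * (H * H) $$ (i, 0)"
      using mult_mat_entry[OF H(1) H(1) i] n by (simp add: sum_distrib_left distrib_left mult_ac)
    also have "\<dots> = (if i = 0 then e else 0)" unfolding H(3) using i n by simp
    finally show ?thesis .
  qed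
  have row0: "B' $$ (0, i) = (if i = 0 then e else 0)" if "i < n" for i
  proof -
    have "B' $$ (0, i) = B'\<^sup>T $$ (i, 0)" using B' that n by simp
    then show ?thesis using col0[OF that] sym' by simp
  qed
  define E where "E = Matrix.mat 1 1 (\<lambda>_. e)"
  define C where "C = Matrix.mat m m (\<lambda>(i, j). B' $$ (Suc i, Suc j))"
  have E: "E \<in> carrier_mat 1 1" and C: "C \<in> carrier_mat m m" by (auto simp: E_def C_def)
  have block: "B' = four_block_mat E (0\<^sub>m 1 m) (0\<^sub>m m 1) C"
    by (rule eq_matI) (use B' n col0 row0 in \<open>auto simp: E_def C_def\<close>)
  have "C\<^sup>T = C"
  proof (rule eq_matI)
    fix i j assume "i < dim_row C" "j < dim_col C"
    then have ij: "i < m" "j < m" using C by auto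
    have "B' $$ (Suc j, Suc i) = B'\<^sup>T $$ (Suc i, Suc j)" using ij B' n by simp
    then show "C\<^sup>T $$ (i, j) = C $$ (i, j)" using ij sym' by (simp add: C_def)
  qed (use C in auto)
  moreover have "char_poly C = (\<Prod>e\<leftarrow>es. [:- e, 1:])"
  proof -
    have "H * B' * H = H * (H * B * H) * H" by (simp add: B'_def)
    also have "\<dots> = (H * H) * B * (H * H)"
      using H(1) B by (simp add: assoc_mult_mat[of _ n n _ n _ n])
    finally have "B = H * B' * H" using B H(3) by simp
    then have "similar_mat B B'"
      unfolding similar_mat_def using similar_mat_witI[OF H(3) H(3) _ B B' H(1) H(1)] by blast
    then have "char_poly B = char_poly E * char_poly C"
      using char_poly_similar char_poly_four_block_zeros_col[OF E _ C, of "0\<^sub>m 1 m"] block by fastforce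
    moreover have "char_poly E = [:- e, 1:]"
      by (simp add: E_def char_poly_defs det_def sign_def)
    ultimately have "[:- e, 1:] * char_poly C = [:- e, 1:] * (\<Prod>e\<leftarrow>es. [:- e, 1:])"
      using Cons.prems(3) by simp
    then show ?thesis by (metis mult_cancel_left pCons_eq_0_iff zero_neq_one)
  qed
  ultimately obtain P where P: "P \<in> carrier_mat m m" "P\<^sup>T * P = 1\<^sub>m m"
    "P\<^sup>T * C * P = diag_of_list es"
    using Cons.IH[OF C] by blast
  define F where "F = four_block_mat (1\<^sub>m 1) (0\<^sub>m 1 m) (0\<^sub>m m 1) P"
  have F: "F \<in> carrier_mat n n" using P(1) n four_block_carrier_mat[of "1\<^sub>m 1" 1 1 P m m] by (simp add: F_def)
  have Ft: "F\<^sup>T = four_block_mat (1\<^sub>m 1) (0\<^sub>m 1 m) (0\<^sub>m m 1) P\<^sup>T"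
    unfolding F_def by (subst transpose_four_block_mat[of _ 1 1 _ m _ m]) (use P(1) in auto)
  have Pt: "P\<^sup>T \<in> carrier_mat m m" using P(1) by simp
  have Ft': "F\<^sup>T \<in> carrier_mat n n" using F by simp
  have FF: "F\<^sup>T * F = 1\<^sub>m n"
    unfolding Ft unfolding F_def using P(1,2) Pt n four_block_one_mat[of 1 m]
    by (subst mult_four_block_mat[of _ 1 1 _ m _ m _ _ 1 _ m]) auto
  have FBF: "F\<^sup>T * B' * F = diag_of_list (e # es)"
  proof -
    have "F\<^sup>T * B' = four_block_mat E (0\<^sub>m 1 m) (0\<^sub>m m 1) (P\<^sup>T * C)"
      unfolding Ft block using P(1) Pt E C
      by (subst mult_four_block_mat[of _ 1 1 _ m _ m _ _ 1 _ m]) auto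
    also have "\<dots> * F = four_block_mat E (0\<^sub>m 1 m) (0\<^sub>m m 1) (P\<^sup>T * C * P)"
      unfolding F_def using P(1) Pt E C
      by (subst mult_four_block_mat[of _ 1 1 _ m _ m _ _ 1 _ m]) auto
    also have "\<dots> = diag_of_list (e # es)"
    proof -
      have "length es = m"
        using arg_cong[OF P(3), of dim_col] P(1) by (simp add: diag_of_list_def)
      then show ?thesis
        unfolding P(3) by (intro eq_matI) (auto simp: diag_of_list_def E_def nth_Cons split: nat.splits)
    qed
    finally show ?thesis .
  qed
  have HF: "(H * F)\<^sup>T = F\<^sup>T * H"
    using transpose_mult[OF H(1) F] H(2) by simp
  show ?case
  proof (intro bexI conjI)
    show "H * F \<in> carrier_mat n n" using H(1) F by simp
    have "(H * F)\<^sup>T * (H * F) = F\<^sup>T * (H * H) * F"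
      unfolding HF using H(1) F Ft' by (simp add: assoc_mult_mat[of _ n n _ n _ n])
    then show "(H * F)\<^sup>T * (H * F) = 1\<^sub>m n"
      using H(3) Ft' FF by simp
    have "(H * F)\<^sup>T * B * (H * F) = F\<^sup>T * B' * F"
      unfolding HF B'_def using H(1) F Ft' B by (simp add: assoc_mult_mat[of _ n n _ n _ n])
    then show "(H * F)\<^sup>T * B * (H * F) = diag_of_list (e # es)" using FBF by simp
  qed
qed

text \<open>Over the complex numbers the characteristic polynomial splits. Its roots are real, because the value of the
  Hermitian form at an eigenvector is its own conjugate.\<close>

lemma symmetric_char_poly_splits:
  fixes B :: "real mat"
  assumes B: "B \<in> carrier_mat n n" and sym: "B\<^sup>T = B"
  shows "\<exists>es. char_poly B = (\<Prod>e\<leftarrow>es. [:- e, 1:]) \<and> length es = n \<and> sorted_wrt (\<ge>) es"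
proof -
  define C where "C = map_mat complex_of_real B"
  have C: "C \<in> carrier_mat n n" using B by (simp add: C_def)
  obtain as where as: "char_poly C = (\<Prod>a\<leftarrow>as. [:- a, 1:])" "length as = n"
    using char_poly_factorized[OF C] by blast
  have real: "complex_of_real (Re a) = a" if "a \<in> set as" for a
  proof -
    have "poly (char_poly C) a = 0" unfolding as(1) using that by (simp add: poly_prod_list prod_list_zero_iff o_def)
    then obtain v where v: "v \<in> carrier_vec n" "v \<noteq> 0\<^sub>v n" and ev: "C *\<^sub>v v = a \<cdot>\<^sub>v v"
      using eigenvalue_root_char_poly[OF C] C unfolding eigenvalue_def eigenvector_def by auto
    define x where "x i = vec_index v i" for i
    have Cx: "(\<Sum>j<n. complex_of_real (B $$ (i, j)) * x j) = a * x i" if "i < n" for i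
    proof -
      have "(\<Sum>j<n. complex_of_real (B $$ (i, j)) * x j) = vec_index (C *\<^sub>v v) i"
        using that B v by (auto simp: C_def x_def scalar_prod_def Matrix.row_def lessThan_atLeast0 intro!: sum.cong)
      also have "\<dots> = a * x i" unfolding ev x_def using that v by simp
      finally show ?thesis .
    qed
    define q where "q = (\<Sum>i<n. \<Sum>j<n. cnj (x i) * (complex_of_real (B $$ (i, j)) * x j))"
    define s where "s = (\<Sum>i<n. (cmod (x i))\<^sup>2)"
    have "q = (\<Sum>i<n. cnj (x i) * (a * x i))"
      unfolding q_def by (intro sum.cong refl) (simp add: Cx flip: sum_distrib_left)
    also have "\<dots> = a * complex_of_real s"
      by (simp add: s_def sum_distrib_left complex_norm_square mult_ac del: of_real_power)
    finally have q: "q = a * complex_of_real s" .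
    have "cnj q = (\<Sum>i<n. \<Sum>j<n. x i * (complex_of_real (B $$ (i, j)) * cnj (x j)))"
      by (simp add: q_def)
    also have "\<dots> = (\<Sum>j<n. \<Sum>i<n. x i * (complex_of_real (B $$ (i, j)) * cnj (x j)))"
      by (rule sum.swap)
    also have "\<dots> = q"
      unfolding q_def
    proof (intro sum.cong refl)
      fix i j assume "i \<in> {..<n}" "j \<in> {..<n}"
      then have "B $$ (j, i) = B $$ (i, j)"
        using arg_cong[OF sym, of "\<lambda>M. M $$ (i, j)"] B by simp
      then show "x j * (complex_of_real (B $$ (j, i)) * cnj (x i)) = cnj (x i) * (complex_of_real (B $$ (i, j)) * x j)"
        by simp
    qed
    finally have "cnj a * complex_of_real s = a * complex_of_real s" by (simp add: q)
    moreover have "s \<noteq> 0"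
    proof -
      obtain i where "i < n" "x i \<noteq> 0"
        using v unfolding x_def by (metis carrier_vecD eq_vecI index_zero_vec(1) index_zero_vec(2))
      then have "s > 0" unfolding s_def by (intro sum_pos2[of _ i]) auto
      then show ?thesis by simp
    qed
    ultimately have "cnj a = a" by simp
    then show ?thesis by (metis complex_cnj_cancel_iff complex_is_Real_iff cnj.simps(2) Reals_cnj_iff of_real_Re)
  qed
  define es where "es = rev (sort (map Re as))"
  interpret h: map_poly_inj_comm_ring_hom complex_of_real ..
  have "map_poly complex_of_real (char_poly B) = char_poly C"
    unfolding C_def by (rule of_real_hom.char_poly_hom[OF B, symmetric])
  also have "\<dots> = (\<Prod>a\<leftarrow>as. map_poly complex_of_real [:- Re a, 1:])"
    unfolding as(1) using real by (intro arg_cong[where f = prod_list] map_cong refl) auto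
  also have "\<dots> = map_poly complex_of_real (\<Prod>a\<leftarrow>as. [:- Re a, 1:])"
    by (simp add: h.hom_prod_list o_def)
  finally have "char_poly B = (\<Prod>a\<leftarrow>as. [:- Re a, 1:])" by (simp only: h.eq_iff)
  also have "\<dots> = prod_mset (image_mset (\<lambda>e. [:- e, 1:]) (mset (map Re as)))"
    by (simp add: image_mset.compositionality o_def flip: prod_mset_prod_list)
  also have "mset (map Re as) = mset es" by (simp add: es_def)
  also have "prod_mset (image_mset (\<lambda>e. [:- e, 1:]) (mset es)) = (\<Prod>e\<leftarrow>es. [:- e, 1:])"
    by (simp flip: prod_mset_prod_list)
  finally have "char_poly B = (\<Prod>e\<leftarrow>es. [:- e, 1:])" .
  moreover have "length es = n" by (simp add: es_def as(2))
  moreover have "sorted_wrt (\<ge>) es"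
    unfolding es_def sorted_wrt_rev by simp
  ultimately show ?thesis by blast
qed

lemma spectral_theorem:
  fixes B :: "real mat"
  assumes "B \<in> carrier_mat n n" "B\<^sup>T = B"
  obtains P es where "P \<in> carrier_mat n n" "P\<^sup>T * P = 1\<^sub>m n" "P * P\<^sup>T = 1\<^sub>m n"
    "P\<^sup>T * B * P = diag_of_list es" "char_poly B = (\<Prod>e\<leftarrow>es. [:- e, 1:])"
    "length es = n" "sorted_wrt (\<ge>) es"
proof -
  obtain es where es: "char_poly B = (\<Prod>e\<leftarrow>es. [:- e, 1:])" "length es = n" "sorted_wrt (\<ge>) es"
    using symmetric_char_poly_splits[OF assms] by blast
  obtain P where P: "P \<in> carrier_mat n n" "P\<^sup>T * P = 1\<^sub>m n" "P\<^sup>T * B * P = diag_of_list es"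
    using orthogonal_diagonalization[OF assms es(1)] by blast
  have "P * P\<^sup>T = 1\<^sub>m n"
    by (rule mat_mult_left_right_inverse[OF _ P(1,2)]) (use P(1) in simp)
  with P es show thesis by (intro that)
qed

section \<open>Singular values\<close>

lemma proots_linear_factors: "proots (\<Prod>e\<leftarrow>es. [:- e, 1:]) = mset (es :: real list)"
proof -
  have "0 \<notin> set (map (\<lambda>e :: real. [:- e, 1:]) es)" by auto
  from proots_prod_list[OF this] have "proots (\<Prod>e\<leftarrow>es. [:- e, 1:]) = (\<Sum>p\<leftarrow>map (\<lambda>e. [:- e, 1:]) es. proots p)"
    by simp
  also have "\<dots> = mset es" by (induction es) auto
  finally show ?thesis .
qed

lemma sort_decreasing:
  assumes "sorted_wrt (\<ge>) (xs :: real list)"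
  shows "sort xs = rev xs"
proof (rule properties_for_sort)
  show "sorted (rev xs)" using assms unfolding sorted_wrt_rev .
qed (rule mset_rev)

lemma decreasing_list_unique:
  fixes es fs :: "real list"
  assumes "mset es = mset fs" "sorted_wrt (\<ge>) es" "sorted_wrt (\<ge>) fs"
  shows "es = fs"
proof -
  have "sort es = sort fs"
    by (rule properties_for_sort) (simp_all add: assms(1))
  then have "rev es = rev fs" unfolding sort_decreasing[OF assms(2)] sort_decreasing[OF assms(3)] .
  then show ?thesis unfolding rev_is_rev_conv .
qed

lemma sing_val_list_eq:
  assumes "char_poly (M\<^sup>T * M) = (\<Prod>e\<leftarrow>es. [:- e, 1:])" "sorted_wrt (\<ge>) es"
  shows "sing_val_list M = map sqrt es"
proof -
  have "sorted_wrt (\<ge>) (map sqrt es)" using assms(2) by (simp add: sorted_wrt_map)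
  then show ?thesis
    by (simp add: sing_val_list_def assms(1) proots_linear_factors sort_decreasing flip: mset_map)
qed

lemma char_poly_lower_block:
  fixes A1 :: "real mat"
  assumes A1: "A1 \<in> carrier_mat p p" and A3: "A3 \<in> carrier_mat r p" and A4: "A4 \<in> carrier_mat r r"
  shows "char_poly (four_block_mat A1 (0\<^sub>m p r) A3 A4) = char_poly A1 * char_poly A4"
proof -
  have "char_poly_matrix (four_block_mat A1 (0\<^sub>m p r) A3 A4)
      = four_block_mat (char_poly_matrix A1) (0\<^sub>m p r) (map_mat (\<lambda>a. [:- a:]) A3) (char_poly_matrix A4)"
    by (rule eq_matI) (use assms in \<open>auto simp: char_poly_matrix_def one_poly_def\<close>)
  then show ?thesis
    unfolding char_poly_def
    by (simp add: det_four_block_mat_upper_right_zero[of _ p _ r] assms)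
qed

lemma char_poly_zero_mat: "char_poly (0\<^sub>m n n :: real mat) = (\<Prod>e\<leftarrow>replicate n 0. [:- e, 1:])"
proof -
  have "diag_mat (0\<^sub>m n n :: real mat) = replicate n 0"
    by (auto simp: diag_mat_def intro: nth_equalityI)
  then show ?thesis
    using char_poly_upper_triangular[of "0\<^sub>m n n :: real mat" n] by (simp add: upper_triangular_def)
qed

text \<open>Both sides are characteristic polynomials of block triangular matrices of order \<open>p + r\<close> that are conjugate
  under a block shear.\<close>

lemma char_poly_mult_commute:
  fixes M :: "real mat"
  assumes M: "M \<in> carrier_mat p r" and M': "M' \<in> carrier_mat r p"
  shows "char_poly (M * M') * char_poly (0\<^sub>m r r :: real mat) = char_poly (0\<^sub>m p p :: real mat) * char_poly (M' * M)"
proof -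
  define S where "S = four_block_mat (1\<^sub>m p) M (0\<^sub>m r p) (1\<^sub>m r)"
  define T where "T = four_block_mat (1\<^sub>m p) (- M) (0\<^sub>m r p) (1\<^sub>m r)"
  define X where "X = four_block_mat (M * M') (0\<^sub>m p r) M' (0\<^sub>m r r)"
  define Y where "Y = four_block_mat (0\<^sub>m p p) (0\<^sub>m p r) M' (M' * M)"
  have MM: "M * M' \<in> carrier_mat p p" "M' * M \<in> carrier_mat r r" using M M' by auto
  have c: "S \<in> carrier_mat (p + r) (p + r)" "T \<in> carrier_mat (p + r) (p + r)"
    "X \<in> carrier_mat (p + r) (p + r)" "Y \<in> carrier_mat (p + r) (p + r)"
    unfolding S_def T_def X_def Y_def using MM by (auto intro!: four_block_carrier_mat)
  have ST: "S * T = 1\<^sub>m (p + r)"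
    unfolding S_def T_def using M
    by (subst mult_four_block_mat[of _ p p _ r _ r _ _ p _ r]) (auto simp flip: four_block_one_mat intro!: cong_four_block_mat)
  have TS: "T * S = 1\<^sub>m (p + r)"
    by (rule mat_mult_left_right_inverse[OF c(1,2) ST])
  have "X * S = S * Y"
    unfolding S_def X_def Y_def using M M' MM
    by (subst (1 2) mult_four_block_mat[of _ p p _ r _ r _ _ p _ r])
      (auto intro!: cong_four_block_mat simp: assoc_mult_mat[of _ p r _ p _ r])
  then have "X = S * Y * T"
    using ST c by (metis assoc_mult_mat right_mult_one_mat)
  then have "similar_mat X Y"
    unfolding similar_mat_def using similar_mat_witI[OF ST TS _ c(3,4,1,2)] by blast
  then have "char_poly X = char_poly Y" by (rule char_poly_similar)
  then show ?thesis
    unfolding X_def Y_def by (simp add: char_poly_lower_block[of _ p _ r] MM M')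
qed

text \<open>Evaluated in the eigenbasis \<open>P\<close>. The rows of \<open>P\<^sup>T X\<close> are the coordinates of the columns of \<open>X\<close>.\<close>

lemma spectral_quadratic_form:
  fixes B :: "real mat"
  assumes B: "B \<in> carrier_mat n n" and P: "P \<in> carrier_mat n n" "P * P\<^sup>T = 1\<^sub>m n"
    and diag: "P\<^sup>T * B * P = diag_of_list es" and X: "X \<in> carrier_mat n s"
  shows "frob_inner X (B * X) = (\<Sum>i<n. es ! i * (\<Sum>j<s. ((P\<^sup>T * X) $$ (i, j))\<^sup>2))"
proof -
  define Y where "Y = P\<^sup>T * X"
  have Pt: "P\<^sup>T \<in> carrier_mat n n" using P(1) by simp
  have Y: "Y \<in> carrier_mat n s" using Pt X by (simp add: Y_def)
  have len: "length es = n" using arg_cong[OF diag, of dim_col] P(1) by (simp add: diag_of_list_def)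
  have D: "diag_of_list es \<in> carrier_mat n n" using len by (simp add: diag_of_list_def)
  have PY: "P * Y = X"
    using assoc_mult_mat[OF P(1) Pt X] P(2) X by (simp add: Y_def)
  have BX: "B * X \<in> carrier_mat n s" using B X by simp
  have "frob_inner X (B * X) = frob_inner Y (P\<^sup>T * (B * X))"
    using frob_inner_adjoint[OF P(1) Y BX] by (simp add: PY)
  also have "P\<^sup>T * (B * X) = diag_of_list es * Y"
    using B P(1) Pt X Y unfolding diag[symmetric]
    by (simp add: PY assoc_mult_mat[of _ n n _ n _ s] assoc_mult_mat[of _ n n _ n _ n])
  also have "frob_inner Y (diag_of_list es * Y) = (\<Sum>i<n. \<Sum>j<s. Y $$ (i, j) * (es ! i * Y $$ (i, j)))"
    unfolding frob_inner_carrier[OF Y]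
  proof (intro sum.cong refl arg_cong2[where f = "(*)"])
    fix i j assume "i \<in> {..<n}" "j \<in> {..<s}"
    then have ij: "i < n" "j < s" by auto
    have "(diag_of_list es * Y) $$ (i, j) = (\<Sum>k<n. (if i = k then es ! i * Y $$ (k, j) else 0))"
      unfolding mult_mat_entry[OF D Y ij] by (intro sum.cong) (use ij len in \<open>auto simp: diag_of_list_def\<close>)
    then show "(diag_of_list es * Y) $$ (i, j) = es ! i * Y $$ (i, j)" using ij by simp
  qed
  finally show ?thesis by (simp add: Y_def sum_distrib_left power2_eq_square mult_ac)
qed

lemma gram_quadratic_form:
  assumes M: "M \<in> carrier_mat p r" and X: "X \<in> carrier_mat r s"
  shows "(frob_norm (M * X))\<^sup>2 = frob_inner X ((M\<^sup>T * M) * X)"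
proof -
  have MX: "M * X \<in> carrier_mat p s" using M X by simp
  have "M\<^sup>T * (M * X) = M\<^sup>T * M * X"
    by (rule assoc_mult_mat[symmetric, OF _ M X]) (use M in simp)
  then show ?thesis
    using frob_inner_adjoint[OF M X MX] by (simp add: frob_norm_sq)
qed

text \<open>Orthonormal right singular vectors of \<open>M\<close>, as the columns of \<open>P\<close>, and the squares of its singular values,
  padded with zeros to length \<open>r\<close>.\<close>

lemma gram_spectrum:
  assumes M: "M \<in> carrier_mat p r"
  obtains P es where "P \<in> carrier_mat r r" "P\<^sup>T * P = 1\<^sub>m r" "P * P\<^sup>T = 1\<^sub>m r"
    "P\<^sup>T * (M\<^sup>T * M) * P = diag_of_list es"
    "char_poly (M\<^sup>T * M) = (\<Prod>e\<leftarrow>es. [:- e, 1:])"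
    "length es = r" "sorted_wrt (\<ge>) es" "\<forall>e\<in>set es. e \<ge> 0"
proof -
  have Mt: "M\<^sup>T \<in> carrier_mat r p" using M by simp
  have "M\<^sup>T * M \<in> carrier_mat r r" using M by simp
  moreover have "(M\<^sup>T * M)\<^sup>T = M\<^sup>T * M"
    using transpose_mult[OF Mt M] by simp
  ultimately obtain P es where P: "P \<in> carrier_mat r r" "P\<^sup>T * P = 1\<^sub>m r" "P * P\<^sup>T = 1\<^sub>m r"
    "P\<^sup>T * (M\<^sup>T * M) * P = diag_of_list es"
    "char_poly (M\<^sup>T * M) = (\<Prod>e\<leftarrow>es. [:- e, 1:])"
    "length es = r" "sorted_wrt (\<ge>) es"
    using spectral_theorem by blast
  have "e \<ge> 0" if e: "e \<in> set es" for e
  proof -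
    obtain i where i: "i < r" "e = es ! i" using e P(6) by (auto simp: in_set_conv_nth)
    have MP: "M * P \<in> carrier_mat p r" using M P(1) by simp
    have Pt: "P\<^sup>T \<in> carrier_mat r r" using P(1) by simp
    have "(M * P)\<^sup>T * (M * P) = P\<^sup>T * M\<^sup>T * (M * P)"
      by (simp only: transpose_mult[OF M P(1)])
    also have "\<dots> = P\<^sup>T * (M\<^sup>T * (M * P))"
      by (rule assoc_mult_mat[OF Pt Mt MP])
    also have "M\<^sup>T * (M * P) = M\<^sup>T * M * P"
      by (rule assoc_mult_mat[symmetric, OF Mt M P(1)])
    also have "P\<^sup>T * (M\<^sup>T * M * P) = P\<^sup>T * (M\<^sup>T * M) * P"
      by (rule assoc_mult_mat[symmetric, OF Pt _ P(1)]) (use M in simp)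
    finally have "(M * P)\<^sup>T * (M * P) = diag_of_list es" using P(4) by simp
    then have "e = ((M * P)\<^sup>T * (M * P)) $$ (i, i)"
      using i P(6) by (simp add: diag_of_list_def)
    also have "\<dots> = (\<Sum>k<p. (M * P)\<^sup>T $$ (i, k) * (M * P) $$ (k, i))"
      by (rule mult_mat_entry[OF _ MP i(1) i(1)]) (use MP in simp)
    also have "\<dots> = (\<Sum>k<p. ((M * P) $$ (k, i))\<^sup>2)"
      using M P(1) i by (intro sum.cong) (auto simp: power2_eq_square simp del: index_mult_mat(1))
    finally show ?thesis by (simp add: sum_nonneg)
  qed
  with P show thesis by (intro that) auto
qed

text \<open>By \<open>char_poly_mult_commute\<close> the two characteristic polynomials differ by a power of the variable, that is,
  by zero eigenvalues.\<close>

lemma gram_spectra_wide: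
  fixes es fs :: "real list"
  assumes M: "M \<in> carrier_mat p r" and "p \<le> r"
    and es: "char_poly (M\<^sup>T * M) = (\<Prod>e\<leftarrow>es. [:- e, 1:])" "sorted_wrt (\<ge>) es"
    and fs: "char_poly (M * M\<^sup>T) = (\<Prod>e\<leftarrow>fs. [:- e, 1:])" "sorted_wrt (\<ge>) fs"
      "\<forall>e\<in>set fs. e \<ge> 0"
  shows "es = fs @ replicate (r - p) 0"
proof (rule decreasing_list_unique[OF _ es(2)])
  have nz: "(\<Prod>e\<leftarrow>xs. [:- e, 1:]) \<noteq> 0" for xs :: "real list" by (auto simp: prod_list_zero_iff)
  have "(\<Prod>e\<leftarrow>es. [:- e, 1:]) * (\<Prod>e\<leftarrow>replicate p 0. [:- e, 1:])
      = (\<Prod>e\<leftarrow>replicate r 0. [:- e, 1:]) * (\<Prod>e\<leftarrow>fs. [:- e, 1:])"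
    using char_poly_mult_commute[of "M\<^sup>T" r p M] M unfolding es fs char_poly_zero_mat by simp
  from arg_cong[OF this, of proots] have "mset es + replicate_mset p 0 = replicate_mset r 0 + mset fs"
    by (simp only: proots_mult[OF nz nz] proots_linear_factors mset_replicate)
  moreover have "replicate_mset r (0::real) = replicate_mset p 0 + replicate_mset (r - p) 0"
    using \<open>p \<le> r\<close> by (intro multiset_eqI) auto
  ultimately show "mset es = mset (fs @ replicate (r - p) 0)" by simp
  show "sorted_wrt (\<ge>) (fs @ replicate (r - p) 0)"
    using fs(2,3) by (auto simp: sorted_wrt_iff_nth_less nth_append)
qed

text \<open>The singular values stop at position \<open>min p r\<close>, but the remaining eigenvalues of \<open>M\<^sup>T M\<close> vanish, so the tail
  can be taken over all of them.\<close>

lemma sv_tail_eq: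
  assumes M: "M \<in> carrier_mat p r" 
    and es: "char_poly (M\<^sup>T * M) = (\<Prod>e\<leftarrow>es. [:- e, 1:])" "length es = r" "sorted_wrt (\<ge>) es"
     "\<forall>e\<in>set es. e \<ge> 0"
  shows "sv_tail (Suc k) M = sqrt (\<Sum>i = k..<r. es ! i)"
proof -
  have zero: "es ! i = 0" if "p \<le> i" "i < r" for i
  proof -
    obtain Q fs where fs: "char_poly (M\<^sup>T\<^sup>T * M\<^sup>T) = (\<Prod>e\<leftarrow>fs. [:- e, 1:])" "length fs = p"
      "sorted_wrt (\<ge>) fs" "\<forall>e\<in>set fs. e \<ge> 0"
      by (rule gram_spectrum[of "M\<^sup>T" r p]) (use M in auto)
    have "es = fs @ replicate (r - p) 0"
      by (rule gram_spectra_wide[OF M _ es(1,3) _ fs(3,4)]) (use fs(1) that in auto)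
    then show ?thesis using that fs(2) by (simp add: nth_append)
  qed
  have "(sing_val i M)\<^sup>2 = es ! (i - 1)" if "i \<in> {Suc k..min p r}" for i
  proof -
    have i: "i - 1 < length es" using that es(2) by auto
    from bspec[OF es(4) nth_mem[OF i]] show ?thesis
      using i by (simp add: sing_val_def sing_val_list_eq[OF es(1,3)])
  qed
  then have "sv_tail (Suc k) M = sqrt (\<Sum>i = Suc k..min p r. es ! (i - 1))"
    using M by (simp add: sv_tail_def)
  also have "(\<Sum>i = Suc k..min p r. es ! (i - 1)) = (\<Sum>i = k..<min p r. es ! i)"
    by (rule sum.reindex_bij_witness[of _ Suc "\<lambda>i. i - 1"]) auto
  also have "\<dots> = (\<Sum>i = k..<r. es ! i)"
    by (rule sum.mono_neutral_left) (auto intro: zero)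
  finally show ?thesis .
qed

section \<open>Low-rank approximation\<close>

text \<open>The columns of \<open>V\<close> are right singular vectors for the \<open>k\<close> largest singular values. On the \<open>i\<close>-th right singular
  vector, \<open>1 - V V\<^sup>T\<close> is zero for \<open>i < k\<close> and the identity otherwise.\<close>

lemma truncated_svd:
  assumes M: "M \<in> carrier_mat p r" and "k \<le> r"
  obtains V where "V \<in> carrier_mat r k" "V\<^sup>T * V = 1\<^sub>m k"
    "frob_norm (M - M * (V * V\<^sup>T)) = sv_tail (Suc k) M"
proof -
  obtain P es where P: "P \<in> carrier_mat r r" "P\<^sup>T * P = 1\<^sub>m r" "P * P\<^sup>T = 1\<^sub>m r"
    "P\<^sup>T * (M\<^sup>T * M) * P = diag_of_list es"
    "char_poly (M\<^sup>T * M) = (\<Prod>e\<leftarrow>es. [:- e, 1:])"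
    "length es = r" "sorted_wrt (\<ge>) es" "\<forall>e\<in>set es. e \<ge> 0"
    using gram_spectrum[OF M] by metis
  define V where "V = Matrix.mat r k (\<lambda>(i, j). P $$ (i, j))"
  have V: "V \<in> carrier_mat r k" by (simp add: V_def)
  have Vt: "V\<^sup>T \<in> carrier_mat k r" using V by simp
  have Pt: "P\<^sup>T \<in> carrier_mat r r" using P(1) by simp
  have PP: "(\<Sum>l<r. P $$ (l, i) * P $$ (l, j)) = (if i = j then 1 else 0)" if "i < r" "j < r" for i j
    using arg_cong[OF P(2), of "\<lambda>M. M $$ (i, j)"] mult_mat_entry[OF Pt P(1) that] that P(1) by simp
  have VV: "V\<^sup>T * V = 1\<^sub>m k"
  proof (rule eq_matI)
    fix i j assume "i < dim_row (1\<^sub>m k)" "j < dim_col (1\<^sub>m k)"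
    then have ij: "i < k" "j < k" by auto
    then show "(V\<^sup>T * V) $$ (i, j) = 1\<^sub>m k $$ (i, j)"
      unfolding mult_mat_entry[OF Vt V ij] using PP[of i j] \<open>k \<le> r\<close> by (simp add: V_def)
  qed (use V in auto)
  have VVt: "V * V\<^sup>T \<in> carrier_mat r r" using V by simp
  define X where "X = 1\<^sub>m r - V * V\<^sup>T"
  have X: "X \<in> carrier_mat r r" unfolding X_def by (rule minus_carrier_mat[OF VVt])
  have MX: "M - M * (V * V\<^sup>T) = M * X"
    unfolding X_def mult_minus_distrib_mat[OF M one_carrier_mat VVt] right_mult_one_mat[OF M] ..
  have entry: "(P\<^sup>T * X) $$ (i, j) = (if i < k then 0 else P $$ (j, i))" if ij: "i < r" "j < r" for i j
  proof -
    have "P\<^sup>T * X = P\<^sup>T - P\<^sup>T * V * V\<^sup>T"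
      unfolding X_def mult_minus_distrib_mat[OF Pt one_carrier_mat VVt] assoc_mult_mat[OF Pt V Vt] right_mult_one_mat[OF Pt] ..
    moreover have "(P\<^sup>T * V * V\<^sup>T) $$ (i, j) = (if i < k then P $$ (j, i) else 0)"
    proof -
      have "(P\<^sup>T * V) $$ (i, l) = (if i = l then 1 else 0)" if "l < k" for l
        unfolding mult_mat_entry[OF Pt V ij(1) that] using PP[of i l] that ij \<open>k \<le> r\<close> P(1) by (simp add: V_def)
      then have "(\<Sum>l<k. (P\<^sup>T * V) $$ (i, l) * V\<^sup>T $$ (l, j))
          = (\<Sum>l<k. if i = l then P $$ (j, l) else 0)"
        by (intro sum.cong refl) (use ij in \<open>auto simp: V_def simp del: index_mult_mat(1)\<close>)
      then show ?thesis
        using mult_mat_entry[OF mult_carrier_mat[OF Pt V] Vt ij] by simp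
    qed
    moreover have "P\<^sup>T * V * V\<^sup>T \<in> carrier_mat r r"
      by (rule mult_carrier_mat[OF mult_carrier_mat[OF Pt V] Vt])
    ultimately show ?thesis using ij P(1) V by (simp del: index_mult_mat(1))
  qed
  have "(frob_norm (M * X))\<^sup>2 = (\<Sum>i<r. es ! i * (\<Sum>j<r. ((P\<^sup>T * X) $$ (i, j))\<^sup>2))"
    unfolding gram_quadratic_form[OF M X]
    by (rule spectral_quadratic_form[OF _ P(1,3,4) X]) (use M in simp)
  also have "\<dots> = (\<Sum>i<r. if k \<le> i then es ! i else 0)"
  proof (intro sum.cong refl)
    fix i assume "i \<in> {..<r}"
    then have "(\<Sum>j<r. ((P\<^sup>T * X) $$ (i, j))\<^sup>2) = (if i < k then 0 else (\<Sum>j<r. P $$ (j, i) * P $$ (j, i)))"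
      by (simp add: entry power2_eq_square del: index_mult_mat(1))
    then show "es ! i * (\<Sum>j<r. ((P\<^sup>T * X) $$ (i, j))\<^sup>2) = (if k \<le> i then es ! i else 0)"
      using PP[of i i] \<open>i \<in> {..<r}\<close> by auto
  qed
  also have "\<dots> = (\<Sum>i = k..<r. es ! i)"
    by (rule sum.mono_neutral_cong_right) auto
  finally have "frob_norm (M * X) = sv_tail (Suc k) M"
    unfolding sv_tail_eq[OF M P(5-8)] by (rule real_sqrt_unique[OF _ frob_norm_nonneg, symmetric])
  then show thesis unfolding MX[symmetric] by (rule that[OF V VV])
qed

text \<open>A compression to a subspace of codimension \<open>k\<close> retains at least the \<open>r - k\<close> smallest squared singular
  values: the squared norm of \<open>M (1 - E)\<close> is a weighted sum of the decreasing eigenvalues \<open>es\<close>, with weights \<open>d i\<close>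
  between 0 and 1 of total \<open>r - k\<close>, and is least when the weights sit at the end of the list.\<close>

lemma sv_tail_le_complement_projection:
  assumes M: "M \<in> carrier_mat p r" and E: "E \<in> carrier_mat r r" "E\<^sup>T = E" "E * E = E"
    and tr: "(\<Sum>i<r. E $$ (i, i)) = real k" and "k \<le> r"
  shows "sv_tail (Suc k) M \<le> frob_norm (M - M * E)"
proof -
  obtain P es where P: "P \<in> carrier_mat r r" "P\<^sup>T * P = 1\<^sub>m r" "P * P\<^sup>T = 1\<^sub>m r"
    "P\<^sup>T * (M\<^sup>T * M) * P = diag_of_list es"
    "char_poly (M\<^sup>T * M) = (\<Prod>e\<leftarrow>es. [:- e, 1:])"
    "length es = r" "sorted_wrt (\<ge>) es" "\<forall>e\<in>set es. e \<ge> 0"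
    using gram_spectrum[OF M] by metis
  define X where "X = 1\<^sub>m r - E"
  have X: "X \<in> carrier_mat r r" unfolding X_def by (rule minus_carrier_mat[OF E(1)])
  note proj = symmetric_projection_complement[OF E, folded X_def]
  have MX: "M - M * E = M * X"
    unfolding X_def mult_minus_distrib_mat[OF M one_carrier_mat E(1)] right_mult_one_mat[OF M] ..
  have Pt: "P\<^sup>T \<in> carrier_mat r r" using P(1) by simp
  have PX: "P\<^sup>T * X \<in> carrier_mat r r" using Pt X by simp
  define d where "d i = (\<Sum>j<r. ((P\<^sup>T * X) $$ (i, j))\<^sup>2)" for i
  have d0: "d i \<ge> 0" for i by (simp add: d_def sum_nonneg)
  have d1: "d i \<le> 1" if i: "i < r" for i
  proof -
    define v where "v = Matrix.mat 1 r (\<lambda>(_, j). P $$ (j, i))"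
    have v: "v \<in> carrier_mat 1 r" by (simp add: v_def)
    have "frob_norm v = 1"
    proof -
      have "(\<Sum>l<r. P $$ (l, i) * P $$ (l, i)) = 1"
        using arg_cong[OF P(2), of "\<lambda>M. M $$ (i, i)"] mult_mat_entry[OF Pt P(1) i i] i P(1) by simp
      then show ?thesis by (simp add: frob_norm_eq_sqrt frob_inner_carrier[OF v]) (simp add: v_def)
    qed
    moreover have "frob_norm (v * X) \<le> 1 * frob_norm v"
      by (rule op_bounded_right[OF op_bounded_symmetric_projection[OF X proj] _ X v]) simp
    ultimately have "(frob_norm (v * X))\<^sup>2 \<le> 1"
      using frob_norm_nonneg[of "v * X"] by (simp add: power_le_one)
    moreover have "(frob_norm (v * X))\<^sup>2 = d i"
    proof -
      have vX: "v * X \<in> carrier_mat 1 r" using v X by simp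
      have z: "(0::nat) < 1" by simp
      have "(v * X) $$ (0, j) = (P\<^sup>T * X) $$ (i, j)" if "j < r" for j
        unfolding mult_mat_entry[OF v X z that] mult_mat_entry[OF Pt X i that]
        using i P(1) by (simp add: v_def)
      then show ?thesis
        unfolding frob_norm_sq frob_inner_carrier[OF vX] d_def
        by (simp add: power2_eq_square del: index_mult_mat(1))
    qed
    ultimately show ?thesis by simp
  qed
  have "(\<Sum>i<r. d i) = (frob_norm (P\<^sup>T * X))\<^sup>2"
    unfolding frob_norm_sq frob_inner_carrier[OF PX] d_def by (simp add: power2_eq_square)
  also have "frob_norm (P\<^sup>T * X) = frob_norm X"
    by (rule frob_norm_isometry[OF Pt _ X]) (use P(3) in simp)
  also have "(frob_norm X)\<^sup>2 = (\<Sum>i<r. (X * X\<^sup>T) $$ (i, i))"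
    unfolding frob_norm_sq frob_inner_carrier[OF X]
    using X by (intro sum.cong refl) (simp add: mult_mat_entry[OF X, of "X\<^sup>T" r] del: index_mult_mat(1))
  also have "\<dots> = (\<Sum>i<r. X $$ (i, i))" by (simp only: proj)
  also have "\<dots> = real r - real k"
    using E(1) tr by (simp add: X_def sum_subtractf)
  finally have sum_d: "(\<Sum>i<r. d i) = real r - real k" .
  \<comment> \<open>For \<open>k = 0\<close> this is the largest entry, which bounds all others as required.\<close>
  define c where "c = es ! (k - 1)"
  have mono: "es ! j \<le> es ! i" if "i \<le> j" "j < r" for i j
    using that P(6,7) by (cases "i = j") (auto simp: sorted_wrt_iff_nth_less)
  have "0 \<le> (\<Sum>i<r. (es ! i - c) * (d i - (if k \<le> i then 1 else 0)))"
  proof (rule sum_nonneg)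
    fix i assume "i \<in> {..<r}"
    then have i: "i < r" by simp
    show "0 \<le> (es ! i - c) * (d i - (if k \<le> i then 1 else 0))"
    proof (cases "k \<le> i")
      case True
      then have "es ! i \<le> c" unfolding c_def using i by (intro mono) auto
      then show ?thesis using True d1[OF i] by (simp add: mult_nonpos_nonpos)
    next
      case False
      then have "c \<le> es ! i" unfolding c_def using i \<open>k \<le> r\<close> by (intro mono) auto
      then show ?thesis using False d0[of i] by simp
    qed
  qed
  also have "\<dots> = (\<Sum>i<r. es ! i * d i - (if k \<le> i then es ! i else 0) - c * d i + (if k \<le> i then c else 0))"
    by (intro sum.cong) (auto simp: algebra_simps)
  also have "\<dots> = (\<Sum>i<r. es ! i * d i) - (\<Sum>i = k..<r. es ! i) - c * (\<Sum>i<r. d i) + (\<Sum>i = k..<r. c)"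
  proof -
    have "(\<Sum>i<r. if k \<le> i then f i else 0) = (\<Sum>i = k..<r. f i)" for f :: "nat \<Rightarrow> real"
      by (rule sum.mono_neutral_cong_right) auto
    then show ?thesis by (simp only: sum.distrib sum_subtractf sum_distrib_left[symmetric])
  qed
  also have "\<dots> = (\<Sum>i<r. es ! i * d i) - (\<Sum>i = k..<r. es ! i)"
    unfolding sum_d using \<open>k \<le> r\<close> by (simp add: of_nat_diff algebra_simps)
  also have "(\<Sum>i<r. es ! i * d i) = (frob_norm (M * X))\<^sup>2"
    unfolding gram_quadratic_form[OF M X] d_def
    by (rule spectral_quadratic_form[symmetric, OF _ P(1,3,4) X]) (use M in simp)
  finally have "(\<Sum>i = k..<r. es ! i) \<le> (frob_norm (M * X))\<^sup>2" by simp
  then show ?thesis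
    unfolding sv_tail_eq[OF M P(5-8)] MX using frob_norm_nonneg by (simp add: real_le_lsqrt)
qed

lemma trace_mult_commute:
  fixes M :: "real mat"
  assumes M: "M \<in> carrier_mat p r" and M': "M' \<in> carrier_mat r p"
  shows "(\<Sum>i<p. (M * M') $$ (i, i)) = (\<Sum>i<r. (M' * M) $$ (i, i))"
proof -
  have "(\<Sum>i<p. (M * M') $$ (i, i)) = (\<Sum>i<p. \<Sum>j<r. M $$ (i, j) * M' $$ (j, i))"
    by (intro sum.cong refl mult_mat_entry[OF M M']) auto
  also have "\<dots> = (\<Sum>j<r. \<Sum>i<p. M' $$ (j, i) * M $$ (i, j))"
    by (subst sum.swap) (simp add: mult.commute)
  also have "\<dots> = (\<Sum>i<r. (M' * M) $$ (i, i))"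
    by (intro sum.cong refl mult_mat_entry[OF M' M, symmetric]) auto
  finally show ?thesis .
qed

text \<open>The lower bound of the Eckart--Young theorem, for approximations \<open>Y * W\<close> of rank at most \<open>k\<close>. Since \<open>N W\<close> is the
  orthogonal projection onto the row space of \<open>W\<close>, a matrix of trace \<open>k\<close>, multiplication by \<open>1 - N W\<close> removes \<open>Y * W\<close>
  and reduces the claim to the previous lemma.\<close>

lemma sv_tail_le_low_rank_distance:
  assumes Z: "Z \<in> carrier_mat p m" and Y: "Y \<in> carrier_mat p k" and W: "W \<in> carrier_mat k m"
    and N: "N \<in> carrier_mat m k" "W * N = 1\<^sub>m k" "(N * W)\<^sup>T = N * W" and "k \<le> m"
  shows "sv_tail (Suc k) Z \<le> frob_norm (Z - Y * W)"
proof -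
  define E where "E = N * W"
  have E: "E \<in> carrier_mat m m" using N(1) W by (simp add: E_def)
  have WE: "W * E = W"
    unfolding E_def using assoc_mult_mat[OF W N(1) W] N(2) W by simp
  have EE: "E * E = E"
  proof -
    have "E * E = N * (W * E)" unfolding E_def by (rule assoc_mult_mat[OF N(1) W E[unfolded E_def]])
    then show ?thesis unfolding WE by (simp add: E_def)
  qed
  have sym: "E\<^sup>T = E" using N(3) by (simp add: E_def)
  have YW: "Y * W \<in> carrier_mat p m" using Y W by simp
  have D: "Z - Y * W \<in> carrier_mat p m" by (rule minus_carrier_mat[OF YW])
  have "(\<Sum>i<m. E $$ (i, i)) = real k"
    unfolding E_def trace_mult_commute[OF N(1) W] N(2) by simp
  from sv_tail_le_complement_projection[OF Z E sym EE this \<open>k \<le> m\<close>]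
  have "sv_tail (Suc k) Z \<le> frob_norm (Z - Z * E)" .
  also have "Z - Z * E = (Z - Y * W) * (1\<^sub>m m - E)"
  proof -
    have "(Z - Y * W) * (1\<^sub>m m - E) = (Z - Y * W) - (Z - Y * W) * E"
      unfolding mult_minus_distrib_mat[OF D one_carrier_mat E] right_mult_one_mat[OF D] ..
    also have "(Z - Y * W) * E = Z * E - Y * W"
      unfolding minus_mult_distrib_mat[OF Z YW E] assoc_mult_mat[OF Y W E] WE ..
    also have "(Z - Y * W) - (Z * E - Y * W) = Z - Z * E"
      by (rule eq_matI) (use Z E Y W in \<open>auto simp del: index_mult_mat(1)\<close>)
    finally show ?thesis ..
  qed
  also have "frob_norm \<dots> \<le> 1 * frob_norm (Z - Y * W)"
    by (rule op_bounded_right[OF op_bounded_symmetric_projection[OF minus_carrier_mat[OF E]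
          symmetric_projection_complement[OF E sym EE]] _ minus_carrier_mat[OF E] D]) simp
  finally show ?thesis by simp
qed

section \<open>Compression to the range of a sketch\<close>

text \<open>For a wide matrix the eigenvalues of \<open>W W\<^sup>T\<close> are the squares of the singular values, without padding, so the
  least singular value is visible in the quadratic form of \<open>W W\<^sup>T\<close>.\<close>

lemma wide_spectrum:
  assumes W: "W \<in> carrier_mat k m" and "1 \<le> k" "k \<le> m"
  obtains U fs where "U \<in> carrier_mat k k" "U\<^sup>T * U = 1\<^sub>m k" "U * U\<^sup>T = 1\<^sub>m k"
    "U\<^sup>T * (W * W\<^sup>T) * U = diag_of_list fs" "length fs = k"
    "\<forall>i<k. (sing_val k W)\<^sup>2 \<le> fs ! i" "(sing_val k W)\<^sup>2 = fs ! (k - 1)" "0 \<le> sing_val k W"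
proof -
  obtain P es where P: "char_poly (W\<^sup>T * W) = (\<Prod>e\<leftarrow>es. [:- e, 1:])" "length es = m" "sorted_wrt (\<ge>) es"
    by (rule gram_spectrum[OF W])
  have Wt: "W\<^sup>T \<in> carrier_mat m k" using W by simp
  obtain U fs where U: "U \<in> carrier_mat k k" "U\<^sup>T * U = 1\<^sub>m k" "U * U\<^sup>T = 1\<^sub>m k"
    "U\<^sup>T * (W * W\<^sup>T) * U = diag_of_list fs"
    "char_poly (W * W\<^sup>T) = (\<Prod>e\<leftarrow>fs. [:- e, 1:])"
    "length fs = k" "sorted_wrt (\<ge>) fs" "\<forall>e\<in>set fs. e \<ge> 0"
    using gram_spectrum[OF Wt] unfolding transpose_transpose by metis
  have "es = fs @ replicate (m - k) 0"
    by (rule gram_spectra_wide[OF W \<open>k \<le> m\<close> P(1,3) U(5,7,8)])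
  then have sv: "sing_val k W = sqrt (fs ! (k - 1))"
    using \<open>1 \<le> k\<close> U(6) by (simp add: sing_val_def sing_val_list_eq[OF P(1,3)] nth_append)
  have last: "0 \<le> fs ! (k - 1)" using U(6,8) \<open>1 \<le> k\<close> by simp
  have "(sing_val k W)\<^sup>2 \<le> fs ! i" if "i < k" for i
  proof -
    have "fs ! (k - 1) \<le> fs ! i"
      using that U(6,7) by (cases "i = k - 1") (auto simp: sorted_wrt_iff_nth_less)
    then show ?thesis using last by (simp add: sv)
  qed
  then have "\<forall>i<k. (sing_val k W)\<^sup>2 \<le> fs ! i" by blast
  moreover have "(sing_val k W)\<^sup>2 = fs ! (k - 1)" "0 \<le> sing_val k W" using last by (simp_all add: sv)
  ultimately show thesis using that[OF U(1-4,6)] by blast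
qed

lemma wide_quadratic_form:
  assumes W: "W \<in> carrier_mat k m" and X: "X \<in> carrier_mat k s"
    and U: "U \<in> carrier_mat k k" "U * U\<^sup>T = 1\<^sub>m k"
    and diag: "U\<^sup>T * (W * W\<^sup>T) * U = diag_of_list fs"
  shows "(frob_norm (W\<^sup>T * X))\<^sup>2
    = (\<Sum>i<k. fs ! i * (\<Sum>j<s. ((U\<^sup>T * X) $$ (i, j))\<^sup>2))"
proof -
  have Wt: "W\<^sup>T \<in> carrier_mat m k" using W by simp
  have "(frob_norm (W\<^sup>T * X))\<^sup>2 = frob_inner X (W * W\<^sup>T * X)"
    using gram_quadratic_form[OF Wt X] by simp
  also have "\<dots> = (\<Sum>i<k. fs ! i * (\<Sum>j<s. ((U\<^sup>T * X) $$ (i, j))\<^sup>2))"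
    by (rule spectral_quadratic_form[OF _ U diag X]) (use W in simp)
  finally show ?thesis .
qed

lemma frob_norm_sq_carrier:
  assumes "X \<in> carrier_mat k s"
  shows "(frob_norm X)\<^sup>2 = (\<Sum>i<k. \<Sum>j<s. (X $$ (i, j))\<^sup>2)"
  unfolding frob_norm_sq frob_inner_carrier[OF assms] by (simp add: power2_eq_square)

lemma frob_norm_minus_commute:
  assumes "X \<in> carrier_mat k s" "Y \<in> carrier_mat k s"
  shows "frob_norm (X - Y) = frob_norm (Y - X)"
proof -
  have "frob_inner (X - Y) (X - Y) = frob_inner (Y - X) (Y - X)"
    unfolding frob_inner_carrier[OF minus_carrier_mat[OF assms(1)]] frob_inner_carrier[OF minus_carrier_mat[OF assms(2)]]
    using assms by (intro sum.cong refl) (simp add: algebra_simps)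
  then show ?thesis by (simp add: frob_norm_eq_sqrt)
qed

text \<open>\<open>N\<close> is the pseudoinverse \<open>W\<^sup>T G\<close>, where \<open>G\<close> is the inverse of \<open>W W\<^sup>T\<close>. Its norm is that of the diagonal matrix of
  the reciprocal singular values.\<close>

lemma wide_right_inverse:
  assumes W: "W \<in> carrier_mat k m" and "1 \<le> k" "k \<le> m" and c: "0 < c" "c < sing_val k W"
  obtains N where "N \<in> carrier_mat m k" "W * N = 1\<^sub>m k" "(N * W)\<^sup>T = N * W" "op_bounded N (1 / c)"
proof -
  obtain U fs where U: "U \<in> carrier_mat k k" "U\<^sup>T * U = 1\<^sub>m k" "U * U\<^sup>T = 1\<^sub>m k"
    "U\<^sup>T * (W * W\<^sup>T) * U = diag_of_list fs" "length fs = k"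
    "\<forall>i<k. (sing_val k W)\<^sup>2 \<le> fs ! i"
    using wide_spectrum[OF W \<open>1 \<le> k\<close> \<open>k \<le> m\<close>] by metis
  have fs: "c\<^sup>2 \<le> fs ! i" "0 < fs ! i" if "i < k" for i
  proof -
    have "c\<^sup>2 \<le> (sing_val k W)\<^sup>2" using c by (intro power_mono) auto
    also have "\<dots> \<le> fs ! i" using U(6) that by blast
    finally show "c\<^sup>2 \<le> fs ! i" .
    then show "0 < fs ! i" using c(1) by (meson less_le_trans zero_less_power)
  qed
  have Wt: "W\<^sup>T \<in> carrier_mat m k" and Ut: "U\<^sup>T \<in> carrier_mat k k" using W U(1) by auto
  define B where "B = W * W\<^sup>T"
  have B: "B \<in> carrier_mat k k" using W by (simp add: B_def)
  define D where "D = diag_of_list fs"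
  define D' where "D' = diag_of_list (map inverse fs)"
  have D: "D \<in> carrier_mat k k" and D': "D' \<in> carrier_mat k k"
    using U(5) by (simp_all add: D_def D'_def diag_of_list_def)
  have DD': "D * D' = 1\<^sub>m k"
  proof (rule eq_matI)
    fix i j assume "i < dim_row (1\<^sub>m k)" "j < dim_col (1\<^sub>m k)"
    then have ij: "i < k" "j < k" by auto
    have "(D * D') $$ (i, j) = (\<Sum>l<k. if i = l then (if l = j then 1 else 0) else 0)"
      unfolding mult_mat_entry[OF D D' ij]
      by (intro sum.cong refl) (use ij U(5) fs(2)[of i] in \<open>auto simp: D_def D'_def diag_of_list_def\<close>)
    then show "(D * D') $$ (i, j) = 1\<^sub>m k $$ (i, j)" using ij by simp
  qed (use D D' in auto)
  define G where "G = U * D' * U\<^sup>T"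
  have G: "G \<in> carrier_mat k k" using U(1) D' Ut by (simp add: G_def)
  have BU: "B * U = U * D"
  proof -
    have "U * D = U * (U\<^sup>T * (B * U))"
      unfolding D_def U(4)[symmetric] B_def[symmetric] assoc_mult_mat[OF Ut B U(1)] ..
    also have "\<dots> = U * U\<^sup>T * (B * U)"
      by (rule assoc_mult_mat[symmetric, OF U(1) Ut mult_carrier_mat[OF B U(1)]])
    also have "\<dots> = B * U" unfolding U(3) using B U(1) by simp
    finally show ?thesis ..
  qed
  have BG: "B * G = 1\<^sub>m k"
  proof -
    have "B * G = B * U * D' * U\<^sup>T"
      unfolding G_def using B U(1) D' Ut by (simp add: assoc_mult_mat[of _ k k _ k _ k])
    also have "\<dots> = U * (D * D') * U\<^sup>T"
      unfolding BU using D U(1) D' Ut by (simp add: assoc_mult_mat[of _ k k _ k _ k])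
    finally show ?thesis unfolding DD' using U(1,3) by simp
  qed
  have "D'\<^sup>T = D'" by (rule eq_matI) (auto simp: D'_def diag_of_list_def)
  from symmetric_conjugate[OF D' this Ut] have Gt: "G\<^sup>T = G"
    unfolding transpose_transpose G_def .
  define N where "N = W\<^sup>T * G"
  have N: "N \<in> carrier_mat m k" using Wt G by (simp add: N_def)
  have WN: "W * N = 1\<^sub>m k"
    unfolding N_def using assoc_mult_mat[OF W Wt G] BG by (simp add: B_def)
  have NW: "(N * W)\<^sup>T = N * W"
    unfolding N_def by (rule symmetric_conjugate[OF G Gt W])
  have "op_bounded N (1 / c)"
    unfolding op_bounded_def
  proof (intro allI ballI)
    fix s and X :: "real mat" assume "X \<in> carrier_mat (dim_col N) s"
    then have X: "X \<in> carrier_mat k s" using N by simp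
    define Y where "Y = U\<^sup>T * X"
    have Y: "Y \<in> carrier_mat k s" using Ut X by (simp add: Y_def)
    have GX: "G * X \<in> carrier_mat k s" using G X by simp
    have UGX: "U\<^sup>T * (G * X) = D' * Y"
    proof -
      have "U\<^sup>T * G = U\<^sup>T * (U * (D' * U\<^sup>T))"
        unfolding G_def assoc_mult_mat[OF U(1) D' Ut] ..
      also have "\<dots> = U\<^sup>T * U * (D' * U\<^sup>T)"
        by (rule assoc_mult_mat[symmetric, OF Ut U(1) mult_carrier_mat[OF D' Ut]])
      also have "\<dots> = D' * U\<^sup>T" unfolding U(2) using D' Ut by simp
      finally show ?thesis
        unfolding Y_def assoc_mult_mat[OF Ut G X, symmetric] assoc_mult_mat[OF D' Ut X, symmetric] by simp
    qed
    have ent: "(D' * Y) $$ (i, j) = inverse (fs ! i) * Y $$ (i, j)" if "i < k" "j < s" for i j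
    proof -
      have "(D' * Y) $$ (i, j) = (\<Sum>l<k. if i = l then inverse (fs ! i) * Y $$ (l, j) else 0)"
        unfolding mult_mat_entry[OF D' Y that]
        by (intro sum.cong refl) (use that U(5) in \<open>auto simp: D'_def diag_of_list_def\<close>)
      then show ?thesis using that by simp
    qed
    have "N * X = W\<^sup>T * (G * X)"
      unfolding N_def by (rule assoc_mult_mat[OF Wt G X])
    then have "(frob_norm (N * X))\<^sup>2 = (\<Sum>i<k. fs ! i * (\<Sum>j<s. ((D' * Y) $$ (i, j))\<^sup>2))"
      using wide_quadratic_form[OF W GX U(1,3,4)] UGX by simp
    also have "\<dots> \<le> (\<Sum>i<k. (1 / c)\<^sup>2 * (\<Sum>j<s. (Y $$ (i, j))\<^sup>2))"
    proof (rule sum_mono)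
      fix i assume "i \<in> {..<k}"
      then have i: "i < k" by simp
      have "fs ! i * (\<Sum>j<s. ((D' * Y) $$ (i, j))\<^sup>2)
          = fs ! i * (\<Sum>j<s. (inverse (fs ! i))\<^sup>2 * (Y $$ (i, j))\<^sup>2)"
        by (simp add: ent[OF i] power_mult_distrib del: index_mult_mat(1))
      also have "\<dots> = inverse (fs ! i) * (\<Sum>j<s. (Y $$ (i, j))\<^sup>2)"
        using fs(2)[OF i] by (simp add: power2_eq_square flip: sum_distrib_left)
      also have "\<dots> \<le> (1 / c)\<^sup>2 * (\<Sum>j<s. (Y $$ (i, j))\<^sup>2)"
        using fs[OF i] c(1) by (intro mult_right_mono sum_nonneg) (auto simp: field_simps)
      finally show "fs ! i * (\<Sum>j<s. ((D' * Y) $$ (i, j))\<^sup>2) \<le> (1 / c)\<^sup>2 * (\<Sum>j<s. (Y $$ (i, j))\<^sup>2)" .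
    qed
    also have "\<dots> = (1 / c * frob_norm Y)\<^sup>2"
      unfolding power_mult_distrib frob_norm_sq_carrier[OF Y] sum_distrib_left ..
    also have "frob_norm Y = frob_norm X"
      unfolding Y_def by (rule frob_norm_isometry[OF Ut _ X]) (use U(3) in simp)
    finally show "frob_norm (N * X) \<le> 1 / c * frob_norm X"
      by (rule power2_le_imp_le) (use c(1) frob_norm_nonneg[of X] in simp)
  qed
  then show thesis by (rule that[OF N WN NW])
qed

text \<open>By \<open>orthogonal_projection_best\<close> it suffices to find one good approximation to \<open>A\<close> of the form \<open>Q S F\<close>.
  Take \<open>F = N V\<^sup>T\<close> with a right inverse \<open>N\<close> of \<open>W = V\<^sup>T \<Omega>\<close>, of norm at most \<open>1 / c\<close>, and let \<open>E = A - A V V\<^sup>T\<close>.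
  Because \<open>W F = V\<^sup>T\<close>, the matrix \<open>A \<Omega> F\<close> differs from \<open>A\<close> by \<open>E - E \<Omega> F\<close> only. Replacing the sketch
  \<open>A \<Omega>\<close> by \<open>Q S\<close> costs the tail of its singular values, which is at most \<open>\<parallel>E \<Omega>\<parallel>\<close> by Eckart--Young, because
  \<open>A \<Omega> - E \<Omega> = A V W\<close> has rank at most \<open>k\<close>. Each of \<open>E \<Omega> F\<close> and the tail times \<open>F\<close> contributes
  \<open>(K / c) \<parallel>E\<parallel>\<close>.\<close>

lemma range_finder_error:
  assumes A: "A \<in> carrier_mat p r" and \<Omega>: "\<Omega> \<in> carrier_mat r m" and V: "V \<in> carrier_mat r k" "V\<^sup>T * V = 1\<^sub>m k"
    and Q: "Q \<in> carrier_mat p k" "Q\<^sup>T * Q = 1\<^sub>m k" and S: "S \<in> carrier_mat k m"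
    and best: "frob_norm (Q * S - A * \<Omega>) = sv_tail (Suc k) (A * \<Omega>)"
    and K: "op_bounded \<Omega> K" "0 \<le> K" and "1 \<le> k" "k \<le> m" and c: "0 < c" "c < sing_val k (V\<^sup>T * \<Omega>)"
  shows "frob_norm (A - Q * (Q\<^sup>T * A)) \<le> (1 + 2 * (K / c)) * frob_norm (A - A * (V * V\<^sup>T))"
proof -
  define W where "W = V\<^sup>T * \<Omega>"
  have Vt: "V\<^sup>T \<in> carrier_mat k r" using V(1) by simp
  have W: "W \<in> carrier_mat k m" using Vt \<Omega> by (simp add: W_def)
  obtain N where N: "N \<in> carrier_mat m k" "W * N = 1\<^sub>m k" "(N * W)\<^sup>T = N * W" "op_bounded N (1 / c)"
    using wide_right_inverse[OF W \<open>1 \<le> k\<close> \<open>k \<le> m\<close> c(1)] c(2) unfolding W_def by metis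
  define F where "F = N * V\<^sup>T"
  define E where "E = A - A * (V * V\<^sup>T)"
  define Z where "Z = A * \<Omega>"
  have F: "F \<in> carrier_mat m r" using N(1) Vt by (simp add: F_def)
  have VV: "V * V\<^sup>T \<in> carrier_mat r r" using V(1) by simp
  have AV: "A * V \<in> carrier_mat p k" using A V(1) by simp
  have AVV: "A * (V * V\<^sup>T) \<in> carrier_mat p r" using A VV by simp
  have E: "E \<in> carrier_mat p r" unfolding E_def by (rule minus_carrier_mat[OF AVV])
  have Z: "Z \<in> carrier_mat p m" using A \<Omega> by (simp add: Z_def)
  have QS: "Q * S \<in> carrier_mat p m" using Q(1) S by simp
  have SF: "S * F \<in> carrier_mat k r" using S F by simp
  have QSF: "Q * (S * F) \<in> carrier_mat p r" using Q(1) SF by simp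
  have AVW: "A * (V * V\<^sup>T) * \<Omega> = A * V * W"
    unfolding W_def assoc_mult_mat[OF A V(1) Vt, symmetric] by (rule assoc_mult_mat[OF AV Vt \<Omega>])
  have "op_bounded F (1 / c * 1)"
    unfolding F_def by (rule op_bounded_mult[OF N(4) op_bounded_transpose_isometry[OF V] _ N(1) Vt]) (use c(1) in simp)
  then have Fb: "op_bounded F (1 / c)" by simp
  have E\<Omega>: "E * \<Omega> = Z - A * V * W"
    unfolding E_def Z_def minus_mult_distrib_mat[OF A AVV \<Omega>] AVW ..
  have E\<Omega>_c: "E * \<Omega> \<in> carrier_mat p m" using E \<Omega> by simp
  have tail: "sv_tail (Suc k) Z \<le> K * frob_norm E"
  proof -
    have "sv_tail (Suc k) Z \<le> frob_norm (E * \<Omega>)"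
      unfolding E\<Omega> by (rule sv_tail_le_low_rank_distance[OF Z AV W N(1-3) \<open>k \<le> m\<close>])
    also have "\<dots> \<le> K * frob_norm E" by (rule op_bounded_right[OF K \<Omega> E])
    finally show ?thesis .
  qed
  have WF: "A * V * W * F = A * (V * V\<^sup>T)"
  proof -
    have "A * V * W * F = A * V * (W * F)" by (rule assoc_mult_mat[OF AV W F])
    also have "W * F = V\<^sup>T"
      unfolding F_def using assoc_mult_mat[OF W N(1) Vt] N(2) Vt by simp
    also have "A * V * V\<^sup>T = A * (V * V\<^sup>T)" by (rule assoc_mult_mat[OF A V(1) Vt])
    finally show ?thesis .
  qed
  have AVWc: "A * V * W \<in> carrier_mat p m" using AV W by simp
  have ZF: "Z * F \<in> carrier_mat p r" using Z F by simp
  define T1 where "T1 = A * (V * V\<^sup>T) - Z * F"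
  define T2 where "T2 = (Z - Q * S) * F"
  have T2: "T2 \<in> carrier_mat p r" unfolding T2_def by (rule mult_carrier_mat[OF minus_carrier_mat[OF QS] F])
  have T1: "T1 \<in> carrier_mat p r" unfolding T1_def by (rule minus_carrier_mat[OF ZF])
  have "frob_norm (A - Q * (Q\<^sup>T * A)) \<le> frob_norm (A - Q * (S * F))"
    by (rule orthogonal_projection_best[OF Q A SF])
  also have "A - Q * (S * F) = E + (T1 + T2)"
  proof -
    have T2': "T2 = Z * F - Q * (S * F)"
      unfolding T2_def minus_mult_distrib_mat[OF Z QS F] assoc_mult_mat[OF Q(1) S F] ..
    show ?thesis
      unfolding T2' T1_def E_def
      using A AVV ZF QSF
      by (intro eq_matI) (simp_all del: index_mult_mat)
  qed
  also have "frob_norm \<dots> \<le> frob_norm E + (frob_norm T1 + frob_norm T2)"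
    using frob_norm_triangle[OF E add_carrier_mat[OF T2, of T1]] frob_norm_triangle[OF T1 T2] by linarith
  finally have "frob_norm (A - Q * (Q\<^sup>T * A)) \<le> frob_norm E + (frob_norm T1 + frob_norm T2)" .
  moreover have "frob_norm T1 \<le> 1 / c * (K * frob_norm E)"
  proof -
    have "E * \<Omega> * F = Z * F - A * (V * V\<^sup>T)"
      unfolding E\<Omega> minus_mult_distrib_mat[OF Z AVWc F] WF ..
    then have "frob_norm T1 = frob_norm (E * \<Omega> * F)"
      unfolding T1_def by (simp only: frob_norm_minus_commute[OF AVV ZF])
    also have "\<dots> \<le> 1 / c * frob_norm (E * \<Omega>)"
      by (rule op_bounded_right[OF Fb _ F E\<Omega>_c]) (use c(1) in simp)
    also have "\<dots> \<le> 1 / c * (K * frob_norm E)"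
      by (intro mult_left_mono op_bounded_right[OF K \<Omega> E]) (use c(1) in simp)
    finally show ?thesis .
  qed
  moreover have "frob_norm T2 \<le> 1 / c * (K * frob_norm E)"
  proof -
    have "frob_norm T2 \<le> 1 / c * frob_norm (Z - Q * S)"
      unfolding T2_def by (rule op_bounded_right[OF Fb _ F minus_carrier_mat[OF QS]]) (use c(1) in simp)
    also have "frob_norm (Z - Q * S) = sv_tail (Suc k) Z"
      using best frob_norm_minus_commute[OF Z QS] by (simp add: Z_def)
    also have "1 / c * sv_tail (Suc k) Z \<le> 1 / c * (K * frob_norm E)"
      by (intro mult_left_mono tail) (use c(1) in simp)
    finally show ?thesis .
  qed
  ultimately have "frob_norm (A - Q * (Q\<^sup>T * A))
      \<le> frob_norm E + (1 / c * (K * frob_norm E) + 1 / c * (K * frob_norm E))" by linarith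
  also have "\<dots> = (1 + 2 * (K / c)) * frob_norm E" by (simp add: algebra_simps)
  finally show ?thesis by (simp add: E_def)
qed

section \<open>Joint normality from characteristic functions\<close>

text \<open>If weighting by \<open>Z\<close> only rescales the characteristic function of \<open>X\<close>, then \<open>Z\<close> is uncorrelated with the events of
  \<open>X\<close>: the normalized weighted law of \<open>X\<close> is a probability measure, and Levy's uniqueness theorem identifies it.\<close>

lemma (in prob_space) nonneg_weight_factorizes:
  fixes Z X :: "'a \<Rightarrow> real"
  assumes Z[measurable]: "Z \<in> borel_measurable M" and X[measurable]: "X \<in> borel_measurable M"
    and bnd: "\<And>\<omega>. 0 \<le> Z \<omega>" "\<And>\<omega>. Z \<omega> \<le> C"
    and N: "real_distribution N"
    and char_eq: "\<And>s. (CLINT \<omega>|M. complex_of_real (Z \<omega>) * iexp (s * X \<omega>)) = complex_of_real (expectation Z) * char N s"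
    and B[measurable]: "B \<in> sets borel"
  shows "expectation (\<lambda>\<omega>. Z \<omega> * indicator B (X \<omega>)) = expectation Z * measure N B"
proof -
  have int: "integrable M Z"
    by (rule integrable_const_bound[where B = C]) (use bnd in auto)
  define c where "c = expectation Z"
  have "c \<ge> 0" unfolding c_def by (rule integral_nonneg_AE) (use bnd in auto)
  show ?thesis
  proof (cases "c = 0")
    case True
    then have "AE \<omega> in M. Z \<omega> = 0"
      using integral_nonneg_eq_0_iff_AE[OF int] bnd by (simp add: c_def)
    then have "expectation (\<lambda>\<omega>. Z \<omega> * indicator B (X \<omega>)) = expectation (\<lambda>\<omega>. 0)"
      by (intro integral_cong_AE) auto
    then show ?thesis using True by (simp add: c_def)
  next
    case False
    with \<open>c \<ge> 0\<close> have c: "c > 0" by simp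
    define D where "D = density M (\<lambda>\<omega>. ennreal (Z \<omega> / c))"
    define L where "L = distr D borel X"
    have XD[measurable]: "X \<in> borel_measurable D" by (simp add: D_def)
    have "prob_space D"
    proof
      have "emeasure D (space D) = (\<integral>\<^sup>+\<omega>. ennreal (Z \<omega> / c) \<partial>M)"
        by (simp add: D_def emeasure_density cong: nn_integral_cong)
      also have "\<dots> = ennreal (expectation (\<lambda>\<omega>. Z \<omega> / c))"
        using c bnd int by (intro nn_integral_eq_integral) auto
      also have "\<dots> = 1" using c by (simp add: c_def)
      finally show "emeasure D (space D) = 1" .
    qed
    then interpret D: prob_space D .
    have L: "real_distribution L"
      unfolding L_def by (rule D.real_distribution_distr) (rule XD)
    have "char L = char N"
    proof
      fix s
      have "char L s = (CLINT \<omega>|D. iexp (s * X \<omega>))"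
        unfolding char_def L_def by (rule integral_distr) (simp_all add: XD)
      also have "\<dots> = (CLINT \<omega>|M. (Z \<omega> / c) *\<^sub>R iexp (s * X \<omega>))"
        unfolding D_def using bnd c by (subst integral_density) auto
      also have "\<dots> = (CLINT \<omega>|M. (1 / c) *\<^sub>R (complex_of_real (Z \<omega>) * iexp (s * X \<omega>)))"
        by (simp add: scaleR_conv_of_real)
      also have "\<dots> = (1 / c) *\<^sub>R (CLINT \<omega>|M. complex_of_real (Z \<omega>) * iexp (s * X \<omega>))"
        by (rule integral_scaleR_right)
      also have "\<dots> = char N s"
        unfolding char_eq using c by (simp add: c_def[symmetric] scaleR_conv_of_real)
      finally show "char L s = char N s" .
    qed
    then have "L = N" by (rule Levy_uniqueness[OF L N])
    have "measure L B = (\<integral>x. indicator B x \<partial>L)" 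
      using B by (simp add: L_def)
    also have "\<dots> = (\<integral>\<omega>. indicator B (X \<omega>) \<partial>D)"
      unfolding L_def by (rule integral_distr) (simp_all add: XD)
    also have "\<dots> = expectation (\<lambda>\<omega>. (Z \<omega> / c) * indicator B (X \<omega>))"
      unfolding D_def using bnd c by (subst integral_density) auto
    also have "\<dots> = expectation (\<lambda>\<omega>. Z \<omega> * indicator B (X \<omega>)) / c" by simp
    finally show ?thesis using c \<open>L = N\<close> by (simp add: c_def field_simps)
  qed
qed

text \<open>Passing to complex weights: conjugating the hypothesis shows that the real and the imaginary part
  of \<open>Z\<close> satisfy it too.\<close>

lemma (in prob_space) complex_weight_factorizes:
  fixes X :: "'a \<Rightarrow> real" and Z :: "'a \<Rightarrow> complex"
  assumes Z[measurable]: "Z \<in> borel_measurable M" and X[measurable]: "X \<in> borel_measurable M"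
    and bnd: "\<And>\<omega>. cmod (Z \<omega>) \<le> 1"
    and N: "real_distribution N"
    and law: "\<And>s. (CLINT \<omega>|M. iexp (s * X \<omega>)) = char N s"
    and char_eq: "\<And>s. (CLINT \<omega>|M. Z \<omega> * iexp (s * X \<omega>)) = (CLINT \<omega>|M. Z \<omega>) * char N s"
    and B[measurable]: "B \<in> sets borel"
  shows "(CLINT \<omega>|M. Z \<omega> * indicator B (X \<omega>)) = (CLINT \<omega>|M. Z \<omega>) * complex_of_real (measure N B)"
proof -
  interpret N: real_distribution N by (rule N)
  have int: "integrable M Z" by (rule integrable_const_bound[where B = 1]) (use bnd in auto)
  have int_iexp: "integrable M (\<lambda>\<omega>. W \<omega> * iexp (s * X \<omega>))"
    if [measurable]: "W \<in> borel_measurable M" and "\<And>\<omega>. cmod (W \<omega>) \<le> 1" for s and W :: "'a \<Rightarrow> complex"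
    by (rule integrable_const_bound[where B = 1]) (use that(2) in \<open>auto simp: norm_mult\<close>)
  have char_neg: "cnj (char N (- s)) = char N s" for s
  proof -
    have "cnj (char N (- s)) = (CLINT x|N. cnj (iexp (- s * x)))"
      unfolding char_def by (rule Bochner_Integration.integral_cnj[symmetric])
    also have "\<dots> = char N s" unfolding char_def
      by (intro Bochner_Integration.integral_cong refl) (simp add: exp_cnj)
    finally show ?thesis .
  qed
  \<comment> \<open>Adding 1 makes a real weight of modulus at most 1 nonnegative. The hypothesis on \<open>Y\<close> survives because the
    constant weight satisfies it as well, by \<open>law\<close>.\<close>
  have real: "expectation (\<lambda>\<omega>. Y \<omega> * indicator B (X \<omega>)) = expectation Y * measure N B"
    if Y[measurable]: "Y \<in> borel_measurable M" and Yb: "\<And>\<omega>. \<bar>Y \<omega>\<bar> \<le> 1"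
      and YX: "\<And>s. (CLINT \<omega>|M. complex_of_real (Y \<omega>) * iexp (s * X \<omega>)) = complex_of_real (expectation Y) * char N s"
    for Y :: "'a \<Rightarrow> real"
  proof -
    have intY: "integrable M Y" by (rule integrable_const_bound[where B = 1]) (use Yb in auto)
    have "expectation (\<lambda>\<omega>. (Y \<omega> + 1) * indicator B (X \<omega>)) = expectation (\<lambda>\<omega>. Y \<omega> + 1) * measure N B"
    proof (rule nonneg_weight_factorizes[OF _ X _ _ N _ B])
      show "0 \<le> Y \<omega> + 1" "Y \<omega> + 1 \<le> 2" for \<omega> using Yb[of \<omega>] by (auto simp: abs_le_iff)
      fix s
      have "(CLINT \<omega>|M. complex_of_real (Y \<omega> + 1) * iexp (s * X \<omega>))
        = (CLINT \<omega>|M. complex_of_real (Y \<omega>) * iexp (s * X \<omega>) + iexp (s * X \<omega>))"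
        by (simp add: algebra_simps)
      also have "\<dots> = (CLINT \<omega>|M. complex_of_real (Y \<omega>) * iexp (s * X \<omega>)) + (CLINT \<omega>|M. iexp (s * X \<omega>))"
        using int_iexp[of "\<lambda>\<omega>. complex_of_real (Y \<omega>)" s] int_iexp[of "\<lambda>_. 1" s] Yb
        by (intro Bochner_Integration.integral_add) auto
      also have "\<dots> = complex_of_real (expectation Y) * char N s + char N s"
        unfolding YX law ..
      also have "\<dots> = complex_of_real (expectation (\<lambda>\<omega>. Y \<omega> + 1)) * char N s"
        using Bochner_Integration.integral_add[OF intY, of "\<lambda>_. 1"] by (simp add: prob_space distrib_right)
      finally show "(CLINT \<omega>|M. complex_of_real (Y \<omega> + 1) * iexp (s * X \<omega>))
        = complex_of_real (expectation (\<lambda>\<omega>. Y \<omega> + 1)) * char N s" .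
    qed simp
    moreover have "expectation (\<lambda>\<omega>. 1 * indicator B (X \<omega>)) = expectation (\<lambda>\<omega>. 1) * measure N B"
      by (rule nonneg_weight_factorizes[OF _ X _ _ N _ B, where C = 1]) (use law in \<open>simp_all add: prob_space\<close>)
    moreover have "expectation (\<lambda>\<omega>. (Y \<omega> + 1) * indicator B (X \<omega>))
        = expectation (\<lambda>\<omega>. Y \<omega> * indicator B (X \<omega>)) + expectation (\<lambda>\<omega>. 1 * indicator B (X \<omega>))"
    proof -
      have "integrable M (\<lambda>\<omega>. Y \<omega> * indicator B (X \<omega>))"
        by (rule integrable_const_bound[where B = 1]) (use Yb in \<open>auto simp: indicator_def\<close>)
      moreover have "integrable M (\<lambda>\<omega>. 1 * indicator B (X \<omega>) :: real)"
        by (rule integrable_const_bound[where B = 1]) (auto simp: indicator_def)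
      ultimately show ?thesis
        by (subst Bochner_Integration.integral_add[symmetric]) (auto simp: algebra_simps)
    qed
    ultimately show ?thesis using intY by (simp add: prob_space algebra_simps)
  qed
  have char_cnj: "(CLINT \<omega>|M. cnj (Z \<omega>) * iexp (s * X \<omega>)) = cnj (CLINT \<omega>|M. Z \<omega>) * char N s" for s
  proof -
    have "(CLINT \<omega>|M. cnj (Z \<omega>) * iexp (s * X \<omega>)) = (CLINT \<omega>|M. cnj (Z \<omega> * iexp (- s * X \<omega>)))"
      by (intro Bochner_Integration.integral_cong refl) (simp add: exp_cnj)
    also have "\<dots> = cnj (CLINT \<omega>|M. Z \<omega> * iexp (- s * X \<omega>))" by (rule Bochner_Integration.integral_cnj)
    also have "\<dots> = cnj (CLINT \<omega>|M. Z \<omega>) * char N s" by (simp only: char_eq complex_cnj_mult char_neg)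
    finally show ?thesis .
  qed
  have [measurable]: "cnj \<in> borel_measurable borel"
    by (intro borel_measurable_continuous_onI continuous_intros)
  have Zc: "integrable M (\<lambda>\<omega>. Z \<omega> * iexp (s * X \<omega>))" "integrable M (\<lambda>\<omega>. cnj (Z \<omega>) * iexp (s * X \<omega>))" for s
    by (rule int_iexp; use bnd in auto)+
  have re: "expectation (\<lambda>\<omega>. Re (Z \<omega>) * indicator B (X \<omega>)) = expectation (\<lambda>\<omega>. Re (Z \<omega>)) * measure N B"
  proof (rule real)
    show "\<bar>Re (Z \<omega>)\<bar> \<le> 1" for \<omega> using bnd[of \<omega>] abs_Re_le_cmod order_trans by blast
    fix s
    have "(CLINT \<omega>|M. complex_of_real (Re (Z \<omega>)) * iexp (s * X \<omega>))
        = (CLINT \<omega>|M. (Z \<omega> * iexp (s * X \<omega>) + cnj (Z \<omega>) * iexp (s * X \<omega>)) / 2)"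
      by (intro Bochner_Integration.integral_cong refl) (simp add: distrib_right[symmetric] complex_add_cnj)
    also have "\<dots> = ((CLINT \<omega>|M. Z \<omega> * iexp (s * X \<omega>)) + (CLINT \<omega>|M. cnj (Z \<omega>) * iexp (s * X \<omega>))) / 2"
      unfolding integral_divide_zero Bochner_Integration.integral_add[OF Zc] ..
    also have "\<dots> = ((CLINT \<omega>|M. Z \<omega>) * char N s + cnj (CLINT \<omega>|M. Z \<omega>) * char N s) / 2"
      unfolding char_eq char_cnj ..
    also have "\<dots> = complex_of_real (Re (CLINT \<omega>|M. Z \<omega>)) * char N s"
      by (simp add: distrib_right[symmetric] complex_add_cnj)
    finally show "(CLINT \<omega>|M. complex_of_real (Re (Z \<omega>)) * iexp (s * X \<omega>))
        = complex_of_real (expectation (\<lambda>\<omega>. Re (Z \<omega>))) * char N s"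
      using int by simp
  qed simp
  have im: "expectation (\<lambda>\<omega>. Im (Z \<omega>) * indicator B (X \<omega>)) = expectation (\<lambda>\<omega>. Im (Z \<omega>)) * measure N B"
  proof (rule real)
    show "\<bar>Im (Z \<omega>)\<bar> \<le> 1" for \<omega> using bnd[of \<omega>] abs_Im_le_cmod order_trans by blast
    fix s
    have half: "complex_of_real (Im z) = (z - cnj z) / (2 * \<i>)" for z
      by (simp add: complex_eq_iff)
    have "(CLINT \<omega>|M. complex_of_real (Im (Z \<omega>)) * iexp (s * X \<omega>))
        = (CLINT \<omega>|M. (Z \<omega> * iexp (s * X \<omega>) - cnj (Z \<omega>) * iexp (s * X \<omega>)) / (2 * \<i>))"
      by (intro Bochner_Integration.integral_cong refl) (simp only: half left_diff_distrib[symmetric] times_divide_eq_left)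
    also have "\<dots> = ((CLINT \<omega>|M. Z \<omega> * iexp (s * X \<omega>)) - (CLINT \<omega>|M. cnj (Z \<omega>) * iexp (s * X \<omega>))) / (2 * \<i>)"
      unfolding integral_divide_zero Bochner_Integration.integral_diff[OF Zc] ..
    also have "\<dots> = ((CLINT \<omega>|M. Z \<omega>) * char N s - cnj (CLINT \<omega>|M. Z \<omega>) * char N s) / (2 * \<i>)"
      unfolding char_eq char_cnj ..
    also have "\<dots> = complex_of_real (Im (CLINT \<omega>|M. Z \<omega>)) * char N s"
      by (simp only: half left_diff_distrib[symmetric] times_divide_eq_left)
    finally show "(CLINT \<omega>|M. complex_of_real (Im (Z \<omega>)) * iexp (s * X \<omega>))
        = complex_of_real (expectation (\<lambda>\<omega>. Im (Z \<omega>))) * char N s"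
      using int by simp
  qed simp
  have intB: "integrable M (\<lambda>\<omega>. Z \<omega> * indicator B (X \<omega>))"
    by (rule integrable_const_bound[where B = 1]) (use bnd in \<open>auto simp: indicator_def\<close>)
  show ?thesis
  proof (rule complex_eqI)
    have "Re (CLINT \<omega>|M. Z \<omega> * indicator B (X \<omega>)) = expectation (\<lambda>\<omega>. Re (Z \<omega> * indicator B (X \<omega>)))"
      by (rule integral_Re[symmetric, OF intB])
    also have "\<dots> = expectation (\<lambda>\<omega>. Re (Z \<omega>) * indicator B (X \<omega>))"
      by (intro Bochner_Integration.integral_cong) (auto simp: indicator_def)
    finally show "Re (CLINT \<omega>|M. Z \<omega> * indicator B (X \<omega>))
        = Re ((CLINT \<omega>|M. Z \<omega>) * complex_of_real (measure N B))"
      using int by (simp add: re)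
    have "Im (CLINT \<omega>|M. Z \<omega> * indicator B (X \<omega>)) = expectation (\<lambda>\<omega>. Im (Z \<omega> * indicator B (X \<omega>)))"
      by (rule integral_Im[symmetric, OF intB])
    also have "\<dots> = expectation (\<lambda>\<omega>. Im (Z \<omega>) * indicator B (X \<omega>))"
      by (intro Bochner_Integration.integral_cong) (auto simp: indicator_def)
    finally show "Im (CLINT \<omega>|M. Z \<omega> * indicator B (X \<omega>))
        = Im ((CLINT \<omega>|M. Z \<omega>) * complex_of_real (measure N B))"
      using int by (simp add: im)
  qed
qed

text \<open>The Cramer--Wold principle. The variables are converted from Fourier modes to events one at a
  time; the events reached so far and the remaining modes form the complex weight of the next variable.\<close>

lemma (in prob_space) joint_std_normal_if_char:
  fixes X :: "'i \<Rightarrow> 'a \<Rightarrow> real"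
  assumes K: "finite K" and X[measurable]: "\<And>k. k \<in> K \<Longrightarrow> X k \<in> borel_measurable M"
    and cf: "\<And>t. (CLINT \<omega>|M. iexp (\<Sum>k\<in>K. t k * X k \<omega>)) = complex_of_real (exp (- (\<Sum>k\<in>K. (t k)\<^sup>2) / 2))"
  shows "distr M (\<Pi>\<^sub>M k\<in>K. borel) (\<lambda>\<omega>. \<lambda>k\<in>K. X k \<omega>) = (\<Pi>\<^sub>M k\<in>K. std_normal_distribution)"
proof -
  let ?N = std_normal_distribution
  have N: "real_distribution ?N" by (rule real_dist_normal_dist)
  have "(CLINT \<omega>|M. (\<Prod>k\<in>J. indicator (B k) (X k \<omega>)) * iexp (\<Sum>k\<in>K - J. t k * X k \<omega>))
      = complex_of_real ((\<Prod>k\<in>J. measure ?N (B k)) * exp (- (\<Sum>k\<in>K - J. (t k)\<^sup>2) / 2))"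
    if "J \<subseteq> K" "\<forall>k\<in>J. B k \<in> sets borel" for J B t
    using finite_subset[OF that(1) K] that
  proof (induction J arbitrary: t rule: finite_induct)
    case empty
    then show ?case using cf by simp
  next
    case (insert j J)
    then have j: "j \<in> K" "j \<notin> J" and J: "J \<subseteq> K" and B: "B j \<in> sets borel" "\<forall>k\<in>J. B k \<in> sets borel" by auto
    have KJ: "K - J = insert j (K - insert j J)" using j by auto
    have Xj: "X j \<in> borel_measurable M" using j by simp
    have Xm[measurable]: "X k \<in> borel_measurable M" if "k \<in> J" for k using that J by auto
    have Bm[measurable]: "B k \<in> sets borel" if "k \<in> J" for k using that B(2) by auto
    have X'[measurable]: "X k \<in> borel_measurable M" if "k \<in> K - insert j J" for k using that by simp
    define Z where "Z \<omega> = (\<Prod>k\<in>J. indicator (B k) (X k \<omega>)) * iexp (\<Sum>k\<in>K - insert j J. t k * X k \<omega>)" for \<omega>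
    define p where "p = complex_of_real ((\<Prod>k\<in>J. measure ?N (B k)) * exp (- (\<Sum>k\<in>K - insert j J. (t k)\<^sup>2) / 2))"
    \<comment> \<open>The mode \<open>s\<close> of \<open>X j\<close> is one more remaining mode: the induction hypothesis applies with \<open>t j\<close> changed to \<open>s\<close>.\<close>
    have ZX: "(CLINT \<omega>|M. Z \<omega> * iexp (s * X j \<omega>)) = p * complex_of_real (exp (- s\<^sup>2 / 2))" for s
    proof -
      have "(\<Sum>k\<in>K - J. (t(j := s)) k * X k \<omega>) = s * X j \<omega> + (\<Sum>k\<in>K - insert j J. t k * X k \<omega>)" for \<omega>
        unfolding KJ using K by (subst sum.insert) (auto intro!: sum.cong)
      then have "Z \<omega> * iexp (s * X j \<omega>)
          = (\<Prod>k\<in>J. indicator (B k) (X k \<omega>)) * iexp (\<Sum>k\<in>K - J. (t(j := s)) k * X k \<omega>)" for \<omega>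
        unfolding Z_def by (simp add: exp_add distrib_left mult_ac del: of_real_sum fun_upd_apply)
      then have "(CLINT \<omega>|M. Z \<omega> * iexp (s * X j \<omega>))
          = complex_of_real ((\<Prod>k\<in>J. measure ?N (B k)) * exp (- (\<Sum>k\<in>K - J. ((t(j := s)) k)\<^sup>2) / 2))"
        using insert.IH[OF J B(2), of "t(j := s)"] by simp
      also have "(\<Sum>k\<in>K - J. ((t(j := s)) k)\<^sup>2) = s\<^sup>2 + (\<Sum>k\<in>K - insert j J. (t k)\<^sup>2)"
        unfolding KJ using K by (subst sum.insert) (auto intro!: sum.cong)
      also have "exp (- (s\<^sup>2 + (\<Sum>k\<in>K - insert j J. (t k)\<^sup>2)) / 2)
          = exp (- (\<Sum>k\<in>K - insert j J. (t k)\<^sup>2) / 2) * exp (- s\<^sup>2 / 2)"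
        by (simp add: exp_add[symmetric] add_divide_distrib diff_divide_distrib)
      finally show ?thesis by (simp add: p_def)
    qed
    have Z0: "(CLINT \<omega>|M. Z \<omega>) = p" using ZX[of 0] by simp
    have "(CLINT \<omega>|M. Z \<omega> * indicator (B j) (X j \<omega>)) = (CLINT \<omega>|M. Z \<omega>) * complex_of_real (measure ?N (B j))"
    proof (rule complex_weight_factorizes[OF _ Xj _ N _ _ B(1)])
      show "Z \<in> borel_measurable M" unfolding Z_def by measurable
      show "cmod (Z \<omega>) \<le> 1" for \<omega>
      proof -
        have "cmod (\<Prod>k\<in>J. indicator (B k) (X k \<omega>)) \<le> 1"
          unfolding prod_norm[symmetric] by (intro prod_le_1) (auto simp: indicator_def)
        then show ?thesis by (simp add: Z_def norm_mult del: of_real_sum)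
      qed
      show "(CLINT \<omega>|M. iexp (s * X j \<omega>)) = char ?N s" for s
      proof -
        have "(\<Sum>k\<in>K. (if k = j then s else 0) * X k \<omega>) = s * X j \<omega>" for \<omega>
          using K j by (simp add: if_distrib[of "\<lambda>x. x * _"] cong: if_cong)
        moreover have "(\<Sum>k\<in>K. (if k = j then s else 0)\<^sup>2) = s\<^sup>2"
          using K j by (simp add: if_distrib[of "\<lambda>x. x\<^sup>2"] cong: if_cong)
        ultimately show ?thesis
          using cf[of "\<lambda>k. if k = j then s else 0"] by (simp only: char_std_normal_distribution)
      qed
      show "(CLINT \<omega>|M. Z \<omega> * iexp (s * X j \<omega>)) = (CLINT \<omega>|M. Z \<omega>) * char ?N s" for s
        unfolding ZX Z0 by (simp add: char_std_normal_distribution)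
    qed
    then show ?case
      using insert.hyps unfolding Z0 by (simp add: Z_def p_def mult_ac del: of_real_sum)
  qed
  note key = this[OF subset_refl]
  interpret P: product_sigma_finite "\<lambda>_::'i. ?N"
    by (intro product_sigma_finite.intro prob_space_imp_sigma_finite real_distribution.axioms(1) N)
  show ?thesis
  proof (rule P.PiM_eqI[OF K])
    have "sets (\<Pi>\<^sub>M k\<in>K. ?N) = sets (\<Pi>\<^sub>M k\<in>K. borel)" by (intro sets_PiM_cong) auto
    then show "sets (distr M (\<Pi>\<^sub>M k\<in>K. borel) (\<lambda>\<omega>. \<lambda>k\<in>K. X k \<omega>)) = sets (\<Pi>\<^sub>M k\<in>K. ?N)" by simp
    fix B assume "\<And>k. k \<in> K \<Longrightarrow> B k \<in> sets ?N"
    then have B: "\<And>k. k \<in> K \<Longrightarrow> B k \<in> sets borel" by simp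
    then have Bm: "Pi\<^sub>E K B \<in> sets (\<Pi>\<^sub>M k\<in>K. borel)" using K by (intro sets_PiM_I_finite) auto
    have meas: "(\<lambda>\<omega>. \<lambda>k\<in>K. X k \<omega>) \<in> measurable M (\<Pi>\<^sub>M k\<in>K. borel)" by (intro measurable_restrict) simp
    define F where "F = (\<lambda>\<omega>. \<lambda>k\<in>K. X k \<omega>) -` Pi\<^sub>E K B \<inter> space M"
    have F: "F \<in> events" unfolding F_def by (rule measurable_sets[OF meas Bm])
    have "complex_of_real (prob F) = complex_of_real (expectation (indicator F))"
      using F by simp
    also have "\<dots> = (CLINT \<omega>|M. complex_of_real (indicator F \<omega>))"
      by (rule integral_complex_of_real[symmetric])
    also have "\<dots> = (CLINT \<omega>|M. (\<Prod>k\<in>K. indicator (B k) (X k \<omega>)))"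
      using K by (intro Bochner_Integration.integral_cong refl)
        (auto simp: F_def indicator_def PiE_iff prod_eq_1_iff if_distrib prod.neutral)
    also have "\<dots> = complex_of_real (\<Prod>k\<in>K. measure ?N (B k))"
      using key[of B "\<lambda>_. 0"] B by simp
    finally have "prob F = (\<Prod>k\<in>K. measure ?N (B k))" by (simp only: of_real_eq_iff)
    then have "emeasure M F = (\<Prod>k\<in>K. emeasure ?N (B k))"
      by (simp add: emeasure_eq_measure prod_ennreal finite_measure.emeasure_eq_measure prob_space.finite_measure
        real_distribution.axioms(1) N)
    then show "emeasure (distr M (\<Pi>\<^sub>M k\<in>K. borel) (\<lambda>\<omega>. \<lambda>k\<in>K. X k \<omega>)) (Pi\<^sub>E K B) = (\<Prod>k\<in>K. emeasure ?N (B k))"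
      by (simp add: emeasure_distr[OF meas Bm] F_def)
  qed
qed

section \<open>Rotations and least singular values of Gaussian matrices\<close>

lemma sum_frob_inner:
  assumes "M \<in> carrier_mat k m"
  shows "(\<Sum>x\<in>{..<k} \<times> {..<m}. M $$ x * M' $$ x) = frob_inner M M'"
  unfolding frob_inner_carrier[OF assms] by (simp add: sum.cartesian_product case_prod_beta')

lemma (in prob_space) char_std_normal_variable:
  assumes "distributed M lborel X std_normal_density"
  shows "(CLINT \<omega>|M. iexp (u * X \<omega>)) = complex_of_real (exp (- u\<^sup>2 / 2))"
proof -
  have "(CLINT \<omega>|M. iexp (u * X \<omega>)) = (CLINT x|distr M lborel X. iexp (u * x))"
    by (rule integral_distr[symmetric]) (use distributed_measurable[OF assms] in simp_all)
  also have "distr M lborel X = std_normal_distribution"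
    by (rule distributed_distr_eq_density[OF assms])
  also have "(CLINT x|std_normal_distribution. iexp (u * x)) = complex_of_real (exp (- u\<^sup>2 / 2))"
    using char_std_normal_distribution unfolding char_def by meson
  finally show ?thesis .
qed

text \<open>The characteristic function of the entries of \<open>\<Omega>\<close> at a matrix \<open>U\<close> depends on \<open>\<parallel>U\<parallel>\<close> only; at \<open>T\<close>, the entries of
  \<open>V\<^sup>T \<Omega>\<close> have the value of those of \<open>\<Omega>\<close> at \<open>V T\<close>, and \<open>\<parallel>V T\<parallel> = \<parallel>T\<parallel>\<close>.\<close>

lemma std_gaussian_matrix_rotated_law:
  assumes P: "prob_space P" and G: "std_gaussian_matrix P r m \<Omega>"
    and V: "V \<in> carrier_mat r k" "V\<^sup>T * V = 1\<^sub>m k"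
  defines "K \<equiv> {..<k} \<times> {..<m}"
  shows "distr P (\<Pi>\<^sub>M x\<in>K. borel) (\<lambda>\<omega>. \<lambda>x\<in>K. (V\<^sup>T * \<Omega> \<omega>) $$ x) = (\<Pi>\<^sub>M x\<in>K. std_normal_distribution)"
    and "\<And>x. x \<in> K \<Longrightarrow> (\<lambda>\<omega>. (V\<^sup>T * \<Omega> \<omega>) $$ x) \<in> borel_measurable P"
proof -
  interpret prob_space P by (rule P)
  have \<Omega>: "\<Omega> \<omega> \<in> carrier_mat r m" if "\<omega> \<in> space P" for \<omega>
    using G that by (simp add: std_gaussian_matrix_def random_matrix_def)
  have entry[measurable]: "(\<lambda>\<omega>. \<Omega> \<omega> $$ (i, j)) \<in> borel_measurable P" if "i < r" "j < m" for i j
    using G that by (simp add: std_gaussian_matrix_def random_matrix_def)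
  have Vt: "V\<^sup>T \<in> carrier_mat k r" using V(1) by simp
  show meas: "(\<lambda>\<omega>. (V\<^sup>T * \<Omega> \<omega>) $$ x) \<in> borel_measurable P" if xK: "x \<in> K" for x
  proof -
    obtain i j where x: "x = (i, j)" "i < k" "j < m" using xK by (auto simp: K_def)
    have "(\<lambda>\<omega>. \<Sum>l<r. V\<^sup>T $$ (i, l) * \<Omega> \<omega> $$ (l, j)) \<in> borel_measurable P"
      using x by measurable
    then show ?thesis
      unfolding x(1) by (subst measurable_cong[OF mult_mat_entry[OF Vt \<Omega> x(2,3)]]) auto
  qed
  show "distr P (\<Pi>\<^sub>M x\<in>K. borel) (\<lambda>\<omega>. \<lambda>x\<in>K. (V\<^sup>T * \<Omega> \<omega>) $$ x) = (\<Pi>\<^sub>M x\<in>K. std_normal_distribution)"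
  proof (rule joint_std_normal_if_char[OF _ meas])
    show "finite K" by (simp add: K_def)
    fix t :: "nat \<times> nat \<Rightarrow> real"
    define T where "T = Matrix.mat k m t"
    define U where "U = V * T"
    let ?L = "{..<r} \<times> {..<m}"
    have T: "T \<in> carrier_mat k m" by (simp add: T_def)
    have U: "U \<in> carrier_mat r m" using V(1) T by (simp add: U_def)
    have tK: "T $$ x = t x" if "x \<in> K" for x using that by (auto simp: T_def K_def)
    have "(\<Sum>x\<in>K. t x * (V\<^sup>T * \<Omega> \<omega>) $$ x) = (\<Sum>y\<in>?L. U $$ y * \<Omega> \<omega> $$ y)" if "\<omega> \<in> space P" for \<omega>
    proof -
      have "(\<Sum>x\<in>K. t x * (V\<^sup>T * \<Omega> \<omega>) $$ x) = frob_inner T (V\<^sup>T * \<Omega> \<omega>)"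
        unfolding sum_frob_inner[OF T, symmetric] K_def[symmetric] by (intro sum.cong refl) (simp add: tK)
      also have "\<dots> = frob_inner U (\<Omega> \<omega>)"
        unfolding U_def by (rule frob_inner_adjoint[symmetric, OF V(1) T \<Omega>[OF that]])
      finally show ?thesis unfolding sum_frob_inner[OF U] .
    qed
    then have "(CLINT \<omega>|P. iexp (\<Sum>x\<in>K. t x * (V\<^sup>T * \<Omega> \<omega>) $$ x))
        = (CLINT \<omega>|P. iexp (\<Sum>y\<in>?L. U $$ y * \<Omega> \<omega> $$ y))"
      by (intro Bochner_Integration.integral_cong refl) simp
    also have "\<dots> = (CLINT \<omega>|P. \<Prod>y\<in>?L. iexp (U $$ y * \<Omega> \<omega> $$ y))"
      by (intro Bochner_Integration.integral_cong refl) (simp add: sum_distrib_left exp_sum)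
    also have "\<dots> = (\<Prod>y\<in>?L. CLINT \<omega>|P. iexp (U $$ y * \<Omega> \<omega> $$ y))"
    proof (rule indep_vars_lebesgue_integral)
      have "indep_vars (\<lambda>_. borel) (\<lambda>y \<omega>. \<Omega> \<omega> $$ y) ?L"
        using G by (simp add: std_gaussian_matrix_def case_prod_beta' cong: prod.case_cong)
      then show "indep_vars (\<lambda>_. borel) (\<lambda>y \<omega>. iexp (U $$ y * \<Omega> \<omega> $$ y)) ?L"
        by (rule indep_vars_compose2) simp
      fix y assume "y \<in> ?L"
      then obtain i j where "y = (i, j)" "i < r" "j < m" by auto
      then show "integrable P (\<lambda>\<omega>. iexp (U $$ y * \<Omega> \<omega> $$ y))"
        by (intro integrable_const_bound[where B = 1]) auto
    qed simp
    also have "\<dots> = (\<Prod>y\<in>?L. complex_of_real (exp (- (U $$ y)\<^sup>2 / 2)))"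
      using G by (intro prod.cong refl char_std_normal_variable) (auto simp: std_gaussian_matrix_def)
    also have "\<dots> = complex_of_real (exp (- (\<Sum>y\<in>?L. (U $$ y)\<^sup>2) / 2))"
      by (simp add: exp_sum[symmetric] sum_negf sum_divide_distrib flip: of_real_prod)
    also have "(\<Sum>y\<in>?L. (U $$ y)\<^sup>2) = (\<Sum>x\<in>K. (t x)\<^sup>2)"
    proof -
      have "(\<Sum>y\<in>?L. (U $$ y)\<^sup>2) = (frob_norm U)\<^sup>2"
        unfolding power2_eq_square[of "U $$ _"] sum_frob_inner[OF U] frob_norm_sq ..
      also have "frob_norm U = frob_norm T"
        unfolding U_def by (rule frob_norm_isometry[OF V T])
      also have "(frob_norm T)\<^sup>2 = (\<Sum>x\<in>K. (t x)\<^sup>2)"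
        unfolding frob_norm_sq sum_frob_inner[OF T, symmetric] K_def[symmetric]
        by (intro sum.cong refl) (simp add: tK power2_eq_square)
      finally show ?thesis .
    qed
    finally show "(CLINT \<omega>|P. iexp (\<Sum>x\<in>K. t x * (V\<^sup>T * \<Omega> \<omega>) $$ x))
        = complex_of_real (exp (- (\<Sum>x\<in>K. (t x)\<^sup>2) / 2))" .
  qed
qed

lemma floor_approximation: "(\<lambda>n. of_int \<lfloor>real n * t\<rfloor> / real n) \<longlonglongrightarrow> t"
proof (rule real_tendsto_sandwich)
  show "\<forall>\<^sub>F n in sequentially. t - 1 / real n \<le> of_int \<lfloor>real n * t\<rfloor> / real n"
    using eventually_gt_at_top[of 0]
  proof eventually_elim
    case (elim n)
    have "real n * t - 1 \<le> of_int \<lfloor>real n * t\<rfloor>" by linarith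
    then have "(real n * t - 1) / real n \<le> of_int \<lfloor>real n * t\<rfloor> / real n" by (rule divide_right_mono) simp
    then show ?case using elim by (simp add: diff_divide_distrib)
  qed
  show "\<forall>\<^sub>F n in sequentially. of_int \<lfloor>real n * t\<rfloor> / real n \<le> t"
    using eventually_gt_at_top[of 0]
  proof eventually_elim
    case (elim n)
    have "of_int \<lfloor>real n * t\<rfloor> / real n \<le> real n * t / real n" by (intro divide_right_mono) auto
    then show ?case using elim by simp
  qed
  have "(\<lambda>n. t - 1 / real n) \<longlonglongrightarrow> t - 0"
    by (intro tendsto_intros lim_1_over_n)
  then show "(\<lambda>n. t - 1 / real n) \<longlonglongrightarrow> t" by simp
qed simp

text \<open>The least singular value is the least amplification \<open>\<parallel>W\<^sup>T x\<parallel> / \<parallel>x\<parallel>\<close>, and by density integer vectors detect whether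
  it is below \<open>c\<close>. This exhibits it as a measurable function of the entries.\<close>

lemma sing_val_less_iff:
  assumes W: "W \<in> carrier_mat k m" and "1 \<le> k" "k \<le> m" and "0 < c"
  shows "sing_val k W < c \<longleftrightarrow> (\<exists>z\<in>{..<k} \<rightarrow>\<^sub>E (UNIV :: int set).
    (\<Sum>j<m. (\<Sum>i<k. W $$ (i, j) * of_int (z i))\<^sup>2) < c\<^sup>2 * (\<Sum>i<k. (of_int (z i))\<^sup>2))"
proof -
  obtain U fs where U: "U \<in> carrier_mat k k" "U\<^sup>T * U = 1\<^sub>m k" "U * U\<^sup>T = 1\<^sub>m k"
    "U\<^sup>T * (W * W\<^sup>T) * U = diag_of_list fs" "length fs = k"
    and sv: "\<forall>i<k. (sing_val k W)\<^sup>2 \<le> fs ! i" "(sing_val k W)\<^sup>2 = fs ! (k - 1)" "0 \<le> sing_val k W"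
    using wide_spectrum[OF W \<open>1 \<le> k\<close> \<open>k \<le> m\<close>] by metis
  have Ut: "U\<^sup>T \<in> carrier_mat k k" using U(1) by simp
  have Wt: "W\<^sup>T \<in> carrier_mat m k" using W by simp
  have z: "(0::nat) < 1" by simp
  define q where "q x = (\<Sum>j<m. (\<Sum>i<k. W $$ (i, j) * x i)\<^sup>2)" for x :: "nat \<Rightarrow> real"
  define n2 where "n2 x = (\<Sum>i<k. (x i)\<^sup>2)" for x :: "nat \<Rightarrow> real"
  define X where "X x = Matrix.mat k 1 (\<lambda>(i, _). x i)" for x :: "nat \<Rightarrow> real"
  have X: "X x \<in> carrier_mat k 1" for x by (simp add: X_def)
  have n2: "n2 x = (frob_norm (X x))\<^sup>2" for x
    unfolding frob_norm_sq_carrier[OF X] by (simp add: X_def n2_def)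
  have q: "q x = (\<Sum>i<k. fs ! i * ((U\<^sup>T * X x) $$ (i, 0))\<^sup>2)" for x
  proof -
    have WX: "W\<^sup>T * X x \<in> carrier_mat m 1" using Wt X by simp
    have "(W\<^sup>T * X x) $$ (j, 0) = (\<Sum>i<k. W $$ (i, j) * x i)" if "j < m" for j
      unfolding mult_mat_entry[OF Wt X that z] using that W by (simp add: X_def)
    then have "q x = (frob_norm (W\<^sup>T * X x))\<^sup>2"
      unfolding frob_norm_sq_carrier[OF WX] by (simp add: q_def del: index_mult_mat(1))
    then show ?thesis
      unfolding wide_quadratic_form[OF W X U(1,3,4)] by (simp del: index_mult_mat(1))
  qed
  have lower: "(sing_val k W)\<^sup>2 * n2 x \<le> q x" for x
  proof -
    have UX: "U\<^sup>T * X x \<in> carrier_mat k 1" using Ut X by simp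
    have "n2 x = (frob_norm (U\<^sup>T * X x))\<^sup>2"
      unfolding n2 by (subst frob_norm_isometry[OF Ut _ X]) (use U(3) in simp_all)
    also have "\<dots> = (\<Sum>i<k. ((U\<^sup>T * X x) $$ (i, 0))\<^sup>2)"
      unfolding frob_norm_sq_carrier[OF UX] by (simp del: index_mult_mat(1))
    finally have n2x: "n2 x = (\<Sum>i<k. ((U\<^sup>T * X x) $$ (i, 0))\<^sup>2)" .
    show ?thesis
      unfolding n2x q sum_distrib_left using sv(1) by (intro sum_mono mult_right_mono) auto
  qed
  show ?thesis
  proof
    assume less: "sing_val k W < c"
    define x where "x i = U $$ (i, k - 1)" for i
    have k1: "k - 1 < k" using \<open>1 \<le> k\<close> by simp
    have col: "(U\<^sup>T * X x) $$ (i, 0) = (if i = k - 1 then 1 else 0)" if "i < k" for i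
    proof -
      have "(U\<^sup>T * X x) $$ (i, 0) = (U\<^sup>T * U) $$ (i, k - 1)"
        unfolding mult_mat_entry[OF Ut X that z] mult_mat_entry[OF Ut U(1) that k1]
        by (simp add: X_def x_def)
      then show ?thesis unfolding U(2) using that k1 by simp
    qed
    have "q x = (\<Sum>i<k. if i = k - 1 then fs ! i else 0)"
      unfolding q by (intro sum.cong refl) (simp add: col del: index_mult_mat(1))
    also have "\<dots> = (sing_val k W)\<^sup>2" using k1 sv(2) by simp
    finally have "q x = (sing_val k W)\<^sup>2" .
    moreover have "n2 x = 1"
    proof -
      have "(U\<^sup>T * U) $$ (k - 1, k - 1) = n2 x"
        unfolding mult_mat_entry[OF Ut U(1) k1 k1] n2_def using k1 U(1) by (simp add: x_def power2_eq_square)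
      then show ?thesis unfolding U(2) using k1 by simp
    qed
    moreover have "(sing_val k W)\<^sup>2 < c\<^sup>2" using less sv(3) by (intro power_strict_mono) auto
    ultimately have neg: "q x - c\<^sup>2 * n2 x < 0" by simp
    \<comment> \<open>The last column of \<open>U\<close> attains the least singular value. It is approximated by rational vectors, and
      multiplying by the common denominator \<open>n\<close> gives \<open>z\<close>.\<close>
    let ?y = "\<lambda>n i. of_int \<lfloor>real n * x i\<rfloor> / real n"
    have "(\<lambda>n. q (?y n) - c\<^sup>2 * n2 (?y n)) \<longlonglongrightarrow> q x - c\<^sup>2 * n2 x"
      unfolding q_def n2_def by (intro tendsto_intros floor_approximation)
    from order_tendstoD(2)[OF this neg] eventually_gt_at_top[of 0]
    have "\<forall>\<^sub>F n in sequentially. q (?y n) - c\<^sup>2 * n2 (?y n) < 0 \<and> 0 < n"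
      by eventually_elim simp
    then obtain n where n: "q (?y n) < c\<^sup>2 * n2 (?y n)" "0 < n"
      by (auto dest!: eventually_happens)
    define z where "z = (\<lambda>i\<in>{..<k}. \<lfloor>real n * x i\<rfloor>)"
    let ?z = "\<lambda>i. real_of_int (z i)"
    have "q (?y n) = q ?z / (real n)\<^sup>2"
      unfolding q_def by (simp add: z_def sum_divide_distrib power_divide flip: sum_divide_distrib)
    moreover have "n2 (?y n) = n2 ?z / (real n)\<^sup>2"
      unfolding n2_def by (simp add: z_def power_divide flip: sum_divide_distrib)
    ultimately have "q ?z < c\<^sup>2 * n2 ?z"
      using n by (simp add: divide_less_cancel)
    moreover have "z \<in> {..<k} \<rightarrow>\<^sub>E UNIV" by (simp add: z_def)
    ultimately show "\<exists>z\<in>{..<k} \<rightarrow>\<^sub>E (UNIV :: int set).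
        (\<Sum>j<m. (\<Sum>i<k. W $$ (i, j) * of_int (z i))\<^sup>2) < c\<^sup>2 * (\<Sum>i<k. (of_int (z i))\<^sup>2)"
      unfolding q_def n2_def by blast
  next
    assume "\<exists>z\<in>{..<k} \<rightarrow>\<^sub>E (UNIV :: int set).
        (\<Sum>j<m. (\<Sum>i<k. W $$ (i, j) * of_int (z i))\<^sup>2) < c\<^sup>2 * (\<Sum>i<k. (of_int (z i))\<^sup>2)"
    then obtain z :: "nat \<Rightarrow> int" where "q (\<lambda>i. of_int (z i)) < c\<^sup>2 * n2 (\<lambda>i. of_int (z i))"
      unfolding q_def n2_def by blast
    then have "(sing_val k W)\<^sup>2 * n2 (\<lambda>i. of_int (z i)) < c\<^sup>2 * n2 (\<lambda>i. of_int (z i))"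
      using lower by (rule le_less_trans[rotated])
    moreover have "0 \<le> n2 (\<lambda>i. of_int (z i))" by (simp add: n2_def sum_nonneg)
    ultimately have "(sing_val k W)\<^sup>2 < c\<^sup>2" by (meson mult_right_mono not_less)
    then show "sing_val k W < c" using \<open>0 < c\<close> by (simp add: power2_less_imp_less)
  qed
qed

lemma sing_val_measurable:
  assumes "1 \<le> k" "k \<le> m"
  shows "(\<lambda>f. sing_val k (Matrix.mat k m f)) \<in> borel_measurable (\<Pi>\<^sub>M x\<in>{..<k} \<times> {..<m}. borel)"
  unfolding borel_measurable_iff_less
proof
  fix c :: real
  let ?M = "\<Pi>\<^sub>M x\<in>{..<k} \<times> {..<m}. (borel :: real measure)"
  show "{f \<in> space ?M. sing_val k (Matrix.mat k m f) < c} \<in> sets ?M"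
  proof (cases "0 < c")
    case True
    have "{f \<in> space ?M. sing_val k (Matrix.mat k m f) < c}
      = (\<Union>z\<in>{..<k} \<rightarrow>\<^sub>E (UNIV :: int set). {f \<in> space ?M.
          (\<Sum>j<m. (\<Sum>i<k. f (i, j) * of_int (z i))\<^sup>2) < c\<^sup>2 * (\<Sum>i<k. (of_int (z i))\<^sup>2)})"
      using assms True by (auto simp: sing_val_less_iff[OF mat_carrier])
    also have "\<dots> \<in> sets ?M"
    proof (rule sets.countable_UN'')
      show "countable ({..<k} \<rightarrow>\<^sub>E (UNIV :: int set))" by (intro countable_PiE) auto
      fix z :: "nat \<Rightarrow> int"
      have "(\<lambda>f. \<Sum>j<m. (\<Sum>i<k. f (i, j) * of_int (z i))\<^sup>2) \<in> borel_measurable ?M"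
        by (intro borel_measurable_sum borel_measurable_power borel_measurable_times measurable_component_singleton) auto
      then show "{f \<in> space ?M. (\<Sum>j<m. (\<Sum>i<k. f (i, j) * of_int (z i))\<^sup>2) < c\<^sup>2 * (\<Sum>i<k. (of_int (z i))\<^sup>2)} \<in> sets ?M"
        by measurable
    qed
    finally show ?thesis .
  next
    case False
    have "0 \<le> sing_val k (Matrix.mat k m f)" for f
      by (rule wide_spectrum[OF mat_carrier assms])
    then have empty: "{f \<in> space ?M. sing_val k (Matrix.mat k m f) < c} = {}"
      using False by (auto simp: not_less intro: order_trans)
    show ?thesis unfolding empty by (rule sets.empty_sets)
  qed
qed

text \<open>Both sides are the probability of one Borel set of matrices under the same law, the one of independent
  standard normal entries: for \<open>G\<close>, rotate by the identity matrix.\<close>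

lemma std_gaussian_matrix_sing_val_law:
  assumes P: "prob_space P" "std_gaussian_matrix P r m \<Omega>" and V: "V \<in> carrier_mat r k" "V\<^sup>T * V = 1\<^sub>m k"
    and P': "prob_space P'" "std_gaussian_matrix P' k m G" and k: "1 \<le> k" "k \<le> m"
  shows "{\<omega> \<in> space P. sing_val k (V\<^sup>T * \<Omega> \<omega>) \<le> c} \<in> sets P"
    and "measure P {\<omega> \<in> space P. sing_val k (V\<^sup>T * \<Omega> \<omega>) \<le> c}
      = measure P' {v \<in> space P'. sing_val k (G v) \<le> c}"
proof -
  let ?K = "{..<k} \<times> {..<m}"
  let ?B = "\<Pi>\<^sub>M x\<in>?K. (borel :: real measure)"
  let ?N = "\<Pi>\<^sub>M x\<in>?K. std_normal_distribution"
  define S where "S = {f \<in> space ?B. sing_val k (Matrix.mat k m f) \<le> c}"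
  have S: "S \<in> sets ?B" unfolding S_def using sing_val_measurable[OF k] by measurable
  have main: "{\<omega> \<in> space Q. sing_val k (U\<^sup>T * \<Psi> \<omega>) \<le> c} \<in> sets Q \<and>
     measure Q {\<omega> \<in> space Q. sing_val k (U\<^sup>T * \<Psi> \<omega>) \<le> c} = measure ?N S"
    if Q: "prob_space Q" "std_gaussian_matrix Q s m \<Psi>" and U: "U \<in> carrier_mat s k" "U\<^sup>T * U = 1\<^sub>m k"
    for Q :: "'c measure" and s \<Psi> U
  proof -
    define F where "F = (\<lambda>\<omega>. \<lambda>x\<in>?K. (U\<^sup>T * \<Psi> \<omega>) $$ x)"
    have law: "distr Q ?B F = ?N" unfolding F_def by (rule std_gaussian_matrix_rotated_law(1)[OF Q U])
    have F: "F \<in> measurable Q ?B"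
      unfolding F_def by (intro measurable_restrict std_gaussian_matrix_rotated_law(2)[OF Q U])
    have "Matrix.mat k m (F \<omega>) = U\<^sup>T * \<Psi> \<omega>" if "\<omega> \<in> space Q" for \<omega>
    proof -
      have "\<Psi> \<omega> \<in> carrier_mat s m" using Q(2) that by (simp add: std_gaussian_matrix_def random_matrix_def)
      then show ?thesis using U(1) by (intro eq_matI) (auto simp: F_def)
    qed
    then have eq: "{\<omega> \<in> space Q. sing_val k (U\<^sup>T * \<Psi> \<omega>) \<le> c} = F -` S \<inter> space Q"
      using measurable_space[OF F] by (auto simp: S_def)
    show ?thesis
      unfolding eq law[symmetric] using measurable_sets[OF F S] measure_distr[OF F S] by simp
  qed
  show "{\<omega> \<in> space P. sing_val k (V\<^sup>T * \<Omega> \<omega>) \<le> c} \<in> sets P"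
    using main[OF P V] by simp
  have "(1\<^sub>m k)\<^sup>T * G v = G v" if "v \<in> space P'" for v
  proof -
    have "G v \<in> carrier_mat k m"
      using P'(2) that by (simp add: std_gaussian_matrix_def random_matrix_def)
    then show ?thesis by simp
  qed
  then have "{v \<in> space P'. sing_val k ((1\<^sub>m k)\<^sup>T * G v) \<le> c} = {v \<in> space P'. sing_val k (G v) \<le> c}"
    by auto
  then show "measure P {\<omega> \<in> space P. sing_val k (V\<^sup>T * \<Omega> \<omega>) \<le> c}
      = measure P' {v \<in> space P'. sing_val k (G v) \<le> c}"
    using main[OF P V] main[OF P' one_carrier_mat] by simp
qed

section \<open>Spectral norm of Gaussian matrices\<close>

text \<open>Divided by \<open>3 * sqrt m\<close>, these are the points of a cubic lattice in the unit ball of dimension \<open>m\<close>. The mesh is chosen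
  such that rounding the coordinates moves a point by at most \<open>1 / 3\<close>.\<close>

definition lattice_ball :: "nat \<Rightarrow> (nat \<Rightarrow> int) set" where
  "lattice_ball m = {z \<in> {..<m} \<rightarrow>\<^sub>E UNIV. (\<Sum>i<m. (z i)\<^sup>2) \<le> 9 * int m}"

text \<open>Cauchy--Schwarz turns the Euclidean bound into a bound on the sum of the absolute values, which is additive over
  coordinates and therefore suits counting with product weights.\<close>

lemma lattice_ball_l1:
  assumes "z \<in> lattice_ball m"
  shows "(\<Sum>i<m. nat \<bar>z i\<bar>) \<le> 3 * m"
proof -
  have "(\<Sum>i<m. \<bar>real_of_int (z i)\<bar>)\<^sup>2 \<le> (\<Sum>i<m. \<bar>real_of_int (z i)\<bar>\<^sup>2) * card {..<m}"
    by (rule sum_squared_le_sum_of_squares) 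
  also have "(\<Sum>i<m. \<bar>real_of_int (z i)\<bar>\<^sup>2) = real_of_int (\<Sum>i<m. (z i)\<^sup>2)" by simp
  also have "\<dots> * card {..<m} \<le> real_of_int (9 * int m) * real m"
    using assms by (intro mult_mono) (auto simp: lattice_ball_def simp del: of_int_sum)
  also have "\<dots> = (3 * real m)\<^sup>2" by (simp add: power2_eq_square)
  finally have "(\<Sum>i<m. \<bar>real_of_int (z i)\<bar>) \<le> 3 * real m" by (rule power2_le_imp_le) simp
  also have "(\<Sum>i<m. \<bar>real_of_int (z i)\<bar>) = real (\<Sum>i<m. nat \<bar>z i\<bar>)" by simp
  finally show ?thesis by linarith
qed

lemma sum_half_powers: "(\<Sum>j = - int M..int M. (1 / 2 :: real) ^ nat \<bar>j\<bar>) = 3 - 2 * (1 / 2) ^ M"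
proof (induction M)
  case (Suc M)
  have "{- int (Suc M)..int (Suc M)} = insert (int (Suc M)) (insert (- int (Suc M)) {- int M..int M})" by auto
  then show ?case using Suc by (simp add: nat_add_distrib)
qed simp

text \<open>Under the product of the weights \<open>2\<^sup>-\<^sup>|\<^sup>j\<^sup>|\<close>, of total mass at most \<open>3\<^sup>m\<close>, every point of the lattice ball has
  weight at least \<open>8\<^sup>-\<^sup>m\<close> by \<open>lattice_ball_l1\<close>.\<close>

lemma lattice_ball_finite_card: "finite (lattice_ball m)" "real (card (lattice_ball m)) \<le> 24 ^ m"
proof -
  let ?box = "{..<m} \<rightarrow>\<^sub>E {- int (3 * m)..int (3 * m)}"
  have sub: "lattice_ball m \<subseteq> ?box"
  proof
    fix z assume z: "z \<in> lattice_ball m"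
    have "z i \<in> {- int (3 * m)..int (3 * m)}" if "i < m" for i
    proof -
      have "nat \<bar>z i\<bar> \<le> (\<Sum>i<m. nat \<bar>z i\<bar>)" using that by (intro member_le_sum) auto
      then have "\<bar>z i\<bar> \<le> int (3 * m)" using lattice_ball_l1[OF z] by linarith
      then show ?thesis unfolding atLeastAtMost_iff abs_le_iff by linarith
    qed
    then show "z \<in> ?box" using z by (simp add: lattice_ball_def PiE_iff)
  qed
  have fin: "finite ?box" by (intro finite_PiE) auto
  show "finite (lattice_ball m)" by (rule finite_subset[OF sub fin])
  define w where "w z = (\<Prod>i<m. (1 / 2 :: real) ^ nat \<bar>z i\<bar>)" for z :: "nat \<Rightarrow> int"
  have w0: "0 \<le> w z" for z by (simp add: w_def prod_nonneg)
  have "real (card (lattice_ball m)) = (\<Sum>z\<in>lattice_ball m. 1)" by simp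
  also have "\<dots> \<le> (\<Sum>z\<in>lattice_ball m. 8 ^ m * w z)"
  proof (rule sum_mono)
    fix z assume z: "z \<in> lattice_ball m"
    have "1 = (8 :: real) ^ m * (1 / 2) ^ (3 * m)" by (simp add: power_mult power_mult_distrib[symmetric] power3_eq_cube)
    also have "\<dots> \<le> 8 ^ m * (1 / 2) ^ (\<Sum>i<m. nat \<bar>z i\<bar>)"
      by (intro mult_left_mono power_decreasing lattice_ball_l1[OF z]) auto
    finally show "1 \<le> 8 ^ m * w z" by (simp add: w_def power_sum)
  qed
  also have "\<dots> \<le> (\<Sum>z\<in>?box. 8 ^ m * w z)"
    by (rule sum_mono2[OF fin sub]) (simp add: w0)
  also have "\<dots> = 8 ^ m * (\<Prod>i<m. \<Sum>j = - int (3 * m)..int (3 * m). (1 / 2) ^ nat \<bar>j\<bar>)"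
    unfolding w_def sum_distrib_left[symmetric] by (subst prod_sum_PiE) auto
  also have "\<dots> \<le> 8 ^ m * 3 ^ m"
  proof -
    have "(1 / 2 :: real) ^ (3 * m) \<le> 1" by (rule power_le_one) auto
    then show ?thesis
      unfolding sum_half_powers by (intro mult_left_mono) (auto intro: power_mono)
  qed
  also have "\<dots> = (24 :: real) ^ m" by (simp add: power_mult_distrib[symmetric])
  finally show "real (card (lattice_ball m)) \<le> 24 ^ m" .
qed

definition net_point :: "nat \<Rightarrow> (nat \<Rightarrow> int) \<Rightarrow> nat \<Rightarrow> real" where
  "net_point m z i = of_int (z i) / (3 * sqrt m)"

lemma net_point_norm:
  assumes "z \<in> lattice_ball m"
  shows "(\<Sum>i<m. (net_point m z i)\<^sup>2) \<le> 1"
proof (cases "m = 0")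
  case False
  have "(\<Sum>i<m. (net_point m z i)\<^sup>2) = real_of_int (\<Sum>i<m. (z i)\<^sup>2) / (9 * m)"
    by (simp add: net_point_def power_divide power_mult_distrib sum_divide_distrib)
  also have "\<dots> \<le> real_of_int (9 * int m) / (9 * m)"
    using assms by (intro divide_right_mono) (auto simp: lattice_ball_def simp del: of_int_sum)
  also have "\<dots> = 1" using False by simp
  finally show ?thesis .
qed simp

text \<open>Coordinates are rounded towards zero, so that the rounded point stays in the unit ball.\<close>

lemma net_point_near:
  fixes x :: "nat \<Rightarrow> real"
  assumes x: "(\<Sum>i<m. (x i)\<^sup>2) \<le> 1" and "0 < m"
  obtains z where "z \<in> lattice_ball m" "(\<Sum>i<m. (3 * (x i - net_point m z i))\<^sup>2) \<le> 1"
proof -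
  define c where "c = 3 * sqrt m"
  have c: "c > 0" "c\<^sup>2 = 9 * m" using \<open>0 < m\<close> by (simp_all add: c_def power_mult_distrib)
  define z where "z = (\<lambda>i\<in>{..<m}. if x i \<ge> 0 then \<lfloor>c * x i\<rfloor> else - \<lfloor>- (c * x i)\<rfloor>)"
  have z1: "\<bar>real_of_int (z i)\<bar> \<le> \<bar>c * x i\<bar>" and z2: "\<bar>c * x i - z i\<bar> \<le> 1" if "i < m" for i
  proof -
    have "0 \<le> c * x i \<longleftrightarrow> 0 \<le> x i" using c(1) by (simp add: zero_le_mult_iff)
    then have z: "z i = (if 0 \<le> c * x i then \<lfloor>c * x i\<rfloor> else - \<lfloor>- (c * x i)\<rfloor>)"
      using that by (simp add: z_def)
    show "\<bar>c * x i - z i\<bar> \<le> 1" unfolding z by (auto simp: abs_le_iff) linarith+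
    show "\<bar>real_of_int (z i)\<bar> \<le> \<bar>c * x i\<bar>"
    proof (cases "0 \<le> c * x i")
      case True
      then have "0 \<le> \<lfloor>c * x i\<rfloor>" by simp
      then show ?thesis using True unfolding z by (simp add: abs_of_nonneg)
    next
      case False
      then have "0 \<le> \<lfloor>- (c * x i)\<rfloor>" by simp
      then show ?thesis using False unfolding z by (simp add: abs_of_nonneg abs_of_neg)
    qed
  qed
  have "real_of_int (\<Sum>i<m. (z i)\<^sup>2) = (\<Sum>i<m. \<bar>real_of_int (z i)\<bar>\<^sup>2)" by simp
  also have "\<dots> \<le> (\<Sum>i<m. \<bar>c * x i\<bar>\<^sup>2)"
    by (intro sum_mono power_mono z1) auto
  also have "\<dots> = c\<^sup>2 * (\<Sum>i<m. (x i)\<^sup>2)" by (simp add: power_mult_distrib sum_distrib_left)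
  also have "\<dots> \<le> c\<^sup>2 * 1" using x by (intro mult_left_mono) auto
  also have "\<dots> = real_of_int (9 * int m)" using c(2) by simp
  finally have "z \<in> lattice_ball m" by (simp only: of_int_le_iff lattice_ball_def mem_Collect_eq) (simp add: z_def)
  moreover have "(\<Sum>i<m. (3 * (x i - net_point m z i))\<^sup>2) \<le> (\<Sum>i<m. 1 / m)"
  proof (rule sum_mono)
    fix i assume "i \<in> {..<m}"
    then have i: "i < m" by simp
    have eq: "3 * (x i - net_point m z i) = 3 / c * (c * x i - z i)"
      unfolding net_point_def c_def[symmetric] using c(1) by (simp add: field_simps)
    have "(3 * (x i - net_point m z i))\<^sup>2 = (3 / c)\<^sup>2 * \<bar>c * x i - z i\<bar>\<^sup>2"
      unfolding eq power_mult_distrib power2_abs ..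
    also have "\<dots> \<le> (3 / c)\<^sup>2 * 1\<^sup>2" by (intro mult_left_mono power_mono z2[OF i]) auto
    also have "\<dots> = 1 / m" using c(2) by (simp add: power_divide)
    finally show "(3 * (x i - net_point m z i))\<^sup>2 \<le> 1 / m" .
  qed
  ultimately show thesis using that \<open>0 < m\<close> by simp
qed

text \<open>Let \<open>S\<close> be the supremum of the form over the unit balls. Replacing each argument by a net point costs
  at most \<open>S / 3\<close>, so \<open>S \<le> t + 2 * S / 3\<close>.\<close>

lemma bilinear_bound_from_net:
  fixes W :: "nat \<Rightarrow> nat \<Rightarrow> real"
  assumes "0 < r" "0 < m"
    and net: "\<And>w z. w \<in> lattice_ball r \<Longrightarrow> z \<in> lattice_ball m
      \<Longrightarrow> (\<Sum>i<r. \<Sum>j<m. net_point r w i * W i j * net_point m z j) \<le> t"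
    and y: "(\<Sum>i<r. (y i)\<^sup>2) \<le> 1" and x: "(\<Sum>j<m. (x j)\<^sup>2) \<le> 1"
  shows "(\<Sum>i<r. \<Sum>j<m. y i * W i j * x j) \<le> 3 * t"
proof -
  define B where "B y x = (\<Sum>i<r. \<Sum>j<m. y i * W i j * x j)" for y x :: "nat \<Rightarrow> real"
  define U where "U k = {x :: nat \<Rightarrow> real. (\<Sum>i<k. (x i)\<^sup>2) \<le> 1}" for k :: nat
  define V where "V = (\<lambda>(y, x). B y x) ` (U r \<times> U m)"
  have comp: "\<bar>x i\<bar> \<le> 1" if "x \<in> U k" "i < k" for x i k
  proof -
    have "(x i)\<^sup>2 \<le> (\<Sum>i<k. (x i)\<^sup>2)" using that by (intro member_le_sum) auto
    then have "(x i)\<^sup>2 \<le> 1" using that by (simp add: U_def)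
    then show ?thesis by (simp add: abs_square_le_1)
  qed
  have "B y x \<le> (\<Sum>i<r. \<Sum>j<m. \<bar>W i j\<bar>)" if "y \<in> U r" "x \<in> U m" for y x
    unfolding B_def
  proof (intro sum_mono)
    fix i j assume ij: "i \<in> {..<r}" "j \<in> {..<m}"
    have "y i * W i j * x j \<le> \<bar>y i\<bar> * \<bar>W i j\<bar> * \<bar>x j\<bar>" by (simp add: abs_mult[symmetric])
    also have "\<dots> \<le> 1 * \<bar>W i j\<bar> * 1"
      using comp[OF that(1), of i] comp[OF that(2), of j] ij by (intro mult_mono) auto
    finally show "y i * W i j * x j \<le> \<bar>W i j\<bar>" by simp
  qed
  then have bdd: "bdd_above V" by (auto simp: V_def bdd_above_def)
  define S where "S = Sup V"
  have le: "B y x \<le> S" if "y \<in> U r" "x \<in> U m" for y x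
    unfolding S_def by (rule cSup_upper[OF _ bdd]) (use that in \<open>auto simp: V_def\<close>)
  have "S \<le> t + S / 3 + S / 3"
    unfolding S_def
  proof (rule cSup_least)
    have "(\<lambda>_. 0) \<in> U k" for k by (simp add: U_def)
    then show "V \<noteq> {}" by (auto simp: V_def)
    fix b assume "b \<in> V"
    then obtain y x where b: "b = B y x" and y: "y \<in> U r" and x: "x \<in> U m" by (auto simp: V_def)
    obtain w where w: "w \<in> lattice_ball r" "(\<Sum>i<r. (3 * (y i - net_point r w i))\<^sup>2) \<le> 1"
      using net_point_near[of y r] y \<open>0 < r\<close> by (auto simp: U_def)
    obtain z where z: "z \<in> lattice_ball m" "(\<Sum>i<m. (3 * (x i - net_point m z i))\<^sup>2) \<le> 1"
      using net_point_near[of x m] x \<open>0 < m\<close> by (auto simp: U_def)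
    have "B y x = B (net_point r w) (net_point m z)
        + B (\<lambda>i. 3 * (y i - net_point r w i)) (net_point m z) / 3 + B y (\<lambda>j. 3 * (x j - net_point m z j)) / 3"
      unfolding B_def sum_divide_distrib sum.distrib[symmetric]
      by (intro sum.cong refl) (simp add: field_simps)
    also have "\<dots> \<le> t + S / 3 + S / 3"
      using net[OF w(1) z(1)] le[of "\<lambda>i. 3 * (y i - net_point r w i)" "net_point m z"]
        le[OF y, of "\<lambda>j. 3 * (x j - net_point m z j)"] w z net_point_norm[OF z(1)]
      unfolding B_def[symmetric] by (simp add: U_def)
    finally show "b \<le> t + Sup V / 3 + Sup V / 3" unfolding b S_def .
  qed
  then have "S \<le> 3 * t" by simp
  then show ?thesis using le[of y x] x y by (simp add: U_def B_def)
qed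

text \<open>Applied to the columns of \<open>X\<close> and of \<open>M X\<close>, the bilinear bound gives
  \<open>\<parallel>M X\<parallel>\<^sup>2 \<le> 3 t \<parallel>M X\<parallel> \<parallel>X\<parallel>\<close>.\<close>

lemma op_bounded_from_net:
  assumes M: "M \<in> carrier_mat r m" and "0 < r" "0 < m" "0 \<le> t"
    and net: "\<And>w z. w \<in> lattice_ball r \<Longrightarrow> z \<in> lattice_ball m
      \<Longrightarrow> (\<Sum>i<r. \<Sum>j<m. net_point r w i * M $$ (i, j) * net_point m z j) \<le> t"
  shows "op_bounded M (3 * t)"
  unfolding op_bounded_def
proof (intro allI ballI)
  fix s and X :: "real mat" assume "X \<in> carrier_mat (dim_col M) s"
  then have X: "X \<in> carrier_mat m s" using M by simp
  define Y where "Y = M * X"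
  have Y: "Y \<in> carrier_mat r s" using M X by (simp add: Y_def)
  let ?y = "\<lambda>k. L2_set (\<lambda>i. Y $$ (i, k)) {..<r}"
  let ?x = "\<lambda>k. L2_set (\<lambda>j. X $$ (j, k)) {..<m}"
  have col: "(\<Sum>i<r. (Y $$ (i, k))\<^sup>2) \<le> 3 * t * (?y k * ?x k)" if k: "k < s" for k
  proof -
    have form: "(\<Sum>i<r. (Y $$ (i, k))\<^sup>2) = (\<Sum>i<r. \<Sum>j<m. Y $$ (i, k) * M $$ (i, j) * X $$ (j, k))"
    proof (intro sum.cong refl)
      fix i assume "i \<in> {..<r}"
      then have "Y $$ (i, k) = (\<Sum>j<m. M $$ (i, j) * X $$ (j, k))"
        unfolding Y_def using mult_mat_entry[OF M X _ k] by simp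
      then have "Y $$ (i, k) * Y $$ (i, k) = Y $$ (i, k) * (\<Sum>j<m. M $$ (i, j) * X $$ (j, k))" by simp
      then show "(Y $$ (i, k))\<^sup>2 = (\<Sum>j<m. Y $$ (i, k) * M $$ (i, j) * X $$ (j, k))"
        by (simp add: power2_eq_square sum_distrib_left mult.assoc)
    qed
    have sq: "(?y k)\<^sup>2 = (\<Sum>i<r. (Y $$ (i, k))\<^sup>2)" "(?x k)\<^sup>2 = (\<Sum>j<m. (X $$ (j, k))\<^sup>2)"
      by (simp_all add: L2_set_def sum_nonneg)
    show ?thesis
    proof (cases "?y k = 0 \<or> ?x k = 0")
      case True
      have "(\<Sum>i<r. (Y $$ (i, k))\<^sup>2) = 0"
      proof (cases "?y k = 0")
        case True
        then show ?thesis using sq(1) by simp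
      next
        case False
        then have "?x k = 0" using True by simp
        then have "X $$ (j, k) = 0" if "j < m" for j
          using that by (simp add: L2_set_eq_0_iff)
        then show ?thesis unfolding form by simp
      qed
      then show ?thesis using True by auto
    next
      case False
      then have pos: "0 < ?y k" "0 < ?x k" using L2_set_nonneg by (metis order_le_less)+
      have "(\<Sum>i<r. (Y $$ (i, k) / ?y k)\<^sup>2) \<le> 1" "(\<Sum>j<m. (X $$ (j, k) / ?x k)\<^sup>2) \<le> 1"
        using pos by (simp_all add: power_divide sq[symmetric] flip: sum_divide_distrib)
      from bilinear_bound_from_net[where W = "\<lambda>i j. M $$ (i, j)", OF \<open>0 < r\<close> \<open>0 < m\<close> net this]
      have "(\<Sum>i<r. \<Sum>j<m. Y $$ (i, k) / ?y k * M $$ (i, j) * (X $$ (j, k) / ?x k)) \<le> 3 * t" .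
      then have "(\<Sum>i<r. (Y $$ (i, k))\<^sup>2) / (?y k * ?x k) \<le> 3 * t"
        unfolding form by (simp add: sum_divide_distrib)
      then show ?thesis using pos by (simp add: divide_le_eq)
    qed
  qed
  have norm: "frob_norm Z = L2_set (\<lambda>k. L2_set (\<lambda>i. Z $$ (i, k)) {..<n}) {..<s}" if Z: "Z \<in> carrier_mat n s" for Z n
    unfolding frob_norm_eq_sqrt frob_inner_carrier[OF Z] L2_set_def
    by (subst sum.swap) (simp add: sum_nonneg power2_eq_square[symmetric])
  have "frob_norm Y * frob_norm Y = (\<Sum>k<s. \<Sum>i<r. (Y $$ (i, k))\<^sup>2)"
    unfolding power2_eq_square[symmetric] frob_norm_sq_carrier[OF Y] by (rule sum.swap)
  also have "\<dots> \<le> (\<Sum>k<s. 3 * t * (?y k * ?x k))" by (intro sum_mono col) simp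
  also have "\<dots> = 3 * t * (\<Sum>k<s. \<bar>?y k\<bar> * \<bar>?x k\<bar>)" by (simp add: sum_distrib_left)
  also have "\<dots> \<le> 3 * t * (frob_norm Y * frob_norm X)"
    unfolding norm[OF Y] norm[OF X] using \<open>0 \<le> t\<close> by (intro mult_left_mono L2_set_mult_ineq) auto
  finally have "frob_norm Y * frob_norm Y \<le> frob_norm Y * (3 * t * frob_norm X)" by (simp add: mult_ac)
  moreover have "0 \<le> 3 * t * frob_norm X" using \<open>0 \<le> t\<close> frob_norm_nonneg by simp
  ultimately show "frob_norm (M * X) \<le> 3 * t * frob_norm X"
    unfolding Y_def[symmetric] by (metis frob_norm_nonneg mult_le_cancel_left_pos order_le_less)
qed

lemma (in prob_space) std_normal_exp_moment:
  assumes "distributed M lborel X std_normal_density"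
  shows "(\<integral>\<^sup>+\<omega>. ennreal (exp (s * X \<omega>)) \<partial>M) = ennreal (exp (s\<^sup>2 / 2))"
proof -
  have "(\<integral>\<^sup>+\<omega>. ennreal (exp (s * X \<omega>)) \<partial>M) = (\<integral>\<^sup>+x. ennreal (std_normal_density x) * ennreal (exp (s * x)) \<partial>lborel)"
    by (rule distributed_nn_integral[OF assms, symmetric]) simp
  also have "\<dots> = (\<integral>\<^sup>+x. ennreal (exp (s\<^sup>2 / 2)) * ennreal (normal_density s 1 x) \<partial>lborel)"
  proof (intro nn_integral_cong)
    fix x
    have "- x\<^sup>2 / 2 + s * x = s\<^sup>2 / 2 + - (x - s)\<^sup>2 / 2"
      by (simp add: power2_eq_square field_simps)
    then have "exp (- x\<^sup>2 / 2) * exp (s * x) = exp (s\<^sup>2 / 2) * exp (- (x - s)\<^sup>2 / 2)"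
      unfolding exp_add[symmetric] by simp
    then show "ennreal (std_normal_density x) * ennreal (exp (s * x)) = ennreal (exp (s\<^sup>2 / 2)) * ennreal (normal_density s 1 x)"
      unfolding ennreal_mult'[OF exp_ge_zero, symmetric] ennreal_mult''[OF exp_ge_zero, symmetric]
      by (simp add: normal_density_def mult_ac)
  qed
  also have "\<dots> = ennreal (exp (s\<^sup>2 / 2)) * (\<integral>\<^sup>+x. ennreal (normal_density s 1 x) \<partial>lborel)"
    by (rule nn_integral_cmult) simp
  also have "(\<integral>\<^sup>+x. ennreal (normal_density s 1 x) \<partial>lborel) = 1"
    using prob_space.emeasure_space_1[OF prob_space_normal_density[of 1 s]] by (simp add: emeasure_density)
  finally show ?thesis by simp
qed

text \<open>Chernoff's bound with parameter \<open>t\<close>, which is optimal for a standard normal variable.\<close>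

lemma (in prob_space) gaussian_combination_tail:
  assumes "finite K" and ind: "indep_vars (\<lambda>_. borel) X K"
    and N: "\<And>k. k \<in> K \<Longrightarrow> distributed M lborel (X k) std_normal_density"
    and u: "(\<Sum>k\<in>K. (u k)\<^sup>2) \<le> 1" and t: "0 < t"
  shows "{\<omega> \<in> space M. t \<le> (\<Sum>k\<in>K. u k * X k \<omega>)} \<in> events"
    and "prob {\<omega> \<in> space M. t \<le> (\<Sum>k\<in>K. u k * X k \<omega>)} \<le> exp (- t\<^sup>2 / 2)"
proof -
  have X[measurable]: "X k \<in> borel_measurable M" if "k \<in> K" for k
    using ind that by (simp add: indep_vars_def)
  show E: "{\<omega> \<in> space M. t \<le> (\<Sum>k\<in>K. u k * X k \<omega>)} \<in> events" by measurable
  have "emeasure M {\<omega> \<in> space M. t \<le> (\<Sum>k\<in>K. u k * X k \<omega>)}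
      \<le> ennreal (exp (- t * t)) * (\<integral>\<^sup>+\<omega>. ennreal (exp (t * (\<Sum>k\<in>K. u k * X k \<omega>))) * indicator (space M) \<omega> \<partial>M)"
    by (rule Chernoff_ineq_nn_integral_ge[OF t]) auto
  also have "(\<integral>\<^sup>+\<omega>. ennreal (exp (t * (\<Sum>k\<in>K. u k * X k \<omega>))) * indicator (space M) \<omega> \<partial>M)
      = (\<integral>\<^sup>+\<omega>. (\<Prod>k\<in>K. ennreal (exp (t * u k * X k \<omega>))) \<partial>M)"
    by (intro nn_integral_cong) (simp add: sum_distrib_left exp_sum[OF \<open>finite K\<close>] prod_ennreal mult.assoc)
  also have "\<dots> = (\<Prod>k\<in>K. \<integral>\<^sup>+\<omega>. ennreal (exp (t * u k * X k \<omega>)) \<partial>M)"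
    by (intro indep_vars_nn_integral \<open>finite K\<close> indep_vars_compose2[OF ind]) auto
  also have "\<dots> = (\<Prod>k\<in>K. ennreal (exp ((t * u k)\<^sup>2 / 2)))"
    by (intro prod.cong refl std_normal_exp_moment N)
  also have "\<dots> = ennreal (exp (t\<^sup>2 * (\<Sum>k\<in>K. (u k)\<^sup>2) / 2))"
    by (simp add: prod_ennreal exp_sum[OF \<open>finite K\<close>, symmetric] power_mult_distrib sum_distrib_left sum_divide_distrib)
  also have "ennreal (exp (- t * t)) * \<dots> = ennreal (exp (- t * t + t\<^sup>2 * (\<Sum>k\<in>K. (u k)\<^sup>2) / 2))"
    by (simp only: exp_add ennreal_mult'[OF exp_ge_zero])
  also have "\<dots> \<le> ennreal (exp (- t\<^sup>2 / 2))"
  proof (intro ennreal_leI, unfold exp_le_cancel_iff)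
    have "t\<^sup>2 * (\<Sum>k\<in>K. (u k)\<^sup>2) \<le> t\<^sup>2 * 1" using u by (intro mult_left_mono) auto
    then show "- t * t + t\<^sup>2 * (\<Sum>k\<in>K. (u k)\<^sup>2) / 2 \<le> - t\<^sup>2 / 2" by (simp add: power2_eq_square)
  qed
  finally show "prob {\<omega> \<in> space M. t \<le> (\<Sum>k\<in>K. u k * X k \<omega>)} \<le> exp (- t\<^sup>2 / 2)"
    by (simp add: emeasure_eq_measure)
qed

text \<open>For a pair of net points the bilinear form is a normalized Gaussian combination. There are at most
  \<open>24\<^sup>r 24\<^sup>m \<le> 576\<^sup>r\<close> pairs and \<open>576 \<le> e\<^sup>8\<close>. With \<open>t\<^sup>2 = 4 (a + 4) r\<close>, a pair exceeds \<open>t\<close> with probability at most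
  \<open>exp (- 2 (a + 4) r)\<close>, where the summand 4 makes up for the number of pairs.\<close>

lemma std_gaussian_matrix_op_norm_tail:
  assumes P: "prob_space P" and G: "std_gaussian_matrix P r m \<Omega>" and "0 < m" "m \<le> r" and "0 < a"
  obtains B where "B \<in> sets P" "measure P B \<le> exp (- a * real r)"
    "\<And>\<omega>. \<omega> \<in> space P - B \<Longrightarrow> op_bounded (\<Omega> \<omega>) (6 * sqrt (a + 4) * sqrt (real r))"
proof -
  interpret prob_space P by (rule P)
  have "0 < r" using \<open>0 < m\<close> \<open>m \<le> r\<close> by simp
  let ?K = "{..<r} \<times> {..<m}"
  \<comment> \<open>A third of the asserted bound, because of the factor 3 in \<open>op_bounded_from_net\<close>.\<close>
  define t where "t = 2 * sqrt ((a + 4) * r)"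
  have t: "0 < t" "t\<^sup>2 = 4 * ((a + 4) * r)"
    using \<open>0 < r\<close> \<open>0 < a\<close> by (simp_all add: t_def power_mult_distrib)
  define I where "I = lattice_ball r \<times> lattice_ball m"
  define u where "u wz x = net_point r (fst wz) (fst x) * net_point m (snd wz) (snd x)" for wz x
  define F where "F wz = {\<omega> \<in> space P. t \<le> (\<Sum>x\<in>?K. u wz x * \<Omega> \<omega> $$ x)}" for wz
  have ind: "indep_vars (\<lambda>_. borel) (\<lambda>x \<omega>. \<Omega> \<omega> $$ x) ?K"
    using G by (simp add: std_gaussian_matrix_def case_prod_beta' cong: prod.case_cong)
  have N: "distributed P lborel (\<lambda>\<omega>. \<Omega> \<omega> $$ x) std_normal_density" if "x \<in> ?K" for x
    using G that by (auto simp: std_gaussian_matrix_def)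
  have u: "(\<Sum>x\<in>?K. (u wz x)\<^sup>2) \<le> 1" if "wz \<in> I" for wz
  proof -
    have "(\<Sum>x\<in>?K. (u wz x)\<^sup>2) = (\<Sum>i<r. (net_point r (fst wz) i)\<^sup>2) * (\<Sum>j<m. (net_point m (snd wz) j)\<^sup>2)"
      by (simp add: u_def sum_product sum.cartesian_product power_mult_distrib case_prod_beta')
    also have "\<dots> \<le> 1 * 1"
      using that by (intro mult_mono net_point_norm sum_nonneg) (auto simp: I_def)
    finally show ?thesis by simp
  qed
  have F: "F wz \<in> events" "prob (F wz) \<le> exp (- t\<^sup>2 / 2)" if "wz \<in> I" for wz
    unfolding F_def using gaussian_combination_tail[OF _ ind N u[OF that] t(1)] by auto
  have I: "finite I" "real (card I) \<le> 576 ^ r"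
  proof -
    show "finite I" by (simp add: I_def lattice_ball_finite_card)
    have "real (card I) \<le> 24 ^ r * 24 ^ m"
      unfolding I_def card_cartesian_product of_nat_mult
      by (intro mult_mono lattice_ball_finite_card) auto
    also have "\<dots> \<le> 24 ^ r * (24 :: real) ^ r"
      using \<open>m \<le> r\<close> by (intro mult_left_mono power_increasing) auto
    finally show "real (card I) \<le> 576 ^ r" by (simp add: power_mult_distrib[symmetric])
  qed
  define B where "B = (\<Union>wz\<in>I. F wz)"
  show thesis
  proof (rule that)
    show "B \<in> events" unfolding B_def using F(1) I(1) by auto
    have "prob B \<le> (\<Sum>wz\<in>I. prob (F wz))"
      unfolding B_def by (rule finite_measure_subadditive_finite[OF I(1)]) (use F(1) in auto)
    also have "\<dots> \<le> real (card I) * exp (- t\<^sup>2 / 2)"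
      by (rule sum_bounded_above) (rule F(2))
    also have "\<dots> \<le> 576 ^ r * exp (- t\<^sup>2 / 2)" by (intro mult_right_mono I) auto
    also have "\<dots> \<le> exp 8 ^ r * exp (- t\<^sup>2 / 2)"
    proof (intro mult_right_mono power_mono)
      have "(576 :: real) \<le> (1 + 1 / 2) ^ 16" by (simp add: power_divide)
      also have "\<dots> \<le> exp (1 / 2) ^ 16" by (intro power_mono exp_ge_add_one_self) auto
      also have "\<dots> = exp (8 :: real)" by (simp flip: exp_of_nat_mult)
      finally show "(576 :: real) \<le> exp 8" .
    qed auto
    also have "\<dots> = exp (8 * real r - 2 * (a + 4) * real r)"
      unfolding t(2) exp_of_nat_mult[symmetric] exp_add[symmetric] by (simp add: field_simps)
    also have "\<dots> \<le> exp (- a * real r)" using \<open>0 < a\<close> by (simp add: algebra_simps)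
    finally show "prob B \<le> exp (- a * real r)" .
    fix \<omega> assume \<omega>: "\<omega> \<in> space P - B"
    have "op_bounded (\<Omega> \<omega>) (3 * t)"
    proof (rule op_bounded_from_net[OF _ \<open>0 < r\<close> \<open>0 < m\<close>])
      show "\<Omega> \<omega> \<in> carrier_mat r m"
        using G \<omega> by (simp add: std_gaussian_matrix_def random_matrix_def)
      fix w z assume wz: "w \<in> lattice_ball r" "z \<in> lattice_ball m"
      then have "\<omega> \<notin> F (w, z)" using \<omega> by (auto simp: B_def I_def)
      then have "(\<Sum>x\<in>?K. u (w, z) x * \<Omega> \<omega> $$ x) \<le> t" using \<omega> by (auto simp: F_def)
      then show "(\<Sum>i<r. \<Sum>j<m. net_point r w i * \<Omega> \<omega> $$ (i, j) * net_point m z j) \<le> t"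
        by (simp add: u_def sum.cartesian_product case_prod_beta' mult_ac)
    qed (use t(1) in simp)
    then show "op_bounded (\<Omega> \<omega>) (6 * sqrt (a + 4) * sqrt (real r))"
      by (simp add: t_def real_sqrt_mult mult.assoc)
  qed
qed

section \<open>Reshapings and unfoldings\<close>

text \<open>The Kronecker product of the identity matrix of order \<open>d\<close> with \<open>M\<close>, that is, the block diagonal matrix with \<open>d\<close>
  copies of \<open>M\<close>.\<close>

definition kron_id :: "nat \<Rightarrow> real mat \<Rightarrow> real mat" where
  "kron_id d M = Matrix.mat (dim_row M * d) (dim_col M * d)
     (\<lambda>(x, y). if x div dim_row M = y div dim_col M then M $$ (x mod dim_row M, y mod dim_col M) else 0)"

lemma kron_id_carrier: "M \<in> carrier_mat p q \<Longrightarrow> kron_id d M \<in> carrier_mat (p * d) (q * d)"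
  by (simp add: kron_id_def)

lemma block_index_less:
  fixes x i p d :: nat
  assumes "x < p" "i < d"
  shows "x + p * i < p * d"
proof -
  have "x + p * i < p + p * i" using assms(1) by simp
  also have "\<dots> = p * Suc i" by simp
  also have "\<dots> \<le> p * d" using assms(2) by (intro mult_le_mono2) simp
  finally show ?thesis .
qed

lemma sum_block_index: "(\<Sum>x<p * d. f x) = (\<Sum>i<d. \<Sum>x<p. f (x + p * i))" for p d :: nat and f :: "nat \<Rightarrow> real"
proof -
  have "(\<Sum>i<d. \<Sum>x<p. f (x + p * i)) = (\<Sum>i<d. sum f {i * p..<i * p + p})"
  proof (rule sum.cong[OF refl])
    fix i
    show "(\<Sum>x<p. f (x + p * i)) = sum f {i * p..<i * p + p}"
      using sum.shift_bounds_nat_ivl[of f 0 "i * p" p] by (simp add: lessThan_atLeast0 add.commute mult.commute)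
  qed
  also have "\<dots> = (\<Sum>x<p * d. f x)" by (simp add: sum.nat_group mult.commute)
  finally show ?thesis ..
qed

text \<open>Indices are written as \<open>x + p * i\<close>, with the position \<open>x\<close> inside block \<open>i\<close>, as in column-major order.\<close>

lemma kron_id_mult_entry:
  assumes M: "M \<in> carrier_mat p q" and X: "X \<in> carrier_mat (q * d) r"
    and "x < p" "i < d" "y < r"
  shows "(kron_id d M * X) $$ (x + p * i, y) = (\<Sum>j<q. M $$ (x, j) * X $$ (j + q * i, y))"
proof -
  note row = block_index_less[OF \<open>x < p\<close> \<open>i < d\<close>]
  have "(kron_id d M * X) $$ (x + p * i, y)
      = (\<Sum>i'<d. \<Sum>j<q. kron_id d M $$ (x + p * i, j + q * i') * X $$ (j + q * i', y))"
    unfolding mult_mat_entry[OF kron_id_carrier[OF M] X row \<open>y < r\<close>] sum_block_index ..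
  also have "\<dots> = (\<Sum>i'<d. if i' = i then (\<Sum>j<q. M $$ (x, j) * X $$ (j + q * i, y)) else 0)"
  proof (intro sum.cong refl)
    fix i' assume "i' \<in> {..<d}"
    then have "kron_id d M $$ (x + p * i, j + q * i') = (if i' = i then M $$ (x, j) else 0)" if "j < q" for j
      using M row that block_index_less[OF that, of i' d] \<open>x < p\<close> by (auto simp: kron_id_def)
    then show "(\<Sum>j<q. kron_id d M $$ (x + p * i, j + q * i') * X $$ (j + q * i', y))
        = (if i' = i then (\<Sum>j<q. M $$ (x, j) * X $$ (j + q * i, y)) else 0)"
      by simp
  qed
  also have "\<dots> = (\<Sum>j<q. M $$ (x, j) * X $$ (j + q * i, y))" using \<open>i < d\<close> by simp
  finally show ?thesis .
qed

lemma kron_id_transpose: "(kron_id d M)\<^sup>T = kron_id d M\<^sup>T"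
proof (rule eq_matI)
  fix x y assume "x < dim_row (kron_id d M\<^sup>T)" "y < dim_col (kron_id d M\<^sup>T)"
  then have xy: "x < dim_col M * d" "y < dim_row M * d" by (simp_all add: kron_id_def)
  then have "0 < dim_col M" "0 < dim_row M" by (auto intro: Nat.gr0I)
  then show "(kron_id d M)\<^sup>T $$ (x, y) = kron_id d M\<^sup>T $$ (x, y)"
    using xy by (auto simp: kron_id_def)
qed (simp_all add: kron_id_def)

lemma block_index_cases:
  fixes x p d :: nat
  assumes "x < p * d"
  obtains x0 i where "x = x0 + p * i" "x0 < p" "i < d"
proof -
  have "0 < p" using assms by (auto intro: Nat.gr0I)
  then show thesis
    using that[of "x mod p" "x div p"] assms by (simp add: div_less_iff_less_mult mult.commute)
qed

lemma kron_id_isometry: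
  assumes M: "M \<in> carrier_mat p q" "M\<^sup>T * M = 1\<^sub>m q"
  shows "(kron_id d M)\<^sup>T * kron_id d M = 1\<^sub>m (q * d)"
proof (rule eq_matI)
  have Mt: "M\<^sup>T \<in> carrier_mat q p" using M(1) by simp
  fix a b assume "a < dim_row (1\<^sub>m (q * d))" "b < dim_col (1\<^sub>m (q * d))"
  then have ab: "a < q * d" "b < q * d" by auto
  obtain a0 i where a: "a = a0 + q * i" "a0 < q" "i < d" using block_index_cases[OF ab(1)] .
  obtain b0 j where b: "b = b0 + q * j" "b0 < q" "j < d" using block_index_cases[OF ab(2)] .
  have "((kron_id d M)\<^sup>T * kron_id d M) $$ (a, b)
      = (\<Sum>x<p. M\<^sup>T $$ (a0, x) * kron_id d M $$ (x + p * i, b))"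
    unfolding kron_id_transpose a(1)
    by (rule kron_id_mult_entry[OF Mt kron_id_carrier[OF M(1)] a(2,3) ab(2)])
  also have "\<dots> = (\<Sum>x<p. M\<^sup>T $$ (a0, x) * (if i = j then M $$ (x, b0) else 0))"
  proof (intro sum.cong refl arg_cong2[where f = "(*)"])
    fix x assume "x \<in> {..<p}"
    then have x: "x < p" by simp
    show "kron_id d M $$ (x + p * i, b) = (if i = j then M $$ (x, b0) else 0)"
      using M(1) x a b ab block_index_less[OF x a(3)] by (auto simp: kron_id_def)
  qed
  also have "\<dots> = (if i = j then (M\<^sup>T * M) $$ (a0, b0) else 0)"
    unfolding mult_mat_entry[OF Mt M(1) a(2) b(2)] by simp
  also have "\<dots> = 1\<^sub>m (q * d) $$ (a, b)"
  proof -
    have "a div q = i" "a mod q = a0" "b div q = j" "b mod q = b0" using a b by simp_all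
    then have "a = b \<longleftrightarrow> i = j \<and> a0 = b0" using a(1) b(1) by metis
    then show ?thesis unfolding M(2) using a(2) b(2) ab by simp
  qed
  finally show "((kron_id d M)\<^sup>T * kron_id d M) $$ (a, b) = 1\<^sub>m (q * d) $$ (a, b)" .
qed (use M(1) in \<open>simp_all add: kron_id_def\<close>)

lemma reshape_mat_carrier: "reshape_mat p r M \<in> carrier_mat p r"
  by (simp add: reshape_mat_def)

lemma reshape_mat_entry:
  assumes M: "M \<in> carrier_mat p (d * r)" and "x < p" "i < d" "y < r"
  shows "reshape_mat (p * d) r M $$ (x + p * i, y) = M $$ (x, i + d * y)"
proof -
  have pos: "x + p * i + p * d * y = x + p * (i + d * y)" by (simp add: algebra_simps)
  have "(x + p * i + p * d * y) mod p = x" "(x + p * i + p * d * y) div p = i + d * y"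
    unfolding pos using \<open>x < p\<close> by simp_all
  then show ?thesis
    using M block_index_less[OF \<open>x < p\<close> \<open>i < d\<close>] \<open>x < p\<close> \<open>y < r\<close> by (simp add: reshape_mat_def)
qed

lemma reshape_mat_same:
  assumes M: "M \<in> carrier_mat p r"
  shows "reshape_mat p r M = M"
  by (rule eq_matI) (use M in \<open>auto simp: reshape_mat_def\<close>)

lemma frob_norm_reshape:
  assumes M: "M \<in> carrier_mat p (d * r)"
  shows "frob_norm (reshape_mat (p * d) r M) = frob_norm M"
proof -
  have "frob_inner (reshape_mat (p * d) r M) (reshape_mat (p * d) r M)
      = (\<Sum>i<d. \<Sum>x<p. \<Sum>y<r. M $$ (x, i + d * y) * M $$ (x, i + d * y))"
    unfolding frob_inner_carrier[OF reshape_mat_carrier] sum_block_index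
    by (intro sum.cong refl) (simp add: reshape_mat_entry[OF M])
  also have "\<dots> = (\<Sum>x<p. \<Sum>i<d. \<Sum>y<r. M $$ (x, i + d * y) * M $$ (x, i + d * y))"
    by (rule sum.swap)
  also have "\<dots> = (\<Sum>x<p. \<Sum>y<r. \<Sum>i<d. M $$ (x, i + d * y) * M $$ (x, i + d * y))"
    by (intro sum.cong refl sum.swap)
  also have "\<dots> = frob_inner M M"
    unfolding frob_inner_carrier[OF M] sum_block_index ..
  finally show ?thesis by (simp add: frob_norm_eq_sqrt)
qed

lemma reshape_mat_minus:
  assumes M: "M \<in> carrier_mat p (d * r)" "M' \<in> carrier_mat p (d * r)"
  shows "reshape_mat (p * d) r (M - M') = reshape_mat (p * d) r M - reshape_mat (p * d) r M'"
proof (rule eq_matI)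
  fix x y assume "x < dim_row (reshape_mat (p * d) r M - reshape_mat (p * d) r M')"
    "y < dim_col (reshape_mat (p * d) r M - reshape_mat (p * d) r M')"
  then have xy: "x < p * d" "y < r" by (simp_all add: reshape_mat_def)
  obtain x0 i where x: "x = x0 + p * i" "x0 < p" "i < d" using block_index_cases[OF xy(1)] .
  have "i + d * y < d * r" by (rule block_index_less[OF x(3) xy(2)])
  then show "reshape_mat (p * d) r (M - M') $$ (x, y) = (reshape_mat (p * d) r M - reshape_mat (p * d) r M') $$ (x, y)"
    using M x xy reshape_mat_carrier[of "p * d" r M'] 
    by (simp add: reshape_mat_entry[OF minus_carrier_mat[OF M(2)]] reshape_mat_entry[OF M(1)] reshape_mat_entry[OF M(2)])
qed (simp_all add: reshape_mat_def)

text \<open>Moving the fastest column mode of \<open>M\<close> to the rows stacks the slices of \<open>M\<close>, and \<open>L\<close> acts on each slice separately.\<close>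

lemma reshape_mult:
  assumes L: "L \<in> carrier_mat q p" and M: "M \<in> carrier_mat p (d * r)"
  shows "reshape_mat (q * d) r (L * M) = kron_id d L * reshape_mat (p * d) r M"
proof (rule eq_matI)
  fix x y assume "x < dim_row (kron_id d L * reshape_mat (p * d) r M)" "y < dim_col (kron_id d L * reshape_mat (p * d) r M)"
  then have xy: "x < q * d" "y < r" using L by (simp_all add: reshape_mat_def kron_id_def)
  obtain x0 i where x: "x = x0 + q * i" "x0 < q" "i < d" using block_index_cases[OF xy(1)] .
  have y: "i + d * y < d * r" by (rule block_index_less[OF x(3) xy(2)])
  have LM: "L * M \<in> carrier_mat q (d * r)" using L M by simp
  have "reshape_mat (q * d) r (L * M) $$ (x, y) = (\<Sum>j<p. L $$ (x0, j) * M $$ (j, i + d * y))"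
    unfolding x(1) reshape_mat_entry[OF LM x(2,3) xy(2)] by (rule mult_mat_entry[OF L M x(2) y])
  also have "\<dots> = (\<Sum>j<p. L $$ (x0, j) * reshape_mat (p * d) r M $$ (j + p * i, y))"
    by (intro sum.cong refl) (simp add: reshape_mat_entry[OF M _ x(3) xy(2)])
  also have "\<dots> = (kron_id d L * reshape_mat (p * d) r M) $$ (x, y)"
    unfolding x(1) by (rule kron_id_mult_entry[symmetric, OF L reshape_mat_carrier x(2,3) xy(2)])
  finally show "reshape_mat (q * d) r (L * M) $$ (x, y) = (kron_id d L * reshape_mat (p * d) r M) $$ (x, y)" .
qed (use L in \<open>simp_all add: reshape_mat_def kron_id_def\<close>)

lemma prod_split_first:
  fixes I :: "nat \<Rightarrow> nat"
  assumes "Suc n \<le> N"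
  shows "(\<Prod>k = Suc n..N. I k) = I (Suc n) * (\<Prod>k = Suc (Suc n)..N. I k)"
  using assms by (simp add: prod.atLeast_Suc_atMost)

lemma unfolding_mat_carrier: "unfolding_mat I N n A \<in> carrier_mat (\<Prod>k = 1..n. I k) (\<Prod>k = n+1..N. I k)"
  by (simp add: unfolding_mat_def)

text \<open>Adding a multiple of a place value leaves the lower digits of a mixed-radix number unchanged.\<close>

lemma col_major_index_low:
  assumes k: "1 \<le> k" "k \<le> n" and x: "x < (\<Prod>l = 1..n. I l)"
  shows "col_major_index I 1 (x + (\<Prod>l = 1..n. I l) * i) k = col_major_index I 1 x k"
proof -
  let ?q = "\<Prod>l = 1..<k. I l"
  have set: "{1..n} = {1..<k} \<union> insert k {Suc k..n}" using k by auto
  have "(\<Prod>l = 1..n. I l) = ?q * (\<Prod>l\<in>insert k {Suc k..n}. I l)"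
    unfolding set by (rule prod.union_disjoint) auto
  then have split: "(\<Prod>l = 1..n. I l) = ?q * (I k * (\<Prod>l = Suc k..n. I l))" by simp
  have "?q > 0" using x unfolding split by (metis gr0I mult_0 not_less_zero)
  then have "(x + ?q * (I k * ((\<Prod>l = Suc k..n. I l) * i))) div ?q = x div ?q + I k * ((\<Prod>l = Suc k..n. I l) * i)"
    by simp
  then show ?thesis unfolding split col_major_index_def by (simp add: mult.assoc)
qed

lemma col_major_index_top:
  assumes "x < (\<Prod>l = 1..n. I l)" "i < I (Suc n)"
  shows "col_major_index I 1 (x + (\<Prod>l = 1..n. I l) * i) (Suc n) = i"
proof -
  have "{1..<Suc n} = {1..n}" by auto
  moreover have "(\<Prod>l = 1..n. I l) \<noteq> 0" using assms(1) by linarith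
  then have "(x + (\<Prod>l = 1..n. I l) * i) div (\<Prod>l = 1..n. I l) = i" using assms(1) by simp
  ultimately show ?thesis using assms(2) by (simp add: col_major_index_def)
qed

text \<open>Both matrices have the same entries in column-major order. Digit by digit, mode \<open>Suc n\<close> is the lowest
  column digit of the one and the highest row digit of the other.\<close>

lemma unfolding_mat_step:
  assumes "Suc n \<le> N"
  shows "unfolding_mat I N (Suc n) A = reshape_mat (\<Prod>k = 1..Suc n. I k) (\<Prod>k = Suc n+1..N. I k) (unfolding_mat I N n A)"
proof (rule eq_matI)
  let ?p = "\<Prod>k = 1..n. I k" and ?d = "I (Suc n)" and ?r = "\<Prod>k = Suc n+1..N. I k"
  have p: "(\<Prod>k = 1..Suc n. I k) = ?p * ?d" by simp
  have r: "(\<Prod>k = n+1..N. I k) = ?d * ?r" using prod_split_first[OF assms] by simp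
  have U: "unfolding_mat I N n A \<in> carrier_mat ?p (?d * ?r)" using unfolding_mat_carrier[of I N n A] unfolding r .
  fix x y assume "x < dim_row (reshape_mat (\<Prod>k = 1..Suc n. I k) ?r (unfolding_mat I N n A))"
    "y < dim_col (reshape_mat (\<Prod>k = 1..Suc n. I k) ?r (unfolding_mat I N n A))"
  then have xy: "x < ?p * ?d" "y < ?r" unfolding p by (simp_all add: reshape_mat_def)
  obtain x0 i where x: "x = x0 + ?p * i" "x0 < ?p" "i < ?d" using block_index_cases[OF xy(1)] .
  have iy: "i + ?d * y < ?d * ?r" by (rule block_index_less[OF x(3) xy(2)])
  have digit: "(if k \<le> n then col_major_index I 1 x0 k else col_major_index I (n+1) (i + ?d * y) k)
      = (if k \<le> Suc n then col_major_index I 1 x k else col_major_index I (Suc n+1) y k)" if k: "k \<in> {1..N}" for k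
  proof (cases k "Suc n" rule: linorder_cases)
    case less
    then have "col_major_index I 1 x k = col_major_index I 1 x0 k"
      unfolding x(1) using k by (intro col_major_index_low[OF _ _ x(2)]) auto
    then show ?thesis using less by simp
  next
    case equal
    have "col_major_index I 1 x (Suc n) = i" unfolding x(1) by (rule col_major_index_top[OF x(2,3)])
    then show ?thesis using equal x(3) by (simp add: col_major_index_def)
  next
    case greater
    have "{Suc n..<k} = insert (Suc n) {Suc (Suc n)..<k}" using greater by auto
    then have "(\<Prod>l = Suc n..<k. I l) = ?d * (\<Prod>l = Suc (Suc n)..<k. I l)" by simp
    then show ?thesis using greater x(3) by (simp add: col_major_index_def div_mult2_eq)
  qed
  show "unfolding_mat I N (Suc n) A $$ (x, y)
      = reshape_mat (\<Prod>k = 1..Suc n. I k) ?r (unfolding_mat I N n A) $$ (x, y)"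
  proof -
    have "reshape_mat (\<Prod>k = 1..Suc n. I k) ?r (unfolding_mat I N n A) $$ (x, y) = unfolding_mat I N n A $$ (x0, i + ?d * y)"
      unfolding p x(1) by (rule reshape_mat_entry[OF U x(2,3) xy(2)])
    also have "\<dots> = A (\<lambda>k\<in>{1..N}. if k \<le> n then col_major_index I 1 x0 k else col_major_index I (n+1) (i + ?d * y) k)"
      unfolding unfolding_mat_def r using x(2) iy by simp
    also have "\<dots> = A (\<lambda>k\<in>{1..N}. if k \<le> Suc n then col_major_index I 1 x k else col_major_index I (Suc n+1) y k)"
      by (intro arg_cong[where f = A] restrict_ext digit)
    also have "\<dots> = unfolding_mat I N (Suc n) A $$ (x, y)"
      unfolding unfolding_mat_def p using xy by simp
    finally show ?thesis by simp
  qed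
qed (simp_all add: reshape_mat_def unfolding_mat_def)

lemma col_major_index_inj:
  assumes "\<And>k. k \<in> {1..n} \<Longrightarrow> col_major_index I 1 x k = col_major_index I 1 y k"
  shows "x mod (\<Prod>k = 1..n. I k) = y mod (\<Prod>k = 1..n. I k)"
  using assms
proof (induction n)
  case (Suc n)
  have IH: "x mod (\<Prod>k = 1..n. I k) = y mod (\<Prod>k = 1..n. I k)" using Suc by simp
  have "{1..<Suc n} = {1..n}" by auto
  then have "x div (\<Prod>k = 1..n. I k) mod I (Suc n) = y div (\<Prod>k = 1..n. I k) mod I (Suc n)"
    using Suc.prems[of "Suc n"] by (simp add: col_major_index_def)
  then show ?case using IH by (simp add: mod_mult2_eq)
qed simp

text \<open>Consecutive unfoldings are reshapings of each other, and the last one is a single column in which each entry of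
  the tensor occurs once because mixed-radix digits determine the position.\<close>

lemma tensor_frob_norm_unfolding:
  assumes I: "\<forall>k\<in>{1..N}. I k > 0" and "n \<le> N"
  shows "tensor_frob_norm I N A = frob_norm (unfolding_mat I N n A)"
proof -
  have last: "tensor_frob_norm I N A = frob_norm (unfolding_mat I N N A)"
  proof -
    let ?P = "\<Prod>k = 1..N. I k"
    define f where "f x = (\<lambda>k\<in>{1..N}. col_major_index I 1 x k)" for x
    have inj: "inj_on f {..<?P}"
    proof (rule inj_onI)
      fix x y assume xy: "x \<in> {..<?P}" "y \<in> {..<?P}" "f x = f y"
      have "col_major_index I 1 x k = col_major_index I 1 y k" if "k \<in> {1..N}" for k
        using fun_cong[OF xy(3), of k] that by (simp add: f_def)
      from col_major_index_inj[of N I x y, OF this] show "x = y" using xy by simp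
    qed
    have sub: "f ` {..<?P} \<subseteq> multi_indices I {1..N}"
      using I by (auto simp: f_def multi_indices_def col_major_index_def)
    have "card (multi_indices I {1..N}) = ?P" by (simp add: multi_indices_def card_PiE)
    moreover have "finite (multi_indices I {1..N})" by (auto simp: multi_indices_def intro: finite_PiE)
    ultimately have im: "f ` {..<?P} = multi_indices I {1..N}"
      using card_subset_eq[OF _ sub] card_image[OF inj] by simp
    have "(\<Sum>i\<in>multi_indices I {1..N}. (A i)\<^sup>2) = (\<Sum>x<?P. (A (f x))\<^sup>2)"
      unfolding im[symmetric] sum.reindex[OF inj] o_def ..
    also have "\<dots> = (\<Sum>x<?P. \<Sum>y<1. (unfolding_mat I N N A $$ (x, y))\<^sup>2)"
    proof (intro sum.cong refl)
      fix x assume x: "x \<in> {..<?P}"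
      have "f x = (\<lambda>k\<in>{1..N}. if k \<le> N then col_major_index I 1 x k else col_major_index I (N+1) 0 k)"
        unfolding f_def by (intro restrict_ext) simp
      then show "(A (f x))\<^sup>2 = (\<Sum>y<1. (unfolding_mat I N N A $$ (x, y))\<^sup>2)"
        using x by (simp add: unfolding_mat_def)
    qed
    finally show ?thesis
      unfolding tensor_frob_norm_def frob_norm_def by (simp add: unfolding_mat_def)
  qed
  have "frob_norm (unfolding_mat I N n A) = frob_norm (unfolding_mat I N N A)"
    using \<open>n \<le> N\<close>
  proof (induction n rule: inc_induct)
    case (step n)
    have r: "(\<Prod>k = n+1..N. I k) = I (Suc n) * (\<Prod>k = Suc n+1..N. I k)"
      using prod_split_first[of n N I] step by simp
    have "unfolding_mat I N n A \<in> carrier_mat (\<Prod>k = 1..n. I k) (I (Suc n) * (\<Prod>k = Suc n+1..N. I k))"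
      using unfolding_mat_carrier[of I N n A] unfolding r .
    from frob_norm_reshape[OF this] unfolding_mat_step[of n N I A] step
    show ?case by (simp add: mult.commute)
  qed simp
  then show ?thesis using last by simp
qed

section \<open>Tensor train sweeps\<close>

text \<open>The product of the first \<open>n\<close> cores as a matrix, whose row at the column-major position of \<open>(i\<^sub>1, \<dots>, i\<^sub>n)\<close> is the
  product of the corresponding core slices.\<close>

fun left_frame :: "(nat \<Rightarrow> nat) \<Rightarrow> (nat \<Rightarrow> real mat) \<Rightarrow> nat \<Rightarrow> real mat" where
  "left_frame I Q 0 = 1\<^sub>m 1"
| "left_frame I Q (Suc n) = kron_id (I (Suc n)) (left_frame I Q n) * Q (Suc n)"

lemma left_frame_isometry:
  assumes "\<mu> 0 = 1" and Q: "\<forall>k\<in>{1..n}. Q k \<in> carrier_mat (\<mu> (k-1) * I k) (\<mu> k) \<and> (Q k)\<^sup>T * Q k = 1\<^sub>m (\<mu> k)"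
  shows "left_frame I Q n \<in> carrier_mat (\<Prod>k = 1..n. I k) (\<mu> n)
    \<and> (left_frame I Q n)\<^sup>T * left_frame I Q n = 1\<^sub>m (\<mu> n)"
  using Q
proof (induction n)
  case 0
  then show ?case using \<open>\<mu> 0 = 1\<close> by simp
next
  case (Suc n)
  let ?L = "left_frame I Q n" and ?d = "I (Suc n)"
  have L: "?L \<in> carrier_mat (\<Prod>k = 1..n. I k) (\<mu> n)" "transpose_mat ?L * ?L = 1\<^sub>m (\<mu> n)" using Suc by auto
  have Q: "Q (Suc n) \<in> carrier_mat (\<mu> n * ?d) (\<mu> (Suc n))" "(Q (Suc n))\<^sup>T * Q (Suc n) = 1\<^sub>m (\<mu> (Suc n))"
    using bspec[OF Suc.prems, of "Suc n"] by simp_all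
  note K = kron_id_carrier[OF L(1), of ?d] kron_id_isometry[OF L, of ?d]
  have Qt: "(Q (Suc n))\<^sup>T \<in> carrier_mat (\<mu> (Suc n)) (\<mu> n * ?d)" using Q(1) by simp
  have Kt: "(kron_id ?d ?L)\<^sup>T \<in> carrier_mat (\<mu> n * ?d) ((\<Prod>k = 1..n. I k) * ?d)" using K(1) by simp
  have "(kron_id ?d ?L * Q (Suc n))\<^sup>T * (kron_id ?d ?L * Q (Suc n))
      = (Q (Suc n))\<^sup>T * ((kron_id ?d ?L)\<^sup>T * (kron_id ?d ?L * Q (Suc n)))"
    unfolding transpose_mult[OF K(1) Q(1)] by (rule assoc_mult_mat[OF Qt Kt mult_carrier_mat[OF K(1) Q(1)]])
  also have "(kron_id ?d ?L)\<^sup>T * (kron_id ?d ?L * Q (Suc n)) = Q (Suc n)"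
    unfolding assoc_mult_mat[OF Kt K(1) Q(1), symmetric] K(2) using Q(1) by simp
  finally show ?case using mult_carrier_mat[OF K(1) Q(1)] Q(2) by (simp add: mult.commute)
qed

text \<open>The algebraic part of a run: the matrices \<open>As n\<close> and the orthonormal frames \<open>Q n\<close>, apart from how the frames
  were found.\<close>

locale tt_sweep =
  fixes I \<mu> :: "nat \<Rightarrow> nat" and N :: nat and A :: tensor and As Q :: "nat \<Rightarrow> real mat"
  assumes mu0: "\<mu> 0 = 1"
    and first: "As 1 = unfolding_mat I N 1 A"
    and step: "\<And>n. n \<in> {2..N-1} \<Longrightarrow> As n = reshape_mat (\<mu> (n-1) * I n) (\<Prod>k = n+1..N. I k) ((Q (n-1))\<^sup>T * As (n-1))"
    and frames: "\<And>n. n \<in> {1..N-1} \<Longrightarrow> Q n \<in> carrier_mat (\<mu> (n-1) * I n) (\<mu> n) \<and> (Q n)\<^sup>T * Q n = 1\<^sub>m (\<mu> n)"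
begin

abbreviation "U n \<equiv> unfolding_mat I N n A"
abbreviation "P n \<equiv> \<Prod>k = 1..n. I k"
abbreviation "r n \<equiv> \<Prod>k = n+1..N. I k"
abbreviation "L n \<equiv> left_frame I Q n"
abbreviation "K n \<equiv> kron_id (I n) (L (n-1))"

lemma left_frame_props:
  assumes "n \<le> N - 1"
  shows "L n \<in> carrier_mat (P n) (\<mu> n)" "(L n)\<^sup>T * L n = 1\<^sub>m (\<mu> n)"
  using left_frame_isometry[of \<mu> n Q I, OF mu0] frames assms by auto

lemma unfolding_carrier: "U n \<in> carrier_mat (P n) (r n)"
  by (rule unfolding_mat_carrier)

lemma previous_unfolding_carrier:
  assumes "n \<in> {1..N}"
  shows "U (n-1) \<in> carrier_mat (P (n-1)) (I n * r n)"
  using unfolding_carrier[of "n-1"] prod_split_first[of "n-1" N I] assms by simp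

lemma row_count_step:
  assumes "n \<ge> 1"
  shows "P n = P (n-1) * I n"
  using assms by (cases n) simp_all

lemma unfolding_step:
  assumes "n \<in> {1..N}"
  shows "U n = reshape_mat (P (n-1) * I n) (r n) (U (n-1))"
  using unfolding_mat_step[of "n-1" N I A] row_count_step[of n] assms by simp

lemma block_isometry:
  assumes "n \<in> {1..N-1}"
  shows "K n \<in> carrier_mat (P n) (\<mu> (n-1) * I n)" "(K n)\<^sup>T * K n = 1\<^sub>m (\<mu> (n-1) * I n)"
proof -
  have n: "n - 1 \<le> N - 1" by (rule order_trans[OF diff_le_self]) (use assms in simp)
  show "K n \<in> carrier_mat (P n) (\<mu> (n-1) * I n)"
    using kron_id_carrier[OF left_frame_props(1)[OF n], of "I n"] row_count_step[of n] assms by simp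
  show "(K n)\<^sup>T * K n = 1\<^sub>m (\<mu> (n-1) * I n)" by (rule kron_id_isometry[OF left_frame_props[OF n]])
qed

lemma left_frame_step:
  assumes "n \<ge> 1"
  shows "L n = K n * Q n"
  using assms by (cases n) simp_all

text \<open>The matrices of the sweep are compressions of the unfoldings of \<open>A\<close>: reshaping turns the factor \<open>L n\<^sup>T\<close> into
  the isometric block factor \<open>K (n + 1)\<^sup>T\<close>.\<close>

lemma compressed_unfolding:
  assumes "n \<in> {1..N-1}"
  shows "As n = (K n)\<^sup>T * U n"
    and "(Q n)\<^sup>T * As n = (L n)\<^sup>T * U n"
proof -
  have main: "(Q n)\<^sup>T * As n = (L n)\<^sup>T * U n"
    if n: "n \<in> {1..N-1}" and As: "As n = (K n)\<^sup>T * U n" for n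
  proof -
    have Q: "Q n \<in> carrier_mat (\<mu> (n-1) * I n) (\<mu> n)" using frames[OF n] by simp
    have "(L n)\<^sup>T = (Q n)\<^sup>T * (K n)\<^sup>T"
      using left_frame_step[of n] transpose_mult[OF block_isometry(1)[OF n] Q] n by simp
    moreover have "(Q n)\<^sup>T * (K n)\<^sup>T * U n = (Q n)\<^sup>T * ((K n)\<^sup>T * U n)"
      by (rule assoc_mult_mat[OF _ _ unfolding_carrier]) (use Q block_isometry(1)[OF n] in simp_all)
    ultimately show ?thesis using As by simp
  qed
  show As: "As n = (K n)\<^sup>T * U n"
    using assms
  proof (induction n rule: nat_induct)
    case (Suc n)
    have r: "r n = I (Suc n) * r (Suc n)" using prod_split_first[of n N I] Suc.prems by simp
    show ?case
    proof (cases "n = 0")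
      case True
      have "kron_id (I (Suc 0)) (1\<^sub>m 1) = 1\<^sub>m (I (Suc 0))"
        by (rule eq_matI) (auto simp: kron_id_def)
      then show ?thesis using True first unfolding_carrier[of "Suc 0"] by simp
    next
      case False
      then have n: "n \<in> {1..N-1}" and Sn: "Suc n \<in> {2..N-1}" using Suc.prems by auto
      have As: "As n = (K n)\<^sup>T * U n" by (rule Suc.IH[OF n])
      have Un: "U n \<in> carrier_mat (P n) (I (Suc n) * r (Suc n))" using unfolding_carrier[of n] unfolding r .
      have Lt: "(L n)\<^sup>T \<in> carrier_mat (\<mu> n) (P n)" using left_frame_props(1)[of n] n by simp
      have "As (Suc n) = reshape_mat (\<mu> n * I (Suc n)) (r (Suc n)) ((L n)\<^sup>T * U n)"
        using step[OF Sn] main[OF n As] by simp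
      also have "\<dots> = kron_id (I (Suc n)) (L n)\<^sup>T * reshape_mat (P n * I (Suc n)) (r (Suc n)) (U n)"
        by (rule reshape_mult[OF Lt Un])
      also have "\<dots> = (K (Suc n))\<^sup>T * U (Suc n)"
        using unfolding_step[of "Suc n"] Suc.prems by (simp add: kron_id_transpose)
      finally show ?thesis .
    qed
  qed simp
  show "(Q n)\<^sup>T * As n = (L n)\<^sup>T * U n" by (rule main[OF assms As])
qed

lemma As_carrier:
  assumes "n \<in> {1..N-1}"
  shows "As n \<in> carrier_mat (\<mu> (n-1) * I n) (r n)"
  unfolding compressed_unfolding(1)[OF assms] using block_isometry(1)[OF assms] unfolding_carrier[of n] by simp

text \<open>The error in step \<open>n\<close> is the sum of a reshaping of the previous error and the image under the isometry \<open>K n\<close> of the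
  error of the compression by \<open>Q n\<close>.\<close>

lemma compression_error:
  assumes n: "n \<le> N - 1"
  shows "frob_norm (U n - L n * ((L n)\<^sup>T * U n))
    \<le> (\<Sum>k = 1..n. frob_norm (As k - Q k * ((Q k)\<^sup>T * As k)))"
  using n
proof (induction n)
  case 0
  have "U 0 - L 0 * ((L 0)\<^sup>T * U 0) = 0\<^sub>m 1 (r 0)" using unfolding_carrier[of 0] by simp
  then show ?case by (simp add: frob_norm_def)
next
  case (Suc n)
  let ?n = "Suc n" and ?d = "I (Suc n)"
  have n: "n \<le> N - 1" and Sn: "?n \<in> {1..N-1}" "?n \<in> {1..N}" using Suc.prems by auto
  note Ln = left_frame_props[OF n]
  have Lt: "(L n)\<^sup>T \<in> carrier_mat (\<mu> n) (P n)" using Ln(1) by simp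
  have Un: "U n \<in> carrier_mat (P n) (?d * r ?n)" using previous_unfolding_carrier[OF Sn(2)] by simp
  have LU: "(L n)\<^sup>T * U n \<in> carrier_mat (\<mu> n) (?d * r ?n)" using Lt Un by simp
  have LLU: "L n * ((L n)\<^sup>T * U n) \<in> carrier_mat (P n) (?d * r ?n)" using Ln(1) LU by simp
  have K: "K ?n \<in> carrier_mat (P ?n) (\<mu> n * ?d)" "(K ?n)\<^sup>T * K ?n = 1\<^sub>m (\<mu> n * ?d)"
    using block_isometry[OF Sn(1)] by simp_all
  have A: "As ?n \<in> carrier_mat (\<mu> n * ?d) (r ?n)" using As_carrier[OF Sn(1)] by simp
  have Q: "Q ?n \<in> carrier_mat (\<mu> n * ?d) (\<mu> ?n)" using frames[OF Sn(1)] by simp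
  have QA: "(Q ?n)\<^sup>T * As ?n \<in> carrier_mat (\<mu> ?n) (r ?n)" using Q A by simp
  have QQA: "Q ?n * ((Q ?n)\<^sup>T * As ?n) \<in> carrier_mat (\<mu> n * ?d) (r ?n)" using Q QA by simp
  have R: "U ?n = reshape_mat (P n * ?d) (r ?n) (U n)" using unfolding_step[OF Sn(2)] by simp
  have KA: "K ?n * As ?n = reshape_mat (P n * ?d) (r ?n) (L n * ((L n)\<^sup>T * U n))"
  proof -
    have "As ?n = reshape_mat (\<mu> n * ?d) (r ?n) ((L n)\<^sup>T * U n)"
      unfolding compressed_unfolding(1)[OF Sn(1)] R reshape_mult[OF Lt Un] by (simp add: kron_id_transpose)
    then show ?thesis using reshape_mult[OF Ln(1) LU] by simp
  qed
  have KAc: "K ?n * As ?n \<in> carrier_mat (P ?n) (r ?n)" by (rule mult_carrier_mat[OF K(1) A])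
  have E1: "frob_norm (U ?n - K ?n * As ?n) = frob_norm (U n - L n * ((L n)\<^sup>T * U n))"
    unfolding KA R reshape_mat_minus[OF Un LLU, symmetric]
    by (rule frob_norm_reshape[OF minus_carrier_mat[OF LLU]])
  have "L ?n * ((L ?n)\<^sup>T * U ?n) = K ?n * (Q ?n * ((Q ?n)\<^sup>T * As ?n))"
    unfolding compressed_unfolding(2)[OF Sn(1), symmetric] using assoc_mult_mat[OF K(1) Q QA] by simp
  then have split: "U ?n - L ?n * ((L ?n)\<^sup>T * U ?n)
      = (U ?n - K ?n * As ?n) + (K ?n * As ?n - K ?n * (Q ?n * ((Q ?n)\<^sup>T * As ?n)))"
    using unfolding_carrier[of ?n] KAc mult_carrier_mat[OF K(1) QQA] by (intro eq_matI) (simp_all del: index_mult_mat)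
  define D where "D = As ?n - Q ?n * ((Q ?n)\<^sup>T * As ?n)"
  have D: "D \<in> carrier_mat (\<mu> n * ?d) (r ?n)" unfolding D_def by (rule minus_carrier_mat[OF QQA])
  have "K ?n * As ?n - K ?n * (Q ?n * ((Q ?n)\<^sup>T * As ?n)) = K ?n * D"
    unfolding D_def by (rule mult_minus_distrib_mat[OF K(1) A QQA, symmetric])
  then have "frob_norm (U ?n - L ?n * ((L ?n)\<^sup>T * U ?n)) \<le> frob_norm (U ?n - K ?n * As ?n) + frob_norm (K ?n * D)"
    unfolding split using frob_norm_triangle[OF minus_carrier_mat[OF KAc] mult_carrier_mat[OF K(1) D]] by simp
  also have "frob_norm (K ?n * D) = frob_norm D" by (rule frob_norm_isometry[OF K D])
  finally show ?case unfolding E1 D_def using Suc.IH[OF n] by simp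
qed

text \<open>A projection that is good for the unfolding is good for its compression, whatever the earlier frames are:
  \<open>K n\<^sup>T\<close> acts on the left and does not increase the norm. This allows \<open>V\<close> to be chosen before the run.\<close>

lemma compressed_projection_error:
  assumes n: "n \<in> {1..N-1}" and V: "V \<in> carrier_mat (r n) k"
  shows "frob_norm (As n - As n * (V * V\<^sup>T)) \<le> frob_norm (U n - U n * (V * V\<^sup>T))"
proof -
  have VV: "V * V\<^sup>T \<in> carrier_mat (r n) (r n)" using V by simp
  have UV: "U n * (V * V\<^sup>T) \<in> carrier_mat (P n) (r n)" using unfolding_carrier[of n] VV by simp
  note K = block_isometry[OF n]
  have Kt: "(K n)\<^sup>T \<in> carrier_mat (\<mu> (n-1) * I n) (P n)" using K(1) by simp
  have "As n - As n * (V * V\<^sup>T) = (K n)\<^sup>T * (U n - U n * (V * V\<^sup>T))"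
    unfolding compressed_unfolding(1)[OF n] assoc_mult_mat[OF Kt unfolding_carrier VV]
    by (rule mult_minus_distrib_mat[OF Kt unfolding_carrier UV, symmetric])
  then show ?thesis
    using op_boundedD[OF op_bounded_transpose_isometry[OF K] Kt minus_carrier_mat[OF UV, of "U n"]] by simp
qed

end

lemma sum_PiE_insert:
  fixes g :: "('a \<Rightarrow> 'b) \<Rightarrow> real"
  assumes "a \<notin> S"
  shows "(\<Sum>j\<in>PiE (insert a S) B. g j) = (\<Sum>l\<in>B a. \<Sum>j\<in>PiE S B. g (j(a := l)))"
proof -
  have "(\<Sum>j\<in>PiE (insert a S) B. g j) = (\<Sum>x\<in>B a \<times> PiE S B. g ((snd x)(a := fst x)))"
    unfolding PiE_insert_eq using inj_combinator[OF assms, of B]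
    by (simp add: sum.reindex case_prod_beta')
  then show ?thesis by (simp add: sum.cartesian_product case_prod_beta')
qed

text \<open>Summing over the last rank index first turns the sum over all rank multi-indices into the recursion of
  \<open>left_frame\<close>. The function \<open>f\<close> stands for the cores that follow.\<close>

lemma tt_contraction:
  assumes "\<mu> 0 = 1" and Q: "\<forall>k\<in>{1..n}. Q k \<in> carrier_mat (\<mu> (k-1) * I k) (\<mu> k) \<and> (Q k)\<^sup>T * Q k = 1\<^sub>m (\<mu> k)"
    and "1 \<le> n" and "x < (\<Prod>k = 1..n. I k)"
  shows "(\<Sum>j\<in>multi_indices \<mu> {1..n}. Q 1 $$ (col_major_index I 1 x 1, j 1)
      * (\<Prod>k = 2..n. Q k $$ (j (k-1) + \<mu> (k-1) * col_major_index I 1 x k, j k)) * f (j n))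
    = (\<Sum>l<\<mu> n. left_frame I Q n $$ (x, l) * f l)"
  using \<open>1 \<le> n\<close> Q \<open>x < _\<close>
proof (induction n arbitrary: x f rule: nat_induct_at_least)
  case base
  have Q1: "Q 1 \<in> carrier_mat (I 1) (\<mu> 1)" using base \<open>\<mu> 0 = 1\<close> by simp
  have "kron_id (I (Suc 0)) (1\<^sub>m 1) = 1\<^sub>m (I (Suc 0))" by (rule eq_matI) (auto simp: kron_id_def)
  then have L1: "left_frame I Q 1 = Q 1" using Q1 by simp
  have "(\<Sum>j\<in>PiE (insert 1 {}) (\<lambda>k. {..<\<mu> k}). Q 1 $$ (col_major_index I 1 x 1, j 1) * f (j 1))
      = (\<Sum>l<\<mu> 1. Q 1 $$ (x, l) * f l)"
    using base by (subst sum_PiE_insert) (simp_all add: col_major_index_def)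
  then show ?case unfolding L1 multi_indices_def by simp
next
  case (Suc n)
  let ?d = "I (Suc n)" and ?p = "\<Prod>k = 1..n. I k"
  have "x < ?p * ?d" using Suc.prems(2) by (simp add: mult.commute)
  then obtain x0 i where x: "x = x0 + ?p * i" "x0 < ?p" "i < ?d" by (rule block_index_cases)
  have Qn: "\<forall>k\<in>{1..n}. Q k \<in> carrier_mat (\<mu> (k-1) * I k) (\<mu> k) \<and> (Q k)\<^sup>T * Q k = 1\<^sub>m (\<mu> k)"
    using Suc.prems(1) by auto
  have QS: "Q (Suc n) \<in> carrier_mat (\<mu> n * ?d) (\<mu> (Suc n))" using bspec[OF Suc.prems(1), of "Suc n"] by simp
  have L: "left_frame I Q n \<in> carrier_mat ?p (\<mu> n)" using left_frame_isometry[of \<mu> n Q I, OF \<open>\<mu> 0 = 1\<close> Qn] by simp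
  have last: "col_major_index I 1 x (Suc n) = i"
    unfolding x(1) by (rule col_major_index_top[OF x(2,3)])
  have digit: "col_major_index I 1 x k = col_major_index I 1 x0 k" if "1 \<le> k" "k \<le> n" for k
    unfolding x(1) by (rule col_major_index_low[OF that x(2)])
  define t where "t j = Q 1 $$ (col_major_index I 1 x0 1, j 1)
      * (\<Prod>k = 2..n. Q k $$ (j (k-1) + \<mu> (k-1) * col_major_index I 1 x0 k, j k))" for j
  have "(\<Sum>j\<in>multi_indices \<mu> {1..Suc n}. Q 1 $$ (col_major_index I 1 x 1, j 1)
      * (\<Prod>k = 2..Suc n. Q k $$ (j (k-1) + \<mu> (k-1) * col_major_index I 1 x k, j k)) * f (j (Suc n)))
    = (\<Sum>j\<in>multi_indices \<mu> {1..Suc n}. t j * Q (Suc n) $$ (j n + \<mu> n * i, j (Suc n)) * f (j (Suc n)))"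
  proof (rule sum.cong[OF refl], rule arg_cong2[where f = "(*)", OF _ refl])
    fix j
    have "(\<Prod>k = 2..Suc n. Q k $$ (j (k-1) + \<mu> (k-1) * col_major_index I 1 x k, j k))
        = (\<Prod>k = 2..n. Q k $$ (j (k-1) + \<mu> (k-1) * col_major_index I 1 x0 k, j k)) * Q (Suc n) $$ (j n + \<mu> n * i, j (Suc n))"
    proof -
      have "(\<Prod>k = 2..n. Q k $$ (j (k-1) + \<mu> (k-1) * col_major_index I 1 x k, j k))
          = (\<Prod>k = 2..n. Q k $$ (j (k-1) + \<mu> (k-1) * col_major_index I 1 x0 k, j k))"
      proof (rule prod.cong[OF refl])
        fix k assume "k \<in> {2..n}"
        then have k: "1 \<le> k" "k \<le> n" by auto
        show "Q k $$ (j (k-1) + \<mu> (k-1) * col_major_index I 1 x k, j k)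
          = Q k $$ (j (k-1) + \<mu> (k-1) * col_major_index I 1 x0 k, j k)"
          unfolding digit[OF k] ..
      qed
      then show ?thesis using Suc.hyps last by (simp add: prod.nat_ivl_Suc' mult.commute)
    qed
    then show "Q 1 $$ (col_major_index I 1 x 1, j 1)
      * (\<Prod>k = 2..Suc n. Q k $$ (j (k-1) + \<mu> (k-1) * col_major_index I 1 x k, j k))
      = t j * Q (Suc n) $$ (j n + \<mu> n * i, j (Suc n))"
      unfolding t_def digit[OF order_refl Suc.hyps] by simp
  qed
  also have "\<dots> = (\<Sum>j\<in>PiE (insert (Suc n) {1..n}) (\<lambda>k. {..<\<mu> k}). t j * Q (Suc n) $$ (j n + \<mu> n * i, j (Suc n)) * f (j (Suc n)))"
    by (simp add: multi_indices_def atLeastAtMostSuc_conv)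
  also have "\<dots> = (\<Sum>l<\<mu> (Suc n). \<Sum>j\<in>multi_indices \<mu> {1..n}. t (j(Suc n := l)) * Q (Suc n) $$ (j n + \<mu> n * i, l) * f l)"
    by (subst sum_PiE_insert) (simp_all add: multi_indices_def)
  also have "\<dots> = (\<Sum>l<\<mu> (Suc n). (\<Sum>j\<in>multi_indices \<mu> {1..n}. t j * Q (Suc n) $$ (j n + \<mu> n * i, l)) * f l)"
  proof -
    have "t (j(Suc n := l)) = t j" for j l
      unfolding t_def using Suc.hyps by (auto intro!: prod.cong)
    then show ?thesis by (simp add: sum_distrib_right)
  qed
  also have "\<dots> = (\<Sum>l<\<mu> (Suc n). (\<Sum>l'<\<mu> n. left_frame I Q n $$ (x0, l') * Q (Suc n) $$ (l' + \<mu> n * i, l)) * f l)"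
  proof (rule sum.cong[OF refl], rule arg_cong2[where f = "(*)", OF _ refl])
    fix l
    show "(\<Sum>j\<in>multi_indices \<mu> {1..n}. t j * Q (Suc n) $$ (j n + \<mu> n * i, l))
        = (\<Sum>l'<\<mu> n. left_frame I Q n $$ (x0, l') * Q (Suc n) $$ (l' + \<mu> n * i, l))"
      unfolding t_def by (rule Suc.IH[OF Qn x(2), of "\<lambda>l'. Q (Suc n) $$ (l' + \<mu> n * i, l)"])
  qed
  also have "\<dots> = (\<Sum>l<\<mu> (Suc n). left_frame I Q (Suc n) $$ (x, l) * f l)"
  proof (intro sum.cong refl arg_cong2[where f = "(*)"])
    fix l assume "l \<in> {..<\<mu> (Suc n)}"
    then show "(\<Sum>l'<\<mu> n. left_frame I Q n $$ (x0, l') * Q (Suc n) $$ (l' + \<mu> n * i, l)) = left_frame I Q (Suc n) $$ (x, l)"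
      unfolding x(1) left_frame.simps using kron_id_mult_entry[OF L QS x(2,3)] by simp
  qed
  finally show ?case .
qed

context tt_sweep
begin

lemma unfolded_output:
  assumes "N \<ge> 2"
  shows "unfolding_mat I N (N-1) (rand_tt_output I N \<mu> As Q) = L (N-1) * ((L (N-1))\<^sup>T * U (N-1))"
proof -
  define C where "C = (Q (N-1))\<^sup>T * As (N-1)"
  have n: "N - 1 \<in> {1..N-1}" using assms by simp
  have r: "r (N-1) = I N" using assms by simp
  have QN: "Q (N-1) \<in> carrier_mat (\<mu> (N-1-1) * I (N-1)) (\<mu> (N-1))" using frames[OF n] by simp
  have C: "C \<in> carrier_mat (\<mu> (N-1)) (I N)"
    unfolding C_def using As_carrier[OF n] QN unfolding r by simp
  have LC: "L (N-1) \<in> carrier_mat (P (N-1)) (\<mu> (N-1))" by (rule left_frame_props(1)) simp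
  have "unfolding_mat I N (N-1) (rand_tt_output I N \<mu> As Q) = L (N-1) * C"
  proof (rule eq_matI)
    fix x y assume "x < dim_row (L (N-1) * C)" "y < dim_col (L (N-1) * C)"
    then have xy: "x < P (N-1)" "y < I N" using LC C by auto
    define i where "i = (\<lambda>k\<in>{1..N}. if k \<le> N-1 then col_major_index I 1 x k else col_major_index I (N-1+1) y k)"
    have iN: "i N = y" using assms xy by (simp add: i_def col_major_index_def)
    have ik: "i k = col_major_index I 1 x k" if "1 \<le> k" "k \<le> N-1" for k
    proof -
      have "k \<le> N" using that by linarith
      then show ?thesis using that by (simp add: i_def)
    qed
    have "unfolding_mat I N (N-1) (rand_tt_output I N \<mu> As Q) $$ (x, y) = rand_tt_output I N \<mu> As Q i"
      unfolding unfolding_mat_def r i_def using xy by simp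
    also have "\<dots> = (\<Sum>j\<in>multi_indices \<mu> {1..N-1}. Q 1 $$ (col_major_index I 1 x 1, j 1)
      * (\<Prod>k = 2..N-1. Q k $$ (j (k-1) + \<mu> (k-1) * col_major_index I 1 x k, j k)) * C $$ (j (N-1), y))"
      unfolding rand_tt_output_def tt_product_def C_def[symmetric] reshape_mat_same[OF C] reshape_core_def iN
      using assms by (intro sum.cong refl arg_cong2[where f = "(*)"] prod.cong) (simp_all add: ik)
    also have "\<dots> = (\<Sum>l<\<mu> (N-1). L (N-1) $$ (x, l) * C $$ (l, y))"
      by (rule tt_contraction[of \<mu> "N-1" Q I x "\<lambda>l. C $$ (l, y)", OF mu0 _ _ xy(1)]) (use frames assms in auto)
    also have "\<dots> = (L (N-1) * C) $$ (x, y)" by (rule mult_mat_entry[OF LC C xy, symmetric])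
    finally show "unfolding_mat I N (N-1) (rand_tt_output I N \<mu> As Q) $$ (x, y) = (L (N-1) * C) $$ (x, y)" .
  qed (use LC C r in \<open>simp_all add: unfolding_mat_def\<close>)
  then show ?thesis unfolding C_def compressed_unfolding(2)[OF n] .
qed

lemma output_error_eq:
  assumes "N \<ge> 2" and I: "\<forall>k\<in>{1..N}. I k > 0"
  shows "tensor_frob_norm I N (\<lambda>i. A i - rand_tt_output I N \<mu> As Q i)
    = frob_norm (U (N-1) - L (N-1) * ((L (N-1))\<^sup>T * U (N-1)))"
proof -
  have "tensor_frob_norm I N (\<lambda>i. A i - rand_tt_output I N \<mu> As Q i)
      = frob_norm (unfolding_mat I N (N-1) (\<lambda>i. A i - rand_tt_output I N \<mu> As Q i))"
    by (rule tensor_frob_norm_unfolding[OF I]) simp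
  also have "unfolding_mat I N (N-1) (\<lambda>i. A i - rand_tt_output I N \<mu> As Q i)
      = U (N-1) - unfolding_mat I N (N-1) (rand_tt_output I N \<mu> As Q)"
    by (rule eq_matI) (auto simp: unfolding_mat_def)
  finally show ?thesis unfolding unfolded_output[OF \<open>N \<ge> 2\<close>] .
qed

end

section \<open>The probabilistic error bound\<close>

lemma random_matrix_const:
  assumes "M \<in> carrier_mat p r"
  shows "random_matrix P p r (\<lambda>_. M)"
  using assms by (simp add: random_matrix_def)

lemma random_matrix_transpose:
  assumes "random_matrix P p r X"
  shows "random_matrix P r p (\<lambda>\<omega>. (X \<omega>)\<^sup>T)"
proof -
  have X: "X \<omega> \<in> carrier_mat p r" if "\<omega> \<in> space P" for \<omega> using assms that by (simp add: random_matrix_def)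
  have "(\<lambda>\<omega>. (X \<omega>)\<^sup>T $$ (i, j)) \<in> borel_measurable P" if "i < r" "j < p" for i j
  proof -
    have "(X \<omega>)\<^sup>T $$ (i, j) = X \<omega> $$ (j, i)" if "\<omega> \<in> space P" for \<omega>
      using X[OF that] \<open>i < r\<close> \<open>j < p\<close> by simp
    then show ?thesis using assms that by (simp add: random_matrix_def cong: measurable_cong)
  qed
  then show ?thesis using X by (simp add: random_matrix_def)
qed

lemma random_matrix_mult:
  assumes "random_matrix P p q X" "random_matrix P q r Y"
  shows "random_matrix P p r (\<lambda>\<omega>. X \<omega> * Y \<omega>)"
proof -
  have X: "X \<omega> \<in> carrier_mat p q" and Y: "Y \<omega> \<in> carrier_mat q r" if "\<omega> \<in> space P" for \<omega>
    using assms that by (auto simp: random_matrix_def)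
  have "(\<lambda>\<omega>. (X \<omega> * Y \<omega>) $$ (i, j)) \<in> borel_measurable P" if "i < p" "j < r" for i j
  proof -
    have "(\<lambda>\<omega>. \<Sum>k<q. X \<omega> $$ (i, k) * Y \<omega> $$ (k, j)) \<in> borel_measurable P"
      using assms that by (intro borel_measurable_sum borel_measurable_times) (auto simp: random_matrix_def)
    then show ?thesis by (subst measurable_cong[OF mult_mat_entry[OF X Y that]]) auto
  qed
  moreover have "X \<omega> * Y \<omega> \<in> carrier_mat p r" if "\<omega> \<in> space P" for \<omega>
    by (rule mult_carrier_mat[OF X[OF that] Y[OF that]])
  ultimately show ?thesis by (simp add: random_matrix_def del: index_mult_mat(1))
qed

lemma random_matrix_kron_id:
  assumes "random_matrix P p q X"
  shows "random_matrix P (p * d) (q * d) (\<lambda>\<omega>. kron_id d (X \<omega>))"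
proof -
  have X: "X \<omega> \<in> carrier_mat p q" if "\<omega> \<in> space P" for \<omega> using assms that by (simp add: random_matrix_def)
  have "(\<lambda>\<omega>. kron_id d (X \<omega>) $$ (i, j)) \<in> borel_measurable P" if ij: "i < p * d" "j < q * d" for i j
  proof -
    have "kron_id d (X \<omega>) $$ (i, j) = (if i div p = j div q then X \<omega> $$ (i mod p, j mod q) else 0)"
      if "\<omega> \<in> space P" for \<omega>
      using X[OF that] ij by (simp add: kron_id_def)
    moreover have "i mod p < p" "j mod q < q" using ij by (auto intro!: mod_less_divisor Nat.gr0I)
    ultimately show ?thesis
      using assms by (cases "i div p = j div q") (simp_all add: random_matrix_def cong: measurable_cong)
  qed
  then show ?thesis using X kron_id_carrier by (simp add: random_matrix_def)
qed

text \<open>Needed for the measurability of the error: the output of the algorithm is determined by its frames.\<close>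

lemma random_matrix_left_frame:
  assumes "\<mu> 0 = 1" and "\<forall>k\<in>{1..n}. random_matrix P (\<mu> (k-1) * I k) (\<mu> k) (Q k)"
  shows "random_matrix P (\<Prod>k = 1..n. I k) (\<mu> n) (\<lambda>\<omega>. left_frame I (\<lambda>k. Q k \<omega>) n)"
  using assms(2)
proof (induction n)
  case 0
  then show ?case using random_matrix_const[of "1\<^sub>m 1" 1 1 P] assms(1) by simp
next
  case (Suc n)
  then have "random_matrix P (\<Prod>k = 1..n. I k) (\<mu> n) (\<lambda>\<omega>. left_frame I (\<lambda>k. Q k \<omega>) n)" by simp
  from random_matrix_mult[OF random_matrix_kron_id[OF this, of "I (Suc n)"], of "\<mu> (Suc n)" "Q (Suc n)"]
  show ?case using bspec[OF Suc.prems, of "Suc n"] by (simp add: mult.commute)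
qed

lemma frob_norm_diff_measurable:
  assumes M: "M \<in> carrier_mat p r" and X: "random_matrix P p r X"
  shows "(\<lambda>\<omega>. frob_norm (M - X \<omega>)) \<in> borel_measurable P"
proof -
  have "frob_norm (M - X \<omega>) = sqrt (\<Sum>i<p. \<Sum>j<r. (M $$ (i, j) - X \<omega> $$ (i, j)) * (M $$ (i, j) - X \<omega> $$ (i, j)))"
    if "\<omega> \<in> space P" for \<omega>
  proof -
    have c: "X \<omega> \<in> carrier_mat p r" using X that by (simp add: random_matrix_def)
    show ?thesis
      unfolding frob_norm_eq_sqrt frob_inner_carrier[OF minus_carrier_mat[OF c]]
      using c by (intro arg_cong[where f = sqrt] sum.cong refl) simp
  qed
  moreover have "(\<lambda>\<omega>. sqrt (\<Sum>i<p. \<Sum>j<r. (M $$ (i, j) - X \<omega> $$ (i, j)) * (M $$ (i, j) - X \<omega> $$ (i, j)))) \<in> borel_measurable P"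
  proof -
    have [measurable]: "(\<lambda>\<omega>. X \<omega> $$ (i, j)) \<in> borel_measurable P" if "i < p" "j < r" for i j
      using X that by (simp add: random_matrix_def)
    show ?thesis by measurable
  qed
  ultimately show ?thesis by (simp cong: measurable_cong)
qed

theorem theorem4p4:
  fixes N R :: nat
    and I \<mu> :: "nat \<Rightarrow> nat"
    and A :: tensor
    and P :: "'w measure"
    and \<Omega> As Q :: "nat \<Rightarrow> 'w \<Rightarrow> real mat"
    and P' :: "'v measure"
    and G :: "nat \<Rightarrow> 'v \<Rightarrow> real mat"
    and \<tau> :: real
    and a a' b b' \<alpha> :: "nat \<Rightarrow> real"
  assumes "N \<ge> 2" and "R > 0" and "\<mu> 0 = 1"
    and "\<forall>n\<in>{1..N}. I n > 0"
    and "\<forall>n\<in>{1..N-1}. \<mu> n > 0"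
    and "\<forall>n\<in>{1..N-1}. \<mu> n < \<mu> n + R \<and> \<mu> n + R < min (\<mu> (n-1) * I n) (\<Prod>k = n+1..N. I k)"
    and "\<forall>n\<in>{1..N-1}. real (\<mu> n + R) > (1 + 1 / ln (real (\<mu> n))) * real (\<mu> n)"
    and "prob_space P"
    and "\<forall>n\<in>{1..N-1}. std_gaussian_matrix P (\<Prod>k = n+1..N. I k) (\<mu> n + R) (\<Omega> n)"
    and "\<forall>n\<in>{1..N-1}. random_matrix P (\<mu> (n-1) * I n) (\<mu> n) (Q n)"
    and "\<forall>n\<in>{1..N-1}. prob_space.indep_set P
           (past_events P I N \<mu> R \<Omega> Q n) (drawn_events P I N \<mu> R \<Omega> n)"
    and "\<forall>\<omega>\<in>space P. rand_tt_run I N \<mu> R A (\<lambda>n. \<Omega> n \<omega>) (\<lambda>n. As n \<omega>) (\<lambda>n. Q n \<omega>)"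
    and "\<tau> \<ge> 1"
    and "\<forall>n\<in>{1..N-1}. a' n > 0 \<and> a n = 6 * \<tau> * sqrt (a' n + 4)"
    and "\<forall>n\<in>{1..N-1}. b n > 0 \<and> b' n > 0"
    and "prob_space P'"
    and "\<forall>n\<in>{1..N-1}. std_gaussian_matrix P' (\<mu> n) (\<mu> n + R) (G n)"
    and "\<forall>n\<in>{1..N-1}.
           measure P' {v \<in> space P'. sing_val (\<mu> n) (G n v) \<le> b n * sqrt (real (\<mu> n + R))}
             \<le> exp (- b' n * real (\<mu> n + R))"
    and "\<forall>n\<in>{1..N-1}. \<alpha> n =
           1 + sqrt ((a n)\<^sup>2 * real (\<Prod>k = n+1..N. I k) / ((b n)\<^sup>2 * real (\<mu> n + R)))
             + sqrt ((a n)\<^sup>2 * real (\<Prod>k = n+1..N. I k) / ((b n)\<^sup>2 * real (\<mu> n + R)))"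
  shows "measure P {\<omega> \<in> space P.
           tensor_frob_norm I N
             (\<lambda>i. A i - rand_tt_output I N \<mu> (\<lambda>n. As n \<omega>) (\<lambda>n. Q n \<omega>) i)
           \<le> 2 * (\<Sum>n = 1..N-1. \<alpha> n * sv_tail (\<mu> n + 1) (unfolding_mat I N n A))}
         \<ge> 1 - (\<Sum>n = 1..N-1. exp (- b' n * real (\<mu> n + R))
                              + exp (- a' n * real (\<Prod>k = n+1..N. I k)))"
proof -
  interpret prob_space P by (rule assms(8))
  define r where "r n = (\<Prod>k = n+1..N. I k)" for n
  define m where "m n = \<mu> n + R" for n
  define U where "U n = unfolding_mat I N n A" for n
  define T where "T n = sv_tail (Suc (\<mu> n)) (U n)" for n
  let ?n = "{1..N-1}"
  have \<mu>: "1 \<le> \<mu> n" "\<mu> n \<le> m n" "m n \<le> r n" "0 < m n" if "n \<in> ?n" for n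
    using bspec[OF assms(5) that] bspec[OF assms(6) that] by (auto simp: m_def r_def)
  have \<Omega>: "std_gaussian_matrix P (r n) (m n) (\<Omega> n)" if "n \<in> ?n" for n
    using assms(9) that by (simp add: r_def m_def)
  have G: "std_gaussian_matrix P' (\<mu> n) (m n) (G n)" if "n \<in> ?n" for n
    using assms(17) that by (simp add: m_def)
  have run: "rand_tt_run I N \<mu> R A (\<lambda>n. \<Omega> n \<omega>) (\<lambda>n. As n \<omega>) (\<lambda>n. Q n \<omega>)" if "\<omega> \<in> space P" for \<omega>
    using assms(12) that by blast
  have sweep: "tt_sweep I \<mu> N A (\<lambda>n. As n \<omega>) (\<lambda>n. Q n \<omega>)" if "\<omega> \<in> space P" for \<omega>
    using run[OF that] assms(3) unfolding rand_tt_run_def by unfold_locales auto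
  have U: "U n \<in> carrier_mat (\<Prod>k = 1..n. I k) (r n)" for n
    unfolding U_def r_def by (rule unfolding_mat_carrier)
  have T0: "0 \<le> T n" for n by (simp add: T_def sv_tail_def sum_nonneg)
  \<comment> \<open>The singular vectors are those of the unfolding of \<open>A\<close> and not those of \<open>As n\<close>, which would be random.\<close>
  have "\<exists>V. V \<in> carrier_mat (r n) (\<mu> n) \<and> V\<^sup>T * V = 1\<^sub>m (\<mu> n)
      \<and> frob_norm (U n - U n * (V * V\<^sup>T)) = T n" if "n \<in> ?n" for n
  proof -
    have "\<mu> n \<le> r n" using \<mu>[OF that] by simp
    from truncated_svd[OF U this] show ?thesis unfolding T_def by metis
  qed
  then obtain V where V: "\<And>n. n \<in> ?n \<Longrightarrow> V n \<in> carrier_mat (r n) (\<mu> n)"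
    "\<And>n. n \<in> ?n \<Longrightarrow> (V n)\<^sup>T * V n = 1\<^sub>m (\<mu> n)"
    "\<And>n. n \<in> ?n \<Longrightarrow> frob_norm (U n - U n * (V n * (V n)\<^sup>T)) = T n"
    by metis
  define c where "c n = b n * sqrt (real (m n))" for n
  define K where "K n = 6 * sqrt (a' n + 4) * sqrt (real (r n))" for n
  define B1 where "B1 n = {\<omega> \<in> space P. sing_val (\<mu> n) ((V n)\<^sup>T * \<Omega> n \<omega>) \<le> c n}" for n
  have B1: "B1 n \<in> events" "prob (B1 n) \<le> exp (- b' n * real (m n))" if n: "n \<in> ?n" for n
  proof -
    note law = std_gaussian_matrix_sing_val_law[OF assms(8) \<Omega>[OF n] V(1,2)[OF n] assms(16) G[OF n] \<mu>(1,2)[OF n], of "c n"]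
    show "B1 n \<in> events" unfolding B1_def by (rule law(1))
    show "prob (B1 n) \<le> exp (- b' n * real (m n))"
      unfolding B1_def law(2) using assms(18) n by (simp add: c_def m_def)
  qed
  have "\<exists>B. B \<in> events \<and> prob B \<le> exp (- a' n * real (r n))
      \<and> (\<forall>\<omega>\<in>space P - B. op_bounded (\<Omega> n \<omega>) (K n))" if n: "n \<in> ?n" for n
  proof -
    have "0 < a' n" using assms(14) n by simp
    from std_gaussian_matrix_op_norm_tail[OF assms(8) \<Omega>[OF n] \<mu>(4,3)[OF n] this]
    show ?thesis unfolding K_def by metis
  qed
  then obtain B2 where B2: "\<And>n. n \<in> ?n \<Longrightarrow> B2 n \<in> events" "\<And>n. n \<in> ?n \<Longrightarrow> prob (B2 n) \<le> exp (- a' n * real (r n))"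
    "\<And>n \<omega>. n \<in> ?n \<Longrightarrow> \<omega> \<in> space P - B2 n \<Longrightarrow> op_bounded (\<Omega> n \<omega>) (K n)"
    by metis
  have step_error: "frob_norm (As n \<omega> - Q n \<omega> * ((Q n \<omega>)\<^sup>T * As n \<omega>)) \<le> \<alpha> n * T n"
    if n: "n \<in> ?n" and \<omega>: "\<omega> \<in> space P" "\<omega> \<notin> B1 n" "\<omega> \<notin> B2 n" for n \<omega>
  proof -
    interpret tt_sweep I \<mu> N A "\<lambda>n. As n \<omega>" "\<lambda>n. Q n \<omega>" by (rule sweep[OF \<omega>(1)])
    have As: "As n \<omega> \<in> carrier_mat (\<mu> (n-1) * I n) (r n)"
      using As_carrier[OF n] by (simp add: r_def)
    have \<Omega>c: "\<Omega> n \<omega> \<in> carrier_mat (r n) (m n)"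
      using \<Omega>[OF n] \<omega>(1) by (simp add: std_gaussian_matrix_def random_matrix_def)
    have Q: "Q n \<omega> \<in> carrier_mat (\<mu> (n-1) * I n) (\<mu> n)" "(Q n \<omega>)\<^sup>T * Q n \<omega> = 1\<^sub>m (\<mu> n)"
      using frames[OF n] by auto
    obtain S where S: "S \<in> carrier_mat (\<mu> n) (m n)"
      "frob_norm (Q n \<omega> * S - As n \<omega> * \<Omega> n \<omega>) = sv_tail (Suc (\<mu> n)) (As n \<omega> * \<Omega> n \<omega>)"
    proof -
      have "\<exists>S\<in>carrier_mat (\<mu> n) (\<mu> n + R). frob_norm (Q n \<omega> * S - As n \<omega> * \<Omega> n \<omega>)
          = sv_tail (\<mu> n + 1) (As n \<omega> * \<Omega> n \<omega>)"
        using run[OF \<omega>(1)] n unfolding rand_tt_run_def Let_def by blast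
      then show ?thesis using that unfolding m_def Suc_eq_plus1 by blast
    qed
    have ab: "0 < a' n" "a n = 6 * \<tau> * sqrt (a' n + 4)" "0 < b n" using assms(14,15) n by auto
    have c: "0 < c n" using ab(3) \<mu>(4)[OF n] by (simp add: c_def)
    have K: "0 \<le> K n" using ab(1) by (simp add: K_def)
    have sv: "c n < sing_val (\<mu> n) ((V n)\<^sup>T * \<Omega> n \<omega>)"
      using \<omega>(1,2) by (simp add: B1_def)
    have "frob_norm (As n \<omega> - Q n \<omega> * ((Q n \<omega>)\<^sup>T * As n \<omega>))
        \<le> (1 + 2 * (K n / c n)) * frob_norm (As n \<omega> - As n \<omega> * (V n * (V n)\<^sup>T))"
      by (rule range_finder_error[OF As \<Omega>c V(1,2)[OF n] Q S B2(3)[OF n] K \<mu>(1,2)[OF n] c sv]) (use \<omega> in simp)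
    also have "\<dots> \<le> (1 + 2 * (K n / c n)) * T n"
    proof (rule mult_left_mono)
      have "V n \<in> carrier_mat (\<Prod>k = n+1..N. I k) (\<mu> n)" using V(1)[OF n] by (simp add: r_def)
      from compressed_projection_error[OF n this]
      show "frob_norm (As n \<omega> - As n \<omega> * (V n * (V n)\<^sup>T)) \<le> T n"
        using V(3)[OF n] by (simp add: U_def)
    qed (use K c in simp)
    also have "\<dots> \<le> \<alpha> n * T n"
    proof (rule mult_right_mono[OF _ T0])
      have "1 * (6 * sqrt (a' n + 4)) \<le> \<tau> * (6 * sqrt (a' n + 4))"
        using \<open>\<tau> \<ge> 1\<close> ab(1) by (intro mult_right_mono) auto
      then have a: "6 * sqrt (a' n + 4) \<le> a n" unfolding ab(2) by simp
      then have "0 \<le> a n" using ab(1) by (smt (verit) real_sqrt_ge_zero)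
      then have s: "sqrt ((a n)\<^sup>2 * real (r n) / ((b n)\<^sup>2 * real (m n))) = a n * sqrt (real (r n)) / c n"
        using ab(3) by (simp add: c_def real_sqrt_divide real_sqrt_mult)
      have "K n \<le> a n * sqrt (real (r n))" unfolding K_def using a by (rule mult_right_mono) simp
      then have "K n / c n \<le> a n * sqrt (real (r n)) / c n" using c by (simp add: divide_right_mono)
      moreover have "\<alpha> n = 1 + 2 * (a n * sqrt (real (r n)) / c n)"
        using assms(19) n s by (simp add: r_def m_def)
      ultimately show "1 + 2 * (K n / c n) \<le> \<alpha> n" by simp
    qed
    finally show ?thesis .
  qed
  define err where "err \<omega> = tensor_frob_norm I N (\<lambda>i. A i - rand_tt_output I N \<mu> (\<lambda>n. As n \<omega>) (\<lambda>n. Q n \<omega>) i)" for \<omega>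
  define bound where "bound = 2 * (\<Sum>n = 1..N-1. \<alpha> n * T n)"
  define E where "E = {\<omega> \<in> space P. err \<omega> \<le> bound}"
  define B where "B = (\<Union>n\<in>?n. B1 n \<union> B2 n)"
  have B: "B \<in> events" unfolding B_def using B1(1) B2(1) by auto
  have good: "space P - B \<subseteq> E"
  proof
    fix \<omega> assume "\<omega> \<in> space P - B"
    then have \<omega>: "\<omega> \<in> space P" "\<And>n. n \<in> ?n \<Longrightarrow> \<omega> \<notin> B1 n" "\<And>n. n \<in> ?n \<Longrightarrow> \<omega> \<notin> B2 n" by (auto simp: B_def)
    interpret tt_sweep I \<mu> N A "\<lambda>n. As n \<omega>" "\<lambda>n. Q n \<omega>" by (rule sweep[OF \<omega>(1)])
    have "err \<omega> \<le> (\<Sum>n = 1..N-1. frob_norm (As n \<omega> - Q n \<omega> * ((Q n \<omega>)\<^sup>T * As n \<omega>)))"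
      unfolding err_def output_error_eq[OF assms(1,4)] by (rule compression_error) simp
    also have "\<dots> \<le> (\<Sum>n = 1..N-1. \<alpha> n * T n)" by (intro sum_mono step_error[OF _ \<omega>(1)]) (use \<omega>(2,3) in auto)
    also have "\<dots> \<le> bound"
    proof -
      have "0 \<le> \<alpha> n" if "n \<in> ?n" for n unfolding bspec[OF assms(19) that]
        by (intro add_nonneg_nonneg real_sqrt_ge_zero divide_nonneg_nonneg mult_nonneg_nonneg zero_le_power2
            of_nat_0_le_iff zero_le_one)
      then have "0 \<le> (\<Sum>n = 1..N-1. \<alpha> n * T n)" using T0 by (intro sum_nonneg mult_nonneg_nonneg) auto
      then show ?thesis by (simp add: bound_def)
    qed
    finally show "\<omega> \<in> E" using \<omega>(1) by (simp add: E_def)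
  qed
  have E: "E \<in> events"
  proof -
    let ?L = "\<lambda>\<omega>. left_frame I (\<lambda>k. Q k \<omega>) (N-1)"
    have L: "random_matrix P (\<Prod>k = 1..N-1. I k) (\<mu> (N-1)) ?L"
      by (rule random_matrix_left_frame[of \<mu> "N-1" P I Q, OF assms(3,10)])
    have "random_matrix P (\<Prod>k = 1..N-1. I k) (r (N-1)) (\<lambda>\<omega>. ?L \<omega> * ((?L \<omega>)\<^sup>T * U (N-1)))"
      by (intro random_matrix_mult[OF L] random_matrix_mult[OF random_matrix_transpose[OF L]] random_matrix_const U)
    from frob_norm_diff_measurable[OF U this]
    have "{\<omega> \<in> space P. frob_norm (U (N-1) - ?L \<omega> * ((?L \<omega>)\<^sup>T * U (N-1))) \<le> bound} \<in> events"
      by measurable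
    also have "{\<omega> \<in> space P. frob_norm (U (N-1) - ?L \<omega> * ((?L \<omega>)\<^sup>T * U (N-1))) \<le> bound} = E"
      using tt_sweep.output_error_eq[OF sweep assms(1,4)] by (auto simp: E_def err_def U_def)
    finally show ?thesis .
  qed
  have "prob B \<le> (\<Sum>n = 1..N-1. prob (B1 n \<union> B2 n))"
    unfolding B_def by (rule finite_measure_subadditive_finite) (use B1(1) B2(1) in auto)
  also have "\<dots> \<le> (\<Sum>n = 1..N-1. exp (- b' n * real (m n)) + exp (- a' n * real (r n)))"
  proof (rule sum_mono)
    fix n assume n: "n \<in> ?n"
    have "prob (B1 n \<union> B2 n) \<le> prob (B1 n) + prob (B2 n)"
      by (rule measure_Un_le[OF B1(1)[OF n] B2(1)[OF n]])
    then show "prob (B1 n \<union> B2 n) \<le> exp (- b' n * real (m n)) + exp (- a' n * real (r n))"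
      using B1(2)[OF n] B2(2)[OF n] by linarith
  qed
  finally have "1 - (\<Sum>n = 1..N-1. exp (- b' n * real (m n)) + exp (- a' n * real (r n))) \<le> 1 - prob B" by simp
  also have "\<dots> = prob (space P - B)" by (rule prob_compl[OF B, symmetric])
  also have "\<dots> \<le> prob E" by (rule finite_measure_mono[OF good E])
  finally show ?thesis by (simp only: E_def err_def bound_def T_def U_def r_def m_def Suc_eq_plus1)
qed
end
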